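(* Let $(W,\lambda)$ be a Liouville domain. For any $H,G\in\mathcal H^+(W,\lambda)$, with associated tube domains ${\rm U}(H)=(W_H,\hat\lambda)$ and ${\rm U}(G)=(W_G,\hat\lambda)$, we have $$d_{\rm SBM}({\rm U}(H),{\rm U}(G))\le d_{\rm T}(H,G).$$
   Context: A Liouville domain $(W,\lambda)$ is a compact exact symplectic manifold with boundary (symplectic form $d\lambda$) whose Liouville vector field $Y_\lambda$, defined by $\iota_{Y_\lambda}d\lambda=\lambda$, is outward transverse to $\partial W$; its flow is $\mathscr L_\lambda^t$, and for $0<a\le 1$ one sets $aW:=\mathscr L_\lambda^{\ln a}(W)$. A Liouville embedding $\varphi:(W,\lambda_W)\hookrightarrow (V,\lambda_V)$ between Liouville domains of equal dimension is an embedding with $\varphi^*\lambda_V-\lambda_W$ exact; $\hookrightarrow$ always denotes Liouville embeddings. ${\rm Symp}(W,\lambda)$ is the group of diffeomorphisms $\psi$ of $W$ with $\psi^*\lambda=\lambda$. For Liouville domains $(W,\lambda_W),(V,\lambda_V)$ of the same dimension, $d_{\rm SBM}((W,\lambda_W),(V,\lambda_V))$ is the infimum of $\ln C\ge 0$ such that there exist Liouville embeddings $i_{W,V}:\frac1C W\hookrightarrow V$ with $\frac1{C^2}V\subset i_{W,V}(\frac1C W)\subset V$ and $i_{V,W}:\frac1C V\hookrightarrow W$ with $\frac1{C^2}W\subset i_{V,W}(\frac1C V)\subset W$. Let $S^1=\mathbb R/\mathbb Z$. For smooth $H:S^1\times W\to\mathbb R$ put $H_t=H(t,\cdot)$, define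 $X_{H_t}$ by $\iota_{X_{H_t}}d\lambda=dH_t$, and $\tau_{\lambda,H}(t,w)=\lambda(X_{H_t}(w))+H(t,w)$. $\mathcal H(W,\lambda)$ is the set of smooth $H:S^1\times W\to\mathbb R$ which are autonomous (independent of $t$) in a neighborhood of $\partial W$, vanish on $\partial W$, and satisfy $\tau_{\lambda,H}>0$ everywhere. $\mathcal H^+(W,\lambda)=\{H\in\mathcal H(W,\lambda)\mid \lambda(X_{H_t})\ge0\text{ on }S^1\times W\}$. For $H\in\mathcal H(W,\lambda)$ the tube is $W_H=\{(w,z)\in W\times\mathbb C\mid z=re^{2\pi i t},\ \pi|z|^2\le H(t,w)\}$ with the 1-form $\hat\lambda=\lambda+\pi r^2dt$; $(W_H,\hat\lambda)$ is a Liouville domain, denoted ${\rm U}(H)$. The Thompson-type distance is $d_{\rm T}(H,G)=\inf\{\ln C\ge0\mid \exists\,\varphi\in{\rm Symp}(W,\lambda)\text{ with }\frac1C H\le G\circ\varphi\le CH\}$, where $(G\circ\varphi)(t,w)=G(t,\varphi(w))$. *)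

theory Defs
  imports "HOL-Analysis.Analysis"
begin

section \<open>Smooth functions between Euclidean spaces\<close>

text \<open>Meaningful for open \<open>S\<close> and a finite-dimensional domain.\<close>

primrec Ck_on :: "nat \<Rightarrow> ('a::real_normed_vector \<Rightarrow> 'b::real_normed_vector) \<Rightarrow> 'a set \<Rightarrow> bool"
  where
    "Ck_on 0 f S \<longleftrightarrow> continuous_on S f"
  | "Ck_on (Suc k) f S \<longleftrightarrow>
       (\<forall>x\<in>S. f differentiable (at x)) \<and>
       (\<forall>v. Ck_on k (\<lambda>x. frechet_derivative f (at x) v) S)"

text \<open>On an arbitrary subset, smoothness means local extendability to smooth functions on open sets.\<close>

definition smooth_on :: "'a::euclidean_space set \<Rightarrow> ('a \<Rightarrow> 'b::euclidean_space) \<Rightarrow> bool"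
  where "smooth_on S f \<longleftrightarrow>
    (\<forall>x\<in>S. \<exists>T g. open T \<and> x \<in> T \<and> (\<forall>k. Ck_on k g T) \<and> (\<forall>y\<in>S \<inter> T. g y = f y))"


section \<open>Smooth manifolds with boundary\<close>

text \<open>A chart is a pair of its domain and its coordinate map; only the values of the
  coordinate map on the domain matter.\<close>

type_synonym ('a, 'e) chart = "'a set \<times> ('a \<Rightarrow> 'e)"

record ('a, 'e) manifold =
  mspace :: "'a topology"
  atlas :: "('a, 'e) chart set"

abbreviation carr :: "('a, 'e) manifold \<Rightarrow> 'a set"
  where "carr M \<equiv> topspace (mspace M)"

abbreviation cdom :: "('a, 'e) chart \<Rightarrow> 'a set"
  where "cdom c \<equiv> fst c"

abbreviation cmap :: "('a, 'e) chart \<Rightarrow> 'a \<Rightarrow> 'e"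
  where "cmap c \<equiv> snd c"

abbreviation cimg :: "('a, 'e) chart \<Rightarrow> 'e set"
  where "cimg c \<equiv> cmap c ` cdom c"

definition cinv :: "('a, 'e) chart \<Rightarrow> 'e \<Rightarrow> 'a"
  where "cinv c = inv_into (cdom c) (cmap c)"

definition half_space :: "'e::euclidean_space \<Rightarrow> 'e set"
  where "half_space b = {x. 0 \<le> x \<bullet> b}"

text \<open>Any of the coordinate half-spaces is allowed as a local model; up to a permutation of
  coordinates this is the usual model.  It makes products with boundaryless manifolds literal.\<close>

definition model_open :: "'e::euclidean_space set \<Rightarrow> bool"
  where "model_open S \<longleftrightarrow> open S \<or> (\<exists>b\<in>Basis. openin (top_of_set (half_space b)) S)"

definition smooth_manifold :: "('a, 'e::euclidean_space) manifold \<Rightarrow> bool"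
  where "smooth_manifold M \<longleftrightarrow>
    Hausdorff_space (mspace M) \<and> second_countable (mspace M) \<and>
    carr M = (\<Union>c\<in>atlas M. cdom c) \<and>
    (\<forall>c\<in>atlas M. openin (mspace M) (cdom c) \<and> model_open (cimg c) \<and>
       homeomorphic_map (subtopology (mspace M) (cdom c)) (top_of_set (cimg c)) (cmap c)) \<and>
    (\<forall>c\<in>atlas M. \<forall>c'\<in>atlas M.
       smooth_on (cmap c ` (cdom c \<inter> cdom c')) (cmap c' \<circ> cinv c))"

definition manifold_boundary :: "('a, 'e::euclidean_space) manifold \<Rightarrow> 'a set"
  where "manifold_boundary M =
    {p. \<exists>c\<in>atlas M. \<exists>b\<in>Basis. p \<in> cdom c \<and>
       openin (top_of_set (half_space b)) (cimg c) \<and> cmap c p \<bullet> b = 0}"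

definition euclidean_manifold :: "('v, 'v::euclidean_space) manifold"
  where "euclidean_manifold = \<lparr>mspace = euclidean, atlas = {(UNIV, id)}\<rparr>"

text \<open>A manifold with boundary whenever at most one of the factors has boundary.\<close>

definition prod_manifold ::
    "('a, 'e) manifold \<Rightarrow> ('b, 'f) manifold \<Rightarrow> ('a \<times> 'b, 'e \<times> 'f) manifold"
  where "prod_manifold M N =
    \<lparr>mspace = prod_topology (mspace M) (mspace N),
     atlas = {(cdom c \<times> cdom d, map_prod (cmap c) (cmap d)) | c d. c \<in> atlas M \<and> d \<in> atlas N}\<rparr>"

text \<open>Smooth maps defined on a subset \<open>D\<close> of \<open>M\<close> (locally the restriction, in coordinates, of a
  smooth map); \<open>D = carr M\<close> gives smooth maps of manifolds.\<close>

definition smooth_map_on ::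
    "('a, 'e::euclidean_space) manifold \<Rightarrow> 'a set \<Rightarrow> ('b, 'f::euclidean_space) manifold \<Rightarrow>
     ('a \<Rightarrow> 'b) \<Rightarrow> bool"
  where "smooth_map_on M D N f \<longleftrightarrow>
    continuous_map (subtopology (mspace M) D) (mspace N) f \<and>
    (\<forall>c\<in>atlas M. \<forall>c'\<in>atlas N.
       smooth_on (cmap c ` (cdom c \<inter> D \<inter> f -` cdom c')) (cmap c' \<circ> f \<circ> cinv c))"

text \<open>The smooth structure induced on a codimension-0 domain \<open>D \<subseteq> carr M\<close> with smooth boundary:
  all charts of \<open>D\<close> that are diffeomorphisms with respect to the smooth structure of \<open>M\<close>.
  \<open>D\<close> may touch the boundary of \<open>M\<close>.\<close>

definition domain_manifold ::
    "('a, 'e::euclidean_space) manifold \<Rightarrow> 'a set \<Rightarrow> ('a, 'e) manifold"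
  where "domain_manifold M D =
    \<lparr>mspace = subtopology (mspace M) D,
     atlas = {c. openin (subtopology (mspace M) D) (cdom c) \<and> inj_on (cmap c) (cdom c) \<and>
                 model_open (cimg c) \<and>
                 smooth_map_on M (cdom c) euclidean_manifold (cmap c) \<and>
                 smooth_map_on euclidean_manifold (cimg c) M (cinv c)}\<rparr>"


section \<open>Tangent vectors, differentials and 1-forms\<close>

text \<open>The tangent space at \<open>p\<close> is identified with the model space \<open>'e\<close> through the preferred
  chart \<open>chart_at M p\<close>.  Thus vector fields are functions \<open>'a \<Rightarrow> 'e\<close> and 1-forms are
  functions \<open>'a \<Rightarrow> 'e \<Rightarrow> real\<close>.\<close>

definition chart_at :: "('a, 'e) manifold \<Rightarrow> 'a \<Rightarrow> ('a, 'e) chart"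
  where "chart_at M p = (SOME c. c \<in> atlas M \<and> p \<in> cdom c)"

definition has_mderiv_on ::
    "('a, 'e::euclidean_space) manifold \<Rightarrow> 'a set \<Rightarrow> ('b, 'f::euclidean_space) manifold \<Rightarrow>
     ('a \<Rightarrow> 'b) \<Rightarrow> 'a \<Rightarrow> ('e \<Rightarrow> 'f) \<Rightarrow> bool"
  where "has_mderiv_on M D N f p L \<longleftrightarrow>
    ((cmap (chart_at N (f p)) \<circ> f \<circ> cinv (chart_at M p)) has_derivative L)
      (at (cmap (chart_at M p) p) within cmap (chart_at M p) ` (cdom (chart_at M p) \<inter> D))"

definition mderiv ::
    "('a, 'e::euclidean_space) manifold \<Rightarrow> ('b, 'f::euclidean_space) manifold \<Rightarrow>
     ('a \<Rightarrow> 'b) \<Rightarrow> 'a \<Rightarrow> 'e \<Rightarrow> 'f"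
  where "mderiv M N f p = (SOME L. has_mderiv_on M (carr M) N f p L)"

abbreviation mdiff ::
    "('a, 'e::euclidean_space) manifold \<Rightarrow> ('a \<Rightarrow> 'v::euclidean_space) \<Rightarrow> 'a \<Rightarrow> 'e \<Rightarrow> 'v"
  where "mdiff M f \<equiv> mderiv M euclidean_manifold f"

text \<open>Local expression of a 1-form in the chart \<open>c\<close>, as a function of the base point \<open>x\<close>
  in the chart image and of a vector \<open>v\<close> in the coordinates of \<open>c\<close>.\<close>

definition form_in_chart ::
    "('a, 'e::euclidean_space) manifold \<Rightarrow> ('a \<Rightarrow> 'e \<Rightarrow> real) \<Rightarrow> ('a, 'e) chart \<Rightarrow> 'e \<Rightarrow> 'e \<Rightarrow> real"
  where "form_in_chart M \<theta> c x v =
    \<theta> (cinv c x)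
      (frechet_derivative (cmap (chart_at M (cinv c x)) \<circ> cinv c) (at x within cimg c) v)"

definition smooth_one_form :: "('a, 'e::euclidean_space) manifold \<Rightarrow> ('a \<Rightarrow> 'e \<Rightarrow> real) \<Rightarrow> bool"
  where "smooth_one_form M \<theta> \<longleftrightarrow>
    (\<forall>p\<in>carr M. linear (\<theta> p)) \<and>
    (\<forall>c\<in>atlas M. \<forall>v. smooth_on (cimg c) (\<lambda>x. form_in_chart M \<theta> c x v))"

text \<open>\<open>d\<theta>(u,v) = u(\<theta>(v)) - v(\<theta>(u))\<close> for constant vector fields \<open>u\<close>, \<open>v\<close> in the
  coordinates of the preferred chart at \<open>p\<close>.\<close>

definition ext_deriv ::
    "('a, 'e::euclidean_space) manifold \<Rightarrow> ('a \<Rightarrow> 'e \<Rightarrow> real) \<Rightarrow> 'a \<Rightarrow> 'e \<Rightarrow> 'e \<Rightarrow> real"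
  where "ext_deriv M \<theta> p u v =
    (let c = chart_at M p; F = at (cmap c p) within cimg c in
       frechet_derivative (\<lambda>x. form_in_chart M \<theta> c x v) F u
       - frechet_derivative (\<lambda>x. form_in_chart M \<theta> c x u) F v)"

text \<open>Only for \<open>p\<close> in the boundary; the chart maps to the half-space \<open>0 \<le> x \<bullet> b\<close>.\<close>

definition outward_pointing :: "('a, 'e::euclidean_space) manifold \<Rightarrow> 'a \<Rightarrow> 'e \<Rightarrow> bool"
  where "outward_pointing M p v \<longleftrightarrow>
    (\<exists>b\<in>Basis. openin (top_of_set (half_space b)) (cimg (chart_at M p)) \<and>
       cmap (chart_at M p) p \<bullet> b = 0 \<and> v \<bullet> b < 0)"

definition integral_curve_on ::
    "('a, 'e::euclidean_space) manifold \<Rightarrow> ('a \<Rightarrow> 'e) \<Rightarrow> real set \<Rightarrow> (real \<Rightarrow> 'a) \<Rightarrow> bool"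
  where "integral_curve_on M Y I \<gamma> \<longleftrightarrow>
    continuous_map (top_of_set I) (mspace M) \<gamma> \<and>
    (\<forall>t\<in>I. ((\<lambda>s. cmap (chart_at M (\<gamma> t)) (\<gamma> s)) has_vector_derivative Y (\<gamma> t)) (at t within I))"


section \<open>Liouville domains\<close>

type_synonym ('a, 'e) liouville = "('a, 'e) manifold \<times> ('a \<Rightarrow> 'e \<Rightarrow> real)"

abbreviation lcarr :: "('a, 'e) liouville \<Rightarrow> 'a set"
  where "lcarr W \<equiv> carr (fst W)"

definition liouville_field :: "('a, 'e::euclidean_space) liouville \<Rightarrow> 'a \<Rightarrow> 'e"
  where "liouville_field W p =
    (THE v. \<forall>u. ext_deriv (fst W) (snd W) p v u = snd W p u)"

text \<open>The 2-form \<open>d\<lambda>\<close> is automatically closed, so being symplectic means nondegenerate.\<close>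

definition liouville_domain :: "('a, 'e::euclidean_space) liouville \<Rightarrow> bool"
  where "liouville_domain W \<longleftrightarrow>
    smooth_manifold (fst W) \<and> compact_space (mspace (fst W)) \<and>
    smooth_one_form (fst W) (snd W) \<and>
    (\<forall>p\<in>lcarr W. \<forall>v. v \<noteq> 0 \<longrightarrow> (\<exists>u. ext_deriv (fst W) (snd W) p v u \<noteq> 0)) \<and>
    (\<forall>p\<in>manifold_boundary (fst W). outward_pointing (fst W) p (liouville_field W p))"

text \<open>\<open>liouville_flow W t q p\<close>: the time-\<open>t\<close> flow of the Liouville field is defined at \<open>q\<close>
  and sends \<open>q\<close> to \<open>p\<close>.\<close>

definition liouville_flow :: "('a, 'e::euclidean_space) liouville \<Rightarrow> real \<Rightarrow> 'a \<Rightarrow> 'a \<Rightarrow> bool"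
  where "liouville_flow W t q p \<longleftrightarrow>
    (\<exists>\<gamma>. integral_curve_on (fst W) (liouville_field W) (closed_segment 0 t) \<gamma> \<and>
         \<gamma> 0 = q \<and> \<gamma> t = p)"

text \<open>The image \<open>aW\<close> of \<open>W\<close> under the time-\<open>ln a\<close> Liouville flow, for \<open>0 < a \<le> 1\<close>.\<close>

definition scaled :: "real \<Rightarrow> ('a, 'e::euclidean_space) liouville \<Rightarrow> 'a set"
  where "scaled a W = {p. \<exists>q\<in>lcarr W. liouville_flow W (ln a) q p}"

text \<open>\<open>\<phi>\<close> is a Liouville embedding into \<open>V\<close> of the codimension-0 domain \<open>D\<close> in \<open>W\<close> (such as
  \<open>D = scaled a W\<close>), carrying the smooth structure and the 1-form restricted from \<open>W\<close>; its
  tangent spaces are those of \<open>W\<close>, and differentials are taken within \<open>D\<close>.  The last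
  conjunct says \<open>\<phi>\<^sup>*\<lambda>\<^sub>V - \<lambda>\<^sub>W = df\<close> on \<open>D\<close>.\<close>

definition liouville_embedding ::
    "('a, 'e::euclidean_space) liouville \<Rightarrow> 'a set \<Rightarrow> ('b, 'e) liouville \<Rightarrow> ('a \<Rightarrow> 'b) \<Rightarrow> bool"
  where "liouville_embedding W D V \<phi> \<longleftrightarrow>
    smooth_map_on (fst W) D (fst V) \<phi> \<and>
    embedding_map (subtopology (mspace (fst W)) D) (mspace (fst V)) \<phi> \<and>
    (\<forall>p\<in>D. \<exists>L. has_mderiv_on (fst W) D (fst V) \<phi> p L \<and> inj L) \<and>
    (\<exists>f. smooth_map_on (fst W) D euclidean_manifold f \<and>
       (\<forall>p\<in>D. \<exists>L K. has_mderiv_on (fst W) D (fst V) \<phi> p L \<and>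
          has_mderiv_on (fst W) D euclidean_manifold f p K \<and>
          (\<forall>v. snd V (\<phi> p) (L v) - snd W p v = K v)))"

definition Symp :: "('a, 'e::euclidean_space) liouville \<Rightarrow> ('a \<Rightarrow> 'a) set"
  where "Symp W = {\<psi>. bij_betw \<psi> (lcarr W) (lcarr W) \<and>
    smooth_map_on (fst W) (lcarr W) (fst W) \<psi> \<and>
    smooth_map_on (fst W) (lcarr W) (fst W) (inv_into (lcarr W) \<psi>) \<and>
    (\<forall>p\<in>lcarr W. \<forall>v. snd W (\<psi> p) (mderiv (fst W) (fst W) \<psi> p v) = snd W p v)}"

text \<open>The symplectic Banach--Mazur distance; it is \<open>\<infinity>\<close> if no \<open>C\<close> is admissible.
  The condition \<open>ln C \<ge> 0\<close> reads \<open>C \<ge> 1\<close>.\<close>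

definition SBM_admissible ::
    "('a, 'e::euclidean_space) liouville \<Rightarrow> ('b, 'e) liouville \<Rightarrow> real \<Rightarrow> bool"
  where "SBM_admissible W V C \<longleftrightarrow>
    (\<exists>i. liouville_embedding W (scaled (1 / C) W) V i \<and>
         scaled (1 / C\<^sup>2) V \<subseteq> i ` scaled (1 / C) W \<and> i ` scaled (1 / C) W \<subseteq> lcarr V)"

definition d_SBM :: "('a, 'e::euclidean_space) liouville \<Rightarrow> ('b, 'e) liouville \<Rightarrow> ereal"
  where "d_SBM W V =
    Inf {ereal (ln C) | C. 1 \<le> C \<and> SBM_admissible W V C \<and> SBM_admissible V W C}"


section \<open>Time-periodic Hamiltonians and their tubes\<close>

text \<open>Functions on \<open>(\<real>/\<int>) \<times> W\<close> are represented by functions \<open>H t w\<close> that are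
  1-periodic in \<open>t\<close>.\<close>

definition hamiltonian_field ::
    "('a, 'e::euclidean_space) liouville \<Rightarrow> ('a \<Rightarrow> real) \<Rightarrow> 'a \<Rightarrow> 'e"
  where "hamiltonian_field W h p =
    (THE v. \<forall>u. ext_deriv (fst W) (snd W) p v u = mdiff (fst W) h p u)"

definition tau ::
    "('a, 'e::euclidean_space) liouville \<Rightarrow> (real \<Rightarrow> 'a \<Rightarrow> real) \<Rightarrow> real \<Rightarrow> 'a \<Rightarrow> real"
  where "tau W H t w = snd W w (hamiltonian_field W (H t) w) + H t w"

definition Ham :: "('a, 'e::euclidean_space) liouville \<Rightarrow> (real \<Rightarrow> 'a \<Rightarrow> real) set"
  where "Ham W = {H.
    (\<forall>t. \<forall>w\<in>lcarr W. H (t + 1) w = H t w) \<and>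
    smooth_map_on (prod_manifold euclidean_manifold (fst W)) (UNIV \<times> lcarr W)
      euclidean_manifold (\<lambda>(t, w). H t w) \<and>
    (\<exists>U. openin (mspace (fst W)) U \<and> manifold_boundary (fst W) \<subseteq> U \<and>
       (\<forall>w\<in>U. \<forall>s t. H s w = H t w)) \<and>
    (\<forall>t. \<forall>w\<in>manifold_boundary (fst W). H t w = 0) \<and>
    (\<forall>t. \<forall>w\<in>lcarr W. 0 < tau W H t w)}"

definition Ham_plus :: "('a, 'e::euclidean_space) liouville \<Rightarrow> (real \<Rightarrow> 'a \<Rightarrow> real) set"
  where "Ham_plus W =
    {H \<in> Ham W. \<forall>t. \<forall>w\<in>lcarr W. 0 \<le> snd W w (hamiltonian_field W (H t) w)}"

definition tube_set :: "('a, 'e) liouville \<Rightarrow> (real \<Rightarrow> 'a \<Rightarrow> real) \<Rightarrow> ('a \<times> complex) set"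
  where "tube_set W H = {(w, z). w \<in> lcarr W \<and>
    (\<exists>r t. 0 \<le> r \<and> z = of_real r * cis (2 * pi * t) \<and> pi * (cmod z)\<^sup>2 \<le> H t w)}"

definition tube_manifold ::
    "('a, 'e::euclidean_space) liouville \<Rightarrow> (real \<Rightarrow> 'a \<Rightarrow> real) \<Rightarrow>
     ('a \<times> complex, 'e \<times> complex) manifold"
  where "tube_manifold W H =
    domain_manifold (prod_manifold (fst W) euclidean_manifold) (tube_set W H)"

text \<open>With \<open>z = r e\<^sup>2\<^sup>\<pi>\<^sup>i\<^sup>t\<close> one has \<open>dt(\<zeta>) = Im (\<zeta> / z) / (2 \<pi>)\<close> for \<open>z \<noteq> 0\<close>; the
  convention \<open>\<zeta> / 0 = 0\<close> yields the smooth extension of \<open>\<pi> r\<^sup>2 dt\<close> by \<open>0\<close> at the origin.\<close>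

definition angular_form :: "complex \<Rightarrow> complex \<Rightarrow> real"
  where "angular_form z \<zeta> = pi * (cmod z)\<^sup>2 * (Im (\<zeta> / z) / (2 * pi))"

text \<open>\<open>\<lambda> + \<pi> r\<^sup>2 dt\<close>, pulled back to the tube by its projections to \<open>W\<close> and to the plane.\<close>

definition tube_form ::
    "('a, 'e::euclidean_space) liouville \<Rightarrow> (real \<Rightarrow> 'a \<Rightarrow> real) \<Rightarrow>
     'a \<times> complex \<Rightarrow> 'e \<times> complex \<Rightarrow> real"
  where "tube_form W H p v =
    snd W (fst p) (mderiv (tube_manifold W H) (fst W) fst p v)
    + angular_form (snd p) (mdiff (tube_manifold W H) snd p v)"

definition tube ::
    "('a, 'e::euclidean_space) liouville \<Rightarrow> (real \<Rightarrow> 'a \<Rightarrow> real) \<Rightarrow>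
     ('a \<times> complex, 'e \<times> complex) liouville"
  where "tube W H = (tube_manifold W H, tube_form W H)"

definition d_T ::
    "('a, 'e::euclidean_space) liouville \<Rightarrow> (real \<Rightarrow> 'a \<Rightarrow> real) \<Rightarrow> (real \<Rightarrow> 'a \<Rightarrow> real) \<Rightarrow> ereal"
  where "d_T W H G =
    Inf {ereal (ln C) | C. 1 \<le> C \<and>
      (\<exists>\<phi>\<in>Symp W. \<forall>t. \<forall>w\<in>lcarr W.
         (1 / C) * H t w \<le> G t (\<phi> w) \<and> G t (\<phi> w) \<le> C * H t w)}"

end

(* A symplectomorphism phi with H / C <= G o phi <= C H induces the embedding (w, z) |-> (phi w, z)
   of the tube over H into the cylinder over W; phi^-1 gives the map in the other direction.  In the
   tube the Liouville flow is (w, z) |-> (L^s w, e^(s/2) z), and H does not increase along L^s because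
   dH(Y) = - lambda(X_H) <= 0.  Hence a point of (1/C) W_H satisfies
   pi |z|^2 <= H(t, L^(ln C) w) / C <= H(t, w) / C <= G(t, phi w), and similarly for the inner
   inclusion.  Only given integral curves are mapped, shifted and projected, so neither existence nor
   uniqueness of flows is needed.  What does need work is that the tube carries charts at all, also at
   its boundary: there H - pi |z|^2 is a regular function and serves as a coordinate. *)

theory Submission
  imports Defs
begin

section \<open>Smooth functions\<close>

text \<open>A tangent vector of the tube is expressed in a preferred chart of which only membership
  in the atlas is known. Computations on the tube therefore go through the differentials
  \<open>pr1\<close> and \<open>pr2\<close> of the projections to W and to the plane. Jointly they
  are an isomorphism; in these terms the tube form is a sum, its Liouville field is (Y, z/2) and the
  embedding acts by (D\<phi>, id). The Liouville field is defined through d\<lambda>, so d has to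
  commute with pullback along the projections and along \<phi>, up to the boundary; hence the
  symmetry of second derivatives. Regularity of H - pi |z|^2 off the axis comes from its radial
  derivative. On the axis above the boundary, H = 0 turns tau > 0 into \<lambda>(X_H) > 0, so dH(Y)
  < 0, while Y points outward. At an interior minimum of H one has X_H = 0 and tau = H; hence H > 0
  off the boundary. The square in 1/C^2 arises because flowing for time ln C pays for the factor C
  in G o \<phi> <= C H, and another ln C is left over as flow inside the tube over H.\<close>

lemma Ck_on_subset: "Ck_on k f S \<Longrightarrow> T \<subseteq> S \<Longrightarrow> Ck_on k f T"
proof (induction k arbitrary: f)
  case 0 then show ?case by (auto intro: continuous_on_subset)
next
  case (Suc k)
  from Suc.prems Suc.IH show ?case by auto
qed

lemma Ck_on_cong:
  assumes "Ck_on k f S" "open S" "\<And>x. x \<in> S \<Longrightarrow> f x = g x"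
  shows "Ck_on k g S"
  using assms
proof (induction k arbitrary: f g)
  case 0 then show ?case by (simp cong: continuous_on_cong)
next
  case (Suc k)
  have d: "g differentiable (at x)" "frechet_derivative g (at x) = frechet_derivative f (at x)"
    if "x \<in> S" for x
  proof -
    have "f differentiable (at x)" using Suc.prems that by simp
    then show "g differentiable (at x)"
      unfolding differentiable_def
      using has_derivative_transform_within_open[OF _ Suc.prems(2) that] Suc.prems(3) by metis
    show "frechet_derivative g (at x) = frechet_derivative f (at x)"
      using frechet_derivative_transform_within_open[OF \<open>f differentiable (at x)\<close> Suc.prems(2) that]
        Suc.prems(3) by metis
  qed
  have "Ck_on k (\<lambda>x. frechet_derivative g (at x) v) S" for v
    by (rule Suc.IH[of "\<lambda>x. frechet_derivative f (at x) v"]) (use Suc.prems d in simp_all)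
  then show ?case using d by simp
qed

text \<open>The recursion peels off derivatives without recording lower orders, so lowering the
  order is an induction that ends with differentiability implying continuity.\<close>

lemma Ck_on_SucD: "Ck_on (Suc k) f S \<Longrightarrow> Ck_on k f S"
proof (induction k arbitrary: f)
  case 0
  then show ?case
    by (auto intro!: continuous_at_imp_continuous_on differentiable_imp_continuous_within)
next
  case (Suc k)
  show ?case
    unfolding Ck_on.simps(2)[of k]
  proof (intro conjI allI)
    show "\<forall>x\<in>S. f differentiable at x" using Suc.prems by simp
    fix v
    show "Ck_on k (\<lambda>x. frechet_derivative f (at x) v) S"
      using Suc.prems by (intro Suc.IH) (simp del: Ck_on.simps add: Ck_on.simps(2)[of "Suc k"])
  qed
qed

lemma Ck_on_SucI:
  assumes "open S" "\<And>x. x \<in> S \<Longrightarrow> (f has_derivative f' x) (at x)"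
    and "\<And>v. Ck_on k (\<lambda>x. f' x v) S"
  shows "Ck_on (Suc k) f S"
proof -
  have "frechet_derivative f (at x) = f' x" if "x \<in> S" for x
    using frechet_derivative_at[OF assms(2)[OF that]] by simp
  then have "Ck_on k (\<lambda>x. frechet_derivative f (at x) v) S" for v
    by (intro Ck_on_cong[OF assms(3)[of v] assms(1)]) auto
  then show ?thesis using assms(2) by (auto simp: differentiable_def)
qed

lemma Ck_on_SucE:
  assumes "Ck_on (Suc k) f S"
  shows "x \<in> S \<Longrightarrow> (f has_derivative frechet_derivative f (at x)) (at x)"
    and "Ck_on k (\<lambda>x. frechet_derivative f (at x) v) S"
proof -
  show "(f has_derivative frechet_derivative f (at x)) (at x)" if "x \<in> S"
    unfolding frechet_derivative_works[symmetric] using assms that by simp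
  show "Ck_on k (\<lambda>x. frechet_derivative f (at x) v) S"
    using assms by simp
qed

lemma Ck_on_const: "open S \<Longrightarrow> Ck_on k (\<lambda>x. c) S"
proof (induction k arbitrary: c)
  case (Suc k)
  then show ?case by simp
qed simp

lemma Ck_on_bounded_linear:
  assumes "bounded_linear L" "open S" "Ck_on k f S"
  shows "Ck_on k (\<lambda>x. L (f x)) S"
  using assms(3)
proof (induction k arbitrary: f)
  case 0 then show ?case using assms(1) by (simp add: bounded_linear.continuous_on)
next
  case (Suc k)
  note f = Ck_on_SucE[OF Suc.prems]
  show ?case
    by (rule Ck_on_SucI[OF assms(2) bounded_linear.has_derivative[OF assms(1) f(1)]])
      (auto intro: Suc.IH f(2))
qed

lemma Ck_on_add:
  assumes "open S" "Ck_on k f S" "Ck_on k g S"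
  shows "Ck_on k (\<lambda>x. f x + g x) S"
  using assms(2,3)
proof (induction k arbitrary: f g)
  case 0 then show ?case by (simp add: continuous_on_add)
next
  case (Suc k)
  note f = Ck_on_SucE[OF Suc.prems(1)] and g = Ck_on_SucE[OF Suc.prems(2)]
  show ?case
    by (rule Ck_on_SucI[OF assms(1) has_derivative_add[OF f(1) g(1)]])
      (auto intro: Suc.IH f(2) g(2))
qed

lemma Ck_on_sum:
  assumes "open S" "\<And>i. i \<in> I \<Longrightarrow> Ck_on k (f i) S"
  shows "Ck_on k (\<lambda>x. \<Sum>i\<in>I. f i x) S"
proof (cases "finite I")
  case True
  then show ?thesis using assms
    by (induction I) (auto intro!: Ck_on_add Ck_on_const)
qed (simp add: Ck_on_const assms)

text \<open>The Leibniz rule expresses the derivative by the same bilinear map, which closes the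
  induction; products, scalar multiples and inner products are all instances.\<close>

lemma Ck_on_bilinear:
  assumes "bounded_bilinear B" "open S" "Ck_on k f S" "Ck_on k g S"
  shows "Ck_on k (\<lambda>x. B (f x) (g x)) S"
  using assms(3,4)
proof (induction k arbitrary: f g)
  case 0 then show ?case using assms(1) by (simp add: bounded_bilinear.continuous_on)
next
  case (Suc k)
  note f = Ck_on_SucE[OF Suc.prems(1)] and g = Ck_on_SucE[OF Suc.prems(2)]
  show ?case
  proof (rule Ck_on_SucI[OF assms(2) bounded_bilinear.FDERIV[OF assms(1) f(1) g(1)]])
    show "Ck_on k (\<lambda>x. B (f x) (frechet_derivative g (at x) v) +
            B (frechet_derivative f (at x) v) (g x)) S" for v
      by (intro Ck_on_add assms(2) Suc.IH f(2) g(2) Ck_on_SucD[OF Suc.prems(1)] Ck_on_SucD[OF Suc.prems(2)])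
  qed
qed

text \<open>In the chain rule the point and the vector fed into Dg both depend on x, whereas
  \<open>Ck_on\<close> controls Dg only on fixed vectors. Expanding the vector in the basis gives a
  sum of products to which the induction hypothesis applies.\<close>

lemma Ck_on_compose:
  fixes f :: "'a::real_normed_vector \<Rightarrow> 'b::euclidean_space"
  assumes "open S" "open T" "Ck_on k f S" "Ck_on k g T" "f ` S \<subseteq> T"
  shows "Ck_on k (\<lambda>x. g (f x)) S"
  using assms(3,4)
proof (induction k arbitrary: g)
  case 0 then show ?case using assms(5) by (auto intro: continuous_on_compose2)
next
  case (Suc k)
  note f = Ck_on_SucE[OF Suc.prems(1)] and g = Ck_on_SucE[OF Suc.prems(2)]
  have lin: "linear (frechet_derivative g (at y))" if "y \<in> T" for y
    using g(1)[OF that] has_derivative_linear by blast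
  have *: "frechet_derivative g (at (f x)) w = (\<Sum>b\<in>Basis. (w \<bullet> b) *\<^sub>R frechet_derivative g (at (f x)) b)"
    if "x \<in> S" for x w
  proof -
    have "frechet_derivative g (at (f x)) w = frechet_derivative g (at (f x)) (\<Sum>b\<in>Basis. (w \<bullet> b) *\<^sub>R b)"
      by (simp add: euclidean_representation)
    also have "\<dots> = (\<Sum>b\<in>Basis. (w \<bullet> b) *\<^sub>R frechet_derivative g (at (f x)) b)"
      using lin[of "f x"] that assms(5)
      by (auto simp: linear_sum linear_cmul)
    finally show ?thesis .
  qed
  show ?case
  proof (rule Ck_on_SucI[OF assms(1)])
    show "((\<lambda>x. g (f x)) has_derivative
        (\<lambda>v. frechet_derivative g (at (f x)) (frechet_derivative f (at x) v))) (at x)" if "x \<in> S" for x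
      using that assms(5) by (intro has_derivative_compose[OF f(1) g(1)]) auto
    fix v
    have "Ck_on k (\<lambda>x. \<Sum>b\<in>Basis. (frechet_derivative f (at x) v \<bullet> b) *\<^sub>R frechet_derivative g (at (f x)) b) S"
      by (intro Ck_on_sum assms(1) Ck_on_bilinear[OF bounded_bilinear_scaleR]
          Ck_on_bounded_linear[OF bounded_linear_inner_left] f(2) Suc.IH[OF Ck_on_SucD[OF Suc.prems(1)] g(2)])
    then show "Ck_on k (\<lambda>x. frechet_derivative g (at (f x)) (frechet_derivative f (at x) v)) S"
      by (rule Ck_on_cong[OF _ assms(1)]) (simp flip: *)
  qed
qed

lemma Ck_on_local:
  assumes "\<And>x. x \<in> S \<Longrightarrow> \<exists>T. open T \<and> x \<in> T \<and> Ck_on k f T"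
  shows "Ck_on k f S"
  using assms
proof (induction k arbitrary: f)
  case 0
  show ?case
    unfolding Ck_on.simps
  proof (rule continuous_at_imp_continuous_on, rule ballI)
    fix x assume "x \<in> S"
    from 0[OF this] obtain T where "open T" "x \<in> T" "continuous_on T f" by auto
    then show "isCont f x" using continuous_on_eq_continuous_at by blast
  qed
next
  case (Suc k)
  have "f differentiable at x" if "x \<in> S" for x
    using Suc.prems[OF that] by auto
  moreover have "Ck_on k (\<lambda>x. frechet_derivative f (at x) v) S" for v
  proof (rule Suc.IH)
    fix x assume "x \<in> S"
    from Suc.prems[OF this] show "\<exists>T. open T \<and> x \<in> T \<and> Ck_on k (\<lambda>x. frechet_derivative f (at x) v) T"
      by auto
  qed
  ultimately show ?case by simp
qed

section \<open>Smoothness on arbitrary sets through local extensions\<close>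

lemma smooth_on_open_iff:
  assumes "open S"
  shows "smooth_on S f \<longleftrightarrow> (\<forall>k. Ck_on k f S)"
proof
  assume "\<forall>k. Ck_on k f S"
  then show "smooth_on S f" unfolding smooth_on_def using assms by blast
next
  assume s: "smooth_on S f"
  show "\<forall>k. Ck_on k f S"
  proof (intro allI Ck_on_local)
    fix k x assume "x \<in> S"
    then obtain T g where T: "open T" "x \<in> T" "\<forall>k. Ck_on k g T" "\<forall>y\<in>S \<inter> T. g y = f y"
      using s unfolding smooth_on_def by blast
    have "Ck_on k f (S \<inter> T)"
      by (rule Ck_on_cong[of k g]) (use T assms in \<open>auto intro: Ck_on_subset\<close>)
    then show "\<exists>T. open T \<and> x \<in> T \<and> Ck_on k f T"
      using T assms \<open>x \<in> S\<close> by blast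
  qed
qed

lemma smooth_on_imp_Ck_on: "smooth_on S f \<Longrightarrow> open S \<Longrightarrow> Ck_on k f S"
  by (simp only: smooth_on_open_iff)

lemma smooth_onI_Ck_on: "open S \<Longrightarrow> (\<And>k. Ck_on k f S) \<Longrightarrow> smooth_on S f"
  by (simp only: smooth_on_open_iff simp_thms)

lemma smooth_on_extend:
  assumes "smooth_on S f" "x \<in> S"
  obtains T g where "open T" "x \<in> T" "smooth_on T g" "\<And>y. y \<in> S \<Longrightarrow> y \<in> T \<Longrightarrow> g y = f y"
proof -
  from assms obtain T g where "open T" "x \<in> T" "\<forall>k. Ck_on k g T" "\<forall>y\<in>S \<inter> T. g y = f y"
    unfolding smooth_on_def by blast
  then show thesis by (intro that[of T g]) (auto simp only: smooth_on_open_iff Int_iff)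
qed

lemma smooth_onI_extend:
  assumes "\<And>x. x \<in> S \<Longrightarrow> \<exists>T g. open T \<and> x \<in> T \<and> smooth_on T g \<and> (\<forall>y\<in>S \<inter> T. g y = f y)"
  shows "smooth_on S f"
  unfolding smooth_on_def
proof
  fix x assume "x \<in> S"
  from assms[OF this] obtain T g where "open T" "x \<in> T" "smooth_on T g" "\<forall>y\<in>S \<inter> T. g y = f y"
    by blast
  then show "\<exists>T g. open T \<and> x \<in> T \<and> (\<forall>k. Ck_on k g T) \<and> (\<forall>y\<in>S \<inter> T. g y = f y)"
    by (intro exI[of _ T] exI[of _ g]) (simp add: smooth_on_open_iff)
qed

lemma smooth_on_cong_subset:
  assumes f: "smooth_on S f" and TS: "T \<subseteq> S" and eq: "\<And>x. x \<in> T \<Longrightarrow> f x = g x"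
  shows "smooth_on T g"
proof (rule smooth_onI_extend)
  fix x assume "x \<in> T"
  then have "x \<in> S" using TS by blast
  then obtain U h where U: "open U" "x \<in> U" "smooth_on U h" "\<And>y. y \<in> S \<Longrightarrow> y \<in> U \<Longrightarrow> h y = f y"
    using smooth_on_extend[OF f] by metis
  have "h y = g y" if "y \<in> T \<inter> U" for y
    using U(4)[of y] eq[of y] that TS by auto
  with U show "\<exists>U h. open U \<and> x \<in> U \<and> smooth_on U h \<and> (\<forall>y\<in>T \<inter> U. h y = g y)"
    by blast
qed

lemma smooth_on_subset: "smooth_on S f \<Longrightarrow> T \<subseteq> S \<Longrightarrow> smooth_on T f"
  by (rule smooth_on_cong_subset[OF _ _ refl])

lemma smooth_on_cong: "smooth_on S f \<Longrightarrow> (\<And>x. x \<in> S \<Longrightarrow> f x = g x) \<Longrightarrow> smooth_on S g"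
  by (rule smooth_on_cong_subset[OF _ subset_refl])

lemma smooth_on_local:
  assumes "\<And>x. x \<in> S \<Longrightarrow> \<exists>T. open T \<and> x \<in> T \<and> smooth_on (S \<inter> T) f"
  shows "smooth_on S f"
proof (rule smooth_onI_extend)
  fix x assume x: "x \<in> S"
  then obtain T where T: "open T" "x \<in> T" "smooth_on (S \<inter> T) f" using assms by blast
  then obtain U g where "open U" "x \<in> U" "smooth_on U g" "\<And>y. y \<in> S \<inter> T \<Longrightarrow> y \<in> U \<Longrightarrow> g y = f y"
    using smooth_on_extend[OF T(3), of x] x by blast
  then show "\<exists>T g. open T \<and> x \<in> T \<and> smooth_on T g \<and> (\<forall>y\<in>S \<inter> T. g y = f y)"
    using T(1,2) smooth_on_subset[of U g "T \<inter> U"] by (intro exI[of _ "T \<inter> U"] exI[of _ g]) auto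
qed

lemma smooth_on_compose:
  assumes f: "smooth_on S f" and g: "smooth_on T g" and ST: "\<And>x. x \<in> S \<Longrightarrow> f x \<in> T"
  shows "smooth_on S (\<lambda>x. g (f x))"
proof (rule smooth_onI_extend)
  fix x assume x: "x \<in> S"
  obtain U f' where U: "open U" "x \<in> U" "smooth_on U f'" "\<And>y. y \<in> S \<Longrightarrow> y \<in> U \<Longrightarrow> f' y = f y"
    using smooth_on_extend[OF f x] by blast
  obtain V g' where V: "open V" "f x \<in> V" "smooth_on V g'" "\<And>y. y \<in> T \<Longrightarrow> y \<in> V \<Longrightarrow> g' y = g y"
    using smooth_on_extend[OF g ST[OF x]] by blast
  have cont: "continuous_on U f'"
    using smooth_on_imp_Ck_on[OF U(3,1), of 0] by simp
  let ?W = "U \<inter> f' -` V"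
  have W: "open ?W" using continuous_open_preimage[OF cont U(1) V(1)] by simp
  have "smooth_on ?W (\<lambda>x. g' (f' x))"
  proof (rule smooth_onI_Ck_on[OF W], rule Ck_on_compose[OF W V(1)])
    fix k
    show "Ck_on k f' ?W" by (rule Ck_on_subset[OF smooth_on_imp_Ck_on[OF U(3,1)]]) simp
    show "Ck_on k g' V" by (rule smooth_on_imp_Ck_on[OF V(3,1)])
  qed auto
  moreover have "x \<in> ?W" using U(2,4) V(2) x by simp
  moreover have "g' (f' y) = g (f y)" if "y \<in> S \<inter> ?W" for y
    using that U(4)[of y] V(4)[of "f y"] ST[of y] by simp
  ultimately show "\<exists>T ga. open T \<and> x \<in> T \<and> smooth_on T ga \<and> (\<forall>y\<in>S \<inter> T. ga y = g (f y))"
    using W by blast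
qed

lemma smooth_on_ident: "smooth_on S (\<lambda>x. x)"
proof -
  have "Ck_on k (\<lambda>x::'a. x) UNIV" for k
    by (cases k) (simp_all add: Ck_on_const)
  from smooth_onI_Ck_on[OF open_UNIV this] show ?thesis by (rule smooth_on_subset) simp
qed

lemma smooth_on_const: "smooth_on S (\<lambda>x. c)"
  by (rule smooth_on_subset[OF smooth_onI_Ck_on[OF open_UNIV Ck_on_const[OF open_UNIV]]]) simp

lemma smooth_on_bounded_linear:
  assumes "bounded_linear L" "smooth_on S f"
  shows "smooth_on S (\<lambda>x. L (f x))"
  by (rule smooth_on_compose[OF assms(2), of UNIV L])
    (simp_all add: smooth_onI_Ck_on[OF open_UNIV]
      Ck_on_bounded_linear[OF assms(1) open_UNIV smooth_on_imp_Ck_on[OF smooth_on_ident open_UNIV]])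

lemma smooth_on_bilinear:
  assumes "bounded_bilinear B" "smooth_on S f" "smooth_on S g"
  shows "smooth_on S (\<lambda>x. B (f x) (g x))"
proof (rule smooth_onI_extend)
  fix x assume x: "x \<in> S"
  obtain U f' where U: "open U" "x \<in> U" "smooth_on U f'" "\<And>y. y \<in> S \<Longrightarrow> y \<in> U \<Longrightarrow> f' y = f y"
    using smooth_on_extend[OF assms(2) x] by blast
  obtain V g' where V: "open V" "x \<in> V" "smooth_on V g'" "\<And>y. y \<in> S \<Longrightarrow> y \<in> V \<Longrightarrow> g' y = g y"
    using smooth_on_extend[OF assms(3) x] by blast
  note W = open_Int[OF U(1) V(1)]
  have "smooth_on (U \<inter> V) (\<lambda>x. B (f' x) (g' x))"
    by (rule smooth_onI_Ck_on[OF W Ck_on_bilinear[OF assms(1) W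
          smooth_on_imp_Ck_on[OF smooth_on_subset[OF U(3)] W]
          smooth_on_imp_Ck_on[OF smooth_on_subset[OF V(3)] W]]]) auto
  then show "\<exists>T h. open T \<and> x \<in> T \<and> smooth_on T h \<and> (\<forall>y\<in>S \<inter> T. h y = B (f y) (g y))"
    using W U(2,4) V(2,4) by (intro exI[of _ "U \<inter> V"] exI[of _ "\<lambda>x. B (f' x) (g' x)"]) auto
qed

lemma smooth_on_add:
  assumes "smooth_on S f" "smooth_on S g"
  shows "smooth_on S (\<lambda>x. f x + g x)"
proof (rule smooth_onI_extend)
  fix x assume x: "x \<in> S"
  obtain U f' where U: "open U" "x \<in> U" "smooth_on U f'" "\<And>y. y \<in> S \<Longrightarrow> y \<in> U \<Longrightarrow> f' y = f y"
    using smooth_on_extend[OF assms(1) x] by blast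
  obtain V g' where V: "open V" "x \<in> V" "smooth_on V g'" "\<And>y. y \<in> S \<Longrightarrow> y \<in> V \<Longrightarrow> g' y = g y"
    using smooth_on_extend[OF assms(2) x] by blast
  note W = open_Int[OF U(1) V(1)]
  have "smooth_on (U \<inter> V) (\<lambda>x. f' x + g' x)"
    by (rule smooth_onI_Ck_on[OF W Ck_on_add[OF W
          smooth_on_imp_Ck_on[OF smooth_on_subset[OF U(3)] W]
          smooth_on_imp_Ck_on[OF smooth_on_subset[OF V(3)] W]]]) auto
  then show "\<exists>T h. open T \<and> x \<in> T \<and> smooth_on T h \<and> (\<forall>y\<in>S \<inter> T. h y = f y + g y)"
    using W U(2,4) V(2,4) by (intro exI[of _ "U \<inter> V"] exI[of _ "\<lambda>x. f' x + g' x"]) auto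
qed

lemmas smooth_on_scaleR = smooth_on_bilinear[OF bounded_bilinear_scaleR]
  and smooth_on_inner = smooth_on_bilinear[OF bounded_bilinear_inner]

lemma smooth_on_diff: "smooth_on S f \<Longrightarrow> smooth_on S g \<Longrightarrow> smooth_on S (\<lambda>x. f x - g x)"
  using smooth_on_add[of S f "\<lambda>x. - g x"] smooth_on_bounded_linear[of uminus S g]
  by (simp add: bounded_linear_minus bounded_linear_ident)

lemma smooth_on_sum: "(\<And>i. i \<in> I \<Longrightarrow> smooth_on S (f i)) \<Longrightarrow> smooth_on S (\<lambda>x. \<Sum>i\<in>I. f i x)"
proof (induction I rule: infinite_finite_induct)
  case (insert i I)
  then have "smooth_on S (\<lambda>x. f i x + (\<Sum>i\<in>I. f i x))" by (intro smooth_on_add) auto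
  then show ?case using insert by simp
qed (simp_all add: smooth_on_const)

lemma smooth_on_Pair:
  assumes "smooth_on S f" "smooth_on S g"
  shows "smooth_on S (\<lambda>x. (f x, g x))"
proof -
  have "smooth_on S (\<lambda>x. (f x, 0) + (0, g x))"
    by (rule smooth_on_add[OF
          smooth_on_bounded_linear[OF bounded_linear_Pair[OF bounded_linear_ident bounded_linear_zero] assms(1)]
          smooth_on_bounded_linear[OF bounded_linear_Pair[OF bounded_linear_zero bounded_linear_ident] assms(2)]])
  then show ?thesis by simp
qed

lemma smooth_on_fst: "smooth_on S f \<Longrightarrow> smooth_on S (\<lambda>x. fst (f x))"
  by (rule smooth_on_bounded_linear[OF bounded_linear_fst])

lemma smooth_on_snd: "smooth_on S f \<Longrightarrow> smooth_on S (\<lambda>x. snd (f x))"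
  by (rule smooth_on_bounded_linear[OF bounded_linear_snd])

lemma smooth_on_imp_continuous_on:
  assumes "smooth_on S f" shows "continuous_on S f"
proof (clarsimp simp: continuous_on_eq_continuous_within)
  fix x assume x: "x \<in> S"
  obtain U f' where U: "open U" "x \<in> U" "smooth_on U f'" "\<And>y. y \<in> S \<Longrightarrow> y \<in> U \<Longrightarrow> f' y = f y"
    using smooth_on_extend[OF assms x] by blast
  have "continuous_on U f'"
    using smooth_on_imp_Ck_on[OF U(3,1), of 0] by simp
  then have "continuous (at x within S) f'"
    using U by (simp add: continuous_on_eq_continuous_at continuous_at_imp_continuous_within)
  then show "continuous (at x within S) f"
    by (rule continuous_transform_within_openin[where S = "S \<inter> U" and T = S])
      (use U x in \<open>auto intro: openin_open_Int\<close>)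
qed

lemma smooth_on_open_derivative:
  assumes "open S" "smooth_on S f"
  shows "x \<in> S \<Longrightarrow> (f has_derivative frechet_derivative f (at x)) (at x)"
    and "smooth_on S (\<lambda>x. frechet_derivative f (at x) v)"
proof -
  note C = smooth_on_imp_Ck_on[OF assms(2,1), of "Suc _"]
  show "x \<in> S \<Longrightarrow> (f has_derivative frechet_derivative f (at x)) (at x)"
    by (rule Ck_on_SucE(1)[OF C])
  show "smooth_on S (\<lambda>x. frechet_derivative f (at x) v)"
    by (rule smooth_onI_Ck_on[OF assms(1) Ck_on_SucE(2)[OF C]])
qed

text \<open>The hypothesis \<open>step\<close> holds when the derivative is a smooth expression in the function itself.\<close>

lemma smooth_onI_bootstrap:
  assumes S: "open S" and f: "\<And>x. x \<in> S \<Longrightarrow> (f has_derivative f' x) (at x)"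
    and step: "\<And>k v. Ck_on k f S \<Longrightarrow> Ck_on k (\<lambda>x. f' x v) S"
  shows "smooth_on S f"
proof -
  have "Ck_on k f S" for k
  proof (induction k)
    case 0
    show ?case
      using has_derivative_continuous[OF f] by (auto intro!: continuous_at_imp_continuous_on)
  next
    case (Suc k)
    then show ?case by (intro Ck_on_SucI[OF S f] step)
  qed
  then show ?thesis by (rule smooth_onI_Ck_on[OF S])
qed

text \<open>Bootstrapping applies because the derivative is polynomial in the inverse itself. The
  real instance is used for inverse maps, the complex one for the logarithm.\<close>

lemma smooth_on_inverse:
  "smooth_on {x. x \<noteq> 0} (inverse :: 'a::{euclidean_space,real_normed_field} \<Rightarrow> 'a)"
proof (rule smooth_onI_bootstrap)
  show "open {x::'a. x \<noteq> 0}" by (simp add: open_Collect_neq)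
  then show "Ck_on k (\<lambda>x. - (inverse x * v * inverse x)) {x::'a. x \<noteq> 0}"
    if "Ck_on k inverse {x::'a. x \<noteq> 0}" for k v
    using that
    by (intro Ck_on_bounded_linear[OF bounded_linear_minus[OF bounded_linear_ident]]
        Ck_on_bilinear[OF bounded_bilinear_mult] Ck_on_const)
qed (auto intro!: has_derivative_inverse')

text \<open>Provides a smooth local choice of the angle in the tube; there the logarithm is taken of
  a quotient close to 1, so the right half plane is large enough.\<close>

lemma smooth_on_Ln: "smooth_on {z. 0 < Re z} Ln"
proof (rule smooth_onI_bootstrap)
  show o: "open {z. 0 < Re z}" by (rule open_halfspace_Re_gt)
  show "(Ln has_derivative (\<lambda>v. inverse z * v)) (at z)" if "z \<in> {z. 0 < Re z}" for z
    using that has_field_derivative_Ln[of z]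
    by (auto simp: has_field_derivative_def complex_nonpos_Reals_iff)
  have "smooth_on {z. 0 < Re z} inverse"
    by (rule smooth_on_subset[OF smooth_on_inverse]) auto
  then show "Ck_on k (\<lambda>z. inverse z * v) {z. 0 < Re z}" for k v
    by (intro Ck_on_bilinear[OF bounded_bilinear_mult o] Ck_on_const[OF o] smooth_on_imp_Ck_on[OF _ o])
qed

section \<open>Symmetry of second derivatives\<close>

lemma has_real_derivative_along_line:
  assumes "(g has_derivative g') (at (y + s *\<^sub>R u))"
  shows "((\<lambda>s. g (y + s *\<^sub>R u)) has_real_derivative g' u) (at s)"
proof -
  have "((\<lambda>s. g (y + s *\<^sub>R u)) has_derivative (\<lambda>t. g' (t *\<^sub>R u))) (at s)"
    by (rule has_derivative_compose[where f = "\<lambda>s. y + s *\<^sub>R u" and g = g, OF _ assms])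
      (auto intro!: derivative_eq_intros)
  moreover have "(\<lambda>t. g' (t *\<^sub>R u)) = (*) (g' u)"
    using has_derivative_linear[OF assms] by (auto simp: linear_cmul mult.commute)
  ultimately show ?thesis by (simp add: has_field_derivative_def)
qed

text \<open>The mean value theorem is applied twice, first in direction u to a difference of two
  values of g, then in direction v to its derivative.\<close>

lemma second_difference_mvt:
  fixes g :: "'a::euclidean_space \<Rightarrow> real"
  assumes h: "0 < h"
    and d1: "\<And>s t. 0 \<le> s \<Longrightarrow> s \<le> h \<Longrightarrow> 0 \<le> t \<Longrightarrow> t \<le> h \<Longrightarrow>
      (g has_derivative frechet_derivative g (at (x + s *\<^sub>R u + t *\<^sub>R v))) (at (x + s *\<^sub>R u + t *\<^sub>R v))"
    and d2: "\<And>s t. 0 \<le> s \<Longrightarrow> s \<le> h \<Longrightarrow> 0 \<le> t \<Longrightarrow> t \<le> h \<Longrightarrow>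
      ((\<lambda>y. frechet_derivative g (at y) u) has_derivative D (x + s *\<^sub>R u + t *\<^sub>R v)) (at (x + s *\<^sub>R u + t *\<^sub>R v))"
  obtains s t where "0 < s" "s < h" "0 < t" "t < h"
    "g (x + h *\<^sub>R u + h *\<^sub>R v) - g (x + h *\<^sub>R u) - g (x + h *\<^sub>R v) + g x = h * h * D (x + s *\<^sub>R u + t *\<^sub>R v) v"
proof -
  let ?F = "\<lambda>s. g (x + s *\<^sub>R u + h *\<^sub>R v) - g (x + s *\<^sub>R u)"
  let ?F' = "\<lambda>s. frechet_derivative g (at (x + s *\<^sub>R u + h *\<^sub>R v)) u - frechet_derivative g (at (x + s *\<^sub>R u)) u"
  have "(?F has_real_derivative ?F' s) (at s)" if "0 \<le> s" "s \<le> h" for s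
  proof -
    have "((\<lambda>s. g ((x + h *\<^sub>R v) + s *\<^sub>R u)) has_real_derivative frechet_derivative g (at (x + s *\<^sub>R u + h *\<^sub>R v)) u) (at s)"
      by (rule has_real_derivative_along_line) (use d1[of s h] that h in \<open>simp add: algebra_simps\<close>)
    moreover have "((\<lambda>s. g (x + s *\<^sub>R u)) has_real_derivative frechet_derivative g (at (x + s *\<^sub>R u)) u) (at s)"
      by (rule has_real_derivative_along_line) (use d1[of s 0] that h in simp)
    ultimately show ?thesis by (auto intro!: DERIV_diff simp: algebra_simps)
  qed
  then obtain s where s: "0 < s" "s < h" "?F h - ?F 0 = (h - 0) * ?F' s"
    using MVT2[OF h, of ?F ?F'] by auto
  let ?K = "\<lambda>t. frechet_derivative g (at (x + s *\<^sub>R u + t *\<^sub>R v)) u"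
  have "(?K has_real_derivative D (x + s *\<^sub>R u + t *\<^sub>R v) v) (at t)" if "0 \<le> t" "t \<le> h" for t
    by (rule has_real_derivative_along_line[where g = "\<lambda>y. frechet_derivative g (at y) u"])
      (use d2[of s t] that s in auto)
  then obtain t where t: "0 < t" "t < h" "?K h - ?K 0 = (h - 0) * D (x + s *\<^sub>R u + t *\<^sub>R v) v"
    using MVT2[OF h, of ?K "\<lambda>t. D (x + s *\<^sub>R u + t *\<^sub>R v) v"] by auto
  show thesis
    by (rule that[OF s(1,2) t(1,2)]) (use s(3) t(3) in \<open>simp add: algebra_simps\<close>)
qed

text \<open>The second difference over a parallelogram is symmetric in u and v, so both mixed
  derivatives take a common value at points near x; continuity then excludes a gap at x.\<close>

lemma second_derivative_symmetric_real:
  fixes g :: "'a::euclidean_space \<Rightarrow> real"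
  assumes T: "open T" "x \<in> T" and g: "smooth_on T g"
  shows "frechet_derivative (\<lambda>y. frechet_derivative g (at y) v) (at x) u
       = frechet_derivative (\<lambda>y. frechet_derivative g (at y) u) (at x) v"
proof (rule ccontr)
  define Q where "Q a b y = frechet_derivative (\<lambda>y. frechet_derivative g (at y) a) (at y) b" for a b y
  have sm: "smooth_on T (\<lambda>y. frechet_derivative g (at y) a)" for a
    using smooth_on_open_derivative(2)[OF T(1) g] .
  have sQ: "smooth_on T (Q a b)" for a b
    unfolding Q_def using smooth_on_open_derivative(2)[OF T(1) sm] .
  have cQ: "isCont (Q a b) x" for a b
    using smooth_on_imp_continuous_on[OF sQ] T continuous_on_eq_continuous_at by blast
  assume "frechet_derivative (\<lambda>y. frechet_derivative g (at y) v) (at x) u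
       \<noteq> frechet_derivative (\<lambda>y. frechet_derivative g (at y) u) (at x) v"
  then have ne: "Q v u x \<noteq> Q u v x" by (simp add: Q_def)
  \<comment> \<open>Half of the supposed gap: one number cannot be strictly within \<open>e\<close>
    of both values.\<close>
  define e where "e = \<bar>Q v u x - Q u v x\<bar> / 2"
  have e: "0 < e" using ne by (simp add: e_def)
  obtain d1 where d1: "d1 > 0" "\<And>y. dist y x < d1 \<Longrightarrow> dist (Q v u y) (Q v u x) < e"
    using cQ[of v u] e unfolding continuous_at_eps_delta by blast
  obtain d2 where d2: "d2 > 0" "\<And>y. dist y x < d2 \<Longrightarrow> dist (Q u v y) (Q u v x) < e"
    using cQ[of u v] e unfolding continuous_at_eps_delta by blast
  obtain d3 where d3: "d3 > 0" "ball x d3 \<subseteq> T" using T openE by blast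
  define d where "d = min d1 (min d2 d3)"
  \<comment> \<open>Keeps the whole parallelogram with sides h u and h v within distance d/2 of x;
    the summand 1 covers u = v = 0.\<close>
  define h where "h = d / (2 * (norm u + norm v + 1))"
  have d: "0 < d" using d1 d2 d3 by (simp add: d_def)
  have N: "0 < norm u + norm v + 1" by (smt (verit) norm_ge_zero)
  have h: "0 < h" using d N by (simp add: h_def)
  have near: "dist (x + s *\<^sub>R u + t *\<^sub>R v) x < d" if "0 \<le> s" "s \<le> h" "0 \<le> t" "t \<le> h" for s t
  proof -
    have "dist (x + s *\<^sub>R u + t *\<^sub>R v) x = norm (s *\<^sub>R u + t *\<^sub>R v)" by (simp add: dist_norm algebra_simps)
    also have "\<dots> \<le> s * norm u + t * norm v" using norm_triangle_ineq[of "s *\<^sub>R u" "t *\<^sub>R v"] that by simp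
    also have "\<dots> \<le> h * norm u + h * norm v" using that by (intro add_mono mult_right_mono) auto
    also have "\<dots> \<le> h * (norm u + norm v + 1)" using h by (simp add: algebra_simps)
    also have "\<dots> = d / 2" using N by (simp add: h_def field_simps)
    also have "\<dots> < d" using d by simp
    finally show ?thesis .
  qed
  have inT: "y \<in> T" if "dist y x < d" for y
    using that d3 by (auto simp: d_def dist_commute)
  have der1: "(g has_derivative frechet_derivative g (at y)) (at y)" if "dist y x < d" for y
    using smooth_on_open_derivative(1)[OF T(1) g] inT[OF that] by blast
  have der2: "((\<lambda>y. frechet_derivative g (at y) a) has_derivative (\<lambda>b. Q a b y)) (at y)"
    if "dist y x < d" for y a
    unfolding Q_def using smooth_on_open_derivative(1)[OF T(1) sm] inT[OF that] by simp
  obtain s t where st: "0 < s" "s < h" "0 < t" "t < h"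
    "g (x + h *\<^sub>R u + h *\<^sub>R v) - g (x + h *\<^sub>R u) - g (x + h *\<^sub>R v) + g x = h * h * Q u v (x + s *\<^sub>R u + t *\<^sub>R v)"
    by (rule second_difference_mvt[OF h, of g x u v "\<lambda>y b. Q u b y", OF der1 der2])
      (use near in auto)
  have near': "dist (x + t *\<^sub>R v + s *\<^sub>R u) x < d" if "0 \<le> s" "s \<le> h" "0 \<le> t" "t \<le> h" for s t
    using near[OF that] by (simp add: algebra_simps)
  obtain s' t' where st': "0 < s'" "s' < h" "0 < t'" "t' < h"
    "g (x + h *\<^sub>R v + h *\<^sub>R u) - g (x + h *\<^sub>R v) - g (x + h *\<^sub>R u) + g x = h * h * Q v u (x + s' *\<^sub>R v + t' *\<^sub>R u)"
    by (rule second_difference_mvt[OF h, of g x v u "\<lambda>y b. Q v b y", OF der1 der2])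
      (use near' in auto)
  have "h * h * Q u v (x + s *\<^sub>R u + t *\<^sub>R v) = h * h * Q v u (x + s' *\<^sub>R v + t' *\<^sub>R u)"
    using st(5) st'(5) by (simp add: algebra_simps)
  then have eq: "Q u v (x + s *\<^sub>R u + t *\<^sub>R v) = Q v u (x + s' *\<^sub>R v + t' *\<^sub>R u)" using h by simp
  have "dist (Q u v (x + s *\<^sub>R u + t *\<^sub>R v)) (Q u v x) < e"
    using near[of s t] st by (intro d2) (auto simp: d_def)
  moreover have "dist (Q v u (x + s' *\<^sub>R v + t' *\<^sub>R u)) (Q v u x) < e"
    using near'[of t' s'] st' by (intro d1) (auto simp: d_def)
  ultimately show False unfolding eq e_def dist_real_def by argo
qed

lemma second_derivative_symmetric:
  fixes g :: "'a::euclidean_space \<Rightarrow> 'b::euclidean_space"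
  assumes T: "open T" "x \<in> T" and g: "smooth_on T g"
  shows "frechet_derivative (\<lambda>y. frechet_derivative g (at y) v) (at x) u
       = frechet_derivative (\<lambda>y. frechet_derivative g (at y) u) (at x) v"
proof (rule euclidean_eqI)
  fix b :: 'b assume "b \<in> Basis"
  let ?gb = "\<lambda>y. g y \<bullet> b"
  have gb: "smooth_on T ?gb" by (intro smooth_on_bounded_linear[OF bounded_linear_inner_left] g)
  have 1: "frechet_derivative ?gb (at y) a = frechet_derivative g (at y) a \<bullet> b" if "y \<in> T" for y a
    using frechet_derivative_at[OF bounded_linear.has_derivative[OF bounded_linear_inner_left smooth_on_open_derivative(1)[OF T(1) g that]], of b]
    by metis
  have 2: "frechet_derivative (\<lambda>y. frechet_derivative ?gb (at y) a) (at x) c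
      = frechet_derivative (\<lambda>y. frechet_derivative g (at y) a) (at x) c \<bullet> b" for a c
  proof -
    note d = smooth_on_open_derivative(1)[OF T(1) smooth_on_open_derivative(2)[OF T(1) g] T(2), of a]
    have "((\<lambda>y. frechet_derivative g (at y) a \<bullet> b) has_derivative
        (\<lambda>c. frechet_derivative (\<lambda>y. frechet_derivative g (at y) a) (at x) c \<bullet> b)) (at x)"
      by (rule bounded_linear.has_derivative[OF bounded_linear_inner_left d])
    then have "((\<lambda>y. frechet_derivative ?gb (at y) a) has_derivative
        (\<lambda>c. frechet_derivative (\<lambda>y. frechet_derivative g (at y) a) (at x) c \<bullet> b)) (at x)"
      by (rule has_derivative_transform_within_open[OF _ T]) (simp add: 1)
    from frechet_derivative_at[OF this] show ?thesis by metis
  qed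
  show "frechet_derivative (\<lambda>y. frechet_derivative g (at y) v) (at x) u \<bullet> b
      = frechet_derivative (\<lambda>y. frechet_derivative g (at y) u) (at x) v \<bullet> b"
    using second_derivative_symmetric_real[OF T gb, of v u] by (simp add: 2)
qed

section \<open>Calculus on relatively open subsets of half-spaces\<close>

lemma model_openE:
  assumes "model_open S"
  obtains (plain) U where "open U" "S = U"
  | (half) b U where "b \<in> Basis" "open U" "S = half_space b \<inter> U"
  using assms unfolding model_open_def openin_open by blast

lemma model_open_Int_open:
  assumes "model_open S" "open U"
  shows "model_open (S \<inter> U)"
  using assms(1)
proof (cases rule: model_openE)
  case (plain V)
  then show ?thesis using assms(2) by (auto simp: model_open_def)
next
  case (half b V)
  then have "openin (top_of_set (half_space b)) (S \<inter> U)"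
    unfolding openin_open using assms(2) by (intro exI[of _ "V \<inter> U"]) auto
  then show ?thesis using half(1) unfolding model_open_def by blast
qed

lemma model_open_Times_UNIV:
  fixes S :: "'a::euclidean_space set"
  assumes "model_open S"
  shows "model_open (S \<times> (UNIV :: 'b::euclidean_space set))"
  using assms
proof (cases rule: model_openE)
  case (plain V)
  then show ?thesis by (auto simp: model_open_def open_Times)
next
  case (half b V)
  have "S \<times> (UNIV::'b set) = half_space (b, 0) \<inter> V \<times> UNIV"
    using half(3) by (auto simp: half_space_def inner_Pair)
  then have "openin (top_of_set (half_space (b, 0::'b))) (S \<times> UNIV)"
    unfolding openin_open using half(2) by (intro exI[of _ "V \<times> UNIV"]) (auto simp: open_Times)
  moreover have "(b, 0::'b) \<in> Basis" using half(1) by (simp add: Basis_prod_def)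
  ultimately show ?thesis unfolding model_open_def by blast
qed

text \<open>Moving by a positive multiple of a basis vector never leaves a coordinate half-space,
  since basis vectors have nonnegative inner products. These one-sided directions make derivatives
  at boundary points unique.\<close>

lemma model_open_directions:
  assumes "model_open S" "x \<in> S" "i \<in> Basis" "0 < e"
  obtains d where "0 < d" "d < e" "x + d *\<^sub>R i \<in> S"
proof -
  obtain U where U: "open U" "x \<in> U"
    "\<And>d. 0 < d \<Longrightarrow> x + d *\<^sub>R i \<in> U \<Longrightarrow> x + d *\<^sub>R i \<in> S"
    using assms(1)
  proof (cases rule: model_openE)
    case (plain V)
    then show ?thesis using that[of V] assms(2) by blast
  next
    case (half b V)
    show ?thesis
    proof (rule that[of V])
      show "open V" "x \<in> V" using half assms(2) by auto
      fix d :: real assume "0 < d" and V: "x + d *\<^sub>R i \<in> V"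
      have "0 \<le> i \<bullet> b" using assms(3) half(1) by (cases "i = b") (auto simp: inner_not_same_Basis)
      then have "0 \<le> (x + d *\<^sub>R i) \<bullet> b"
        using \<open>0 < d\<close> assms(2) half(3) by (simp add: inner_add_left half_space_def)
      then show "x + d *\<^sub>R i \<in> S" using V half(3) by (simp add: half_space_def)
    qed
  qed
  obtain r where r: "0 < r" "ball x r \<subseteq> U" using U openE by blast
  define d where "d = min e r / 2"
  have "0 < d" "d < e" "d < r" using r assms(4) by (auto simp: d_def)
  moreover have "x + d *\<^sub>R i \<in> ball x r" using \<open>0 < d\<close> \<open>d < r\<close> assms(3) by (simp add: dist_norm)
  ultimately show thesis using that U(3)[of d] r(2) by blast
qed

lemma model_open_derivative_unique:
  fixes f :: "'a::euclidean_space \<Rightarrow> 'b::real_normed_vector"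
  assumes S: "model_open S" and x: "x \<in> S"
    and A: "(f has_derivative A) (at x within S)" and B: "(f has_derivative B) (at x within S)"
  shows "A = B"
proof (rule frechet_derivative_unique_within[OF A B])
  fix i :: 'a and e :: real assume "i \<in> Basis" "0 < e"
  then obtain d where "0 < d" "d < e" "x + d *\<^sub>R i \<in> S"
    by (rule model_open_directions[OF S x]) blast
  then show "\<exists>d. 0 < \<bar>d\<bar> \<and> \<bar>d\<bar> < e \<and> x + d *\<^sub>R i \<in> S"
    by (intro exI[of _ d]) auto
qed

lemma frechet_derivative_model_open:
  fixes f :: "'a::euclidean_space \<Rightarrow> 'b::real_normed_vector"
  assumes "model_open S" "x \<in> S" "(f has_derivative A) (at x within S)"
  shows "frechet_derivative f (at x within S) = A"
proof -
  have "(f has_derivative frechet_derivative f (at x within S)) (at x within S)"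
    using assms(3) frechet_derivative_works differentiableI by blast
  then show ?thesis using model_open_derivative_unique[OF assms(1,2)] assms(3) by blast
qed

lemma has_derivative_restrict:
  assumes "(g has_derivative A) (at x)" "open T" "x \<in> T" "x \<in> S"
    and "\<And>y. y \<in> S \<Longrightarrow> y \<in> T \<Longrightarrow> g y = f y"
  shows "(f has_derivative A) (at x within S)"
proof -
  have "(g has_derivative A) (at x within S \<inter> T)"
    using assms(1) has_derivative_at_withinI by blast
  then have "(f has_derivative A) (at x within S \<inter> T)"
    by (rule has_derivative_transform[rotated 2]) (use assms in auto)
  moreover have "at x within S \<inter> T = at x within S"
    by (rule at_within_nhd[OF assms(3,2)]) auto
  ultimately show ?thesis by simp
qed

lemma smooth_on_has_derivative:
  assumes "smooth_on S f" "x \<in> S"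
  obtains L where "(f has_derivative L) (at x within S)"
proof -
  obtain T g where T: "open T" "x \<in> T" "smooth_on T g" "\<And>y. y \<in> S \<Longrightarrow> y \<in> T \<Longrightarrow> g y = f y"
    using smooth_on_extend[OF assms] by metis
  show thesis
    by (rule that[OF has_derivative_restrict[OF smooth_on_open_derivative(1)[OF T(1,3,2)] T(1,2) assms(2) T(4)]])
qed

lemma smooth_on_frechet_derivative:
  assumes "smooth_on S f" "x \<in> S"
  shows "(f has_derivative frechet_derivative f (at x within S)) (at x within S)"
  using smooth_on_has_derivative[OF assms] frechet_derivative_works differentiableI by metis

text \<open>Uniqueness of derivatives within model sets forces all smooth extensions to have the
  same derivative at points of \<open>S\<close>; facts about open sets pass to boundary points in
  this way.\<close>

lemma frechet_derivative_extension:
  assumes S: "model_open S" and T: "open T" "smooth_on T g" "\<And>y. y \<in> S \<Longrightarrow> y \<in> T \<Longrightarrow> g y = f y"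
    and y: "y \<in> S" "y \<in> T"
  shows "frechet_derivative f (at y within S) = frechet_derivative g (at y)"
  by (rule frechet_derivative_model_open[OF S y(1)
        has_derivative_restrict[OF smooth_on_open_derivative(1)[OF T(1,2) y(2)] T(1) y(2,1) T(3)]])

lemma smooth_on_frechet:
  fixes f :: "'a::euclidean_space \<Rightarrow> 'b::euclidean_space"
  assumes S: "model_open S" and f: "smooth_on S f"
  shows "smooth_on S (\<lambda>x. frechet_derivative f (at x within S) v)"
proof (rule smooth_onI_extend)
  fix x assume "x \<in> S"
  then obtain T g where T: "open T" "x \<in> T" "smooth_on T g" "\<And>y. y \<in> S \<Longrightarrow> y \<in> T \<Longrightarrow> g y = f y"
    using smooth_on_extend[OF f] by metis
  show "\<exists>T h. open T \<and> x \<in> T \<and> smooth_on T h \<and> (\<forall>y\<in>S \<inter> T. h y = frechet_derivative f (at y within S) v)"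
    using T(1,2) smooth_on_open_derivative(2)[OF T(1,3), of v] frechet_derivative_extension[OF S T(1,3,4)]
    by (intro exI[of _ T] exI[of _ "\<lambda>y. frechet_derivative g (at y) v"]) simp
qed

lemma second_derivative_symmetric_within:
  fixes f :: "'a::euclidean_space \<Rightarrow> 'b::euclidean_space"
  assumes S: "model_open S" and f: "smooth_on S f" and x: "x \<in> S"
  shows "frechet_derivative (\<lambda>y. frechet_derivative f (at y within S) v) (at x within S) u
       = frechet_derivative (\<lambda>y. frechet_derivative f (at y within S) u) (at x within S) v"
proof -
  obtain T g where T: "open T" "x \<in> T" "smooth_on T g" "\<And>y. y \<in> S \<Longrightarrow> y \<in> T \<Longrightarrow> g y = f y"
    using smooth_on_extend[OF f x] by metis
  have "frechet_derivative (\<lambda>y. frechet_derivative f (at y within S) v) (at x within S)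
      = frechet_derivative (\<lambda>y. frechet_derivative g (at y) v) (at x)" for v
    by (rule frechet_derivative_extension[OF S T(1) smooth_on_open_derivative(2)[OF T(1,3)] _ x T(2)])
      (simp add: frechet_derivative_extension[OF S T(1,3,4)])
  then show ?thesis using second_derivative_symmetric[OF T(1,2,3)] by simp
qed

section \<open>Exterior derivatives in coordinates and nondegenerate bilinear forms\<close>

lemma linear_Basis_expand:
  fixes A :: "'a::euclidean_space \<Rightarrow> 'b::real_vector"
  assumes "linear A"
  shows "A w = (\<Sum>b\<in>Basis. (w \<bullet> b) *\<^sub>R A b)"
proof -
  have "A w = A (\<Sum>b\<in>Basis. (w \<bullet> b) *\<^sub>R b)" by (simp add: euclidean_representation)
  also have "\<dots> = (\<Sum>b\<in>Basis. (w \<bullet> b) *\<^sub>R A b)"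
    using assms by (simp add: linear_sum linear_cmul)
  finally show ?thesis .
qed

text \<open>Coordinate version of \<open>ext_deriv\<close>, with the chart image replaced by a free
  set so that it can be shrunk and pulled back.\<close>

definition dform :: "'a set \<Rightarrow> ('a::euclidean_space \<Rightarrow> 'a \<Rightarrow> real) \<Rightarrow> 'a \<Rightarrow> 'a \<Rightarrow> 'a \<Rightarrow> real"
  where "dform S A x u v = frechet_derivative (\<lambda>y. A y v) (at x within S) u
    - frechet_derivative (\<lambda>y. A y u) (at x within S) v"

lemma dform_cong:
  assumes "\<And>y v. y \<in> S \<Longrightarrow> A y v = B y v" "x \<in> S" 
  shows "dform S A x u v = dform S B x u v"
proof -
  have "((\<lambda>y. A y w) has_derivative D) (at x within S) \<longleftrightarrow> ((\<lambda>y. B y w) has_derivative D) (at x within S)" for w D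
  proof
    show "((\<lambda>y. B y w) has_derivative D) (at x within S)"
      if "((\<lambda>y. A y w) has_derivative D) (at x within S)"
      by (rule has_derivative_transform[OF assms(2) _ that]) (simp add: assms(1))
    show "((\<lambda>y. A y w) has_derivative D) (at x within S)"
      if "((\<lambda>y. B y w) has_derivative D) (at x within S)"
      by (rule has_derivative_transform[OF assms(2) _ that]) (simp add: assms(1))
  qed
  then show ?thesis unfolding dform_def frechet_derivative_def by simp
qed

text \<open>The second derivatives of \<open>\<psi>\<close> cancel by symmetry.\<close>

lemma dform_pullback:
  fixes \<psi> :: "'a::euclidean_space \<Rightarrow> 'b::euclidean_space"
  assumes I: "model_open I" and J: "model_open J" and x: "x \<in> I"
    and \<psi>: "smooth_on I \<psi>" "\<And>y. y \<in> I \<Longrightarrow> \<psi> y \<in> J"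
    and A: "\<And>y. y \<in> J \<Longrightarrow> linear (A y)" "\<And>v. smooth_on J (\<lambda>y. A y v)"
  defines "D \<equiv> \<lambda>y. frechet_derivative \<psi> (at y within I)"
  shows "dform I (\<lambda>y v. A (\<psi> y) (D y v)) x u v = dform J A (\<psi> x) (D x u) (D x v)"
proof -
  let ?DA = "\<lambda>b. frechet_derivative (\<lambda>y. A y b) (at (\<psi> x) within J)"
  have DA: "((\<lambda>y. A y b) has_derivative ?DA b) (at (\<psi> x) within J)" for b
    by (rule smooth_on_frechet_derivative[OF A(2) \<psi>(2)[OF x]])
  have D\<psi>: "(\<psi> has_derivative D x) (at x within I)"
    unfolding D_def by (rule smooth_on_frechet_derivative[OF \<psi>(1) x])
  let ?DD = "\<lambda>v. frechet_derivative (\<lambda>y. D y v) (at x within I)"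
  have DD: "((\<lambda>y. D y v) has_derivative ?DD v) (at x within I)" for v
    unfolding D_def by (rule smooth_on_frechet_derivative[OF smooth_on_frechet[OF I \<psi>(1)] x])
  \<comment> \<open>Smoothness of \<open>A\<close> is given for fixed arguments only; this makes the
    dependence of its derivative on the argument explicit.\<close>
  have DAw: "?DA w h = (\<Sum>b\<in>Basis. (w \<bullet> b) * ?DA b h)" for w h
  proof -
    have "((\<lambda>y. \<Sum>b\<in>Basis. (w \<bullet> b) * A y b) has_derivative (\<lambda>h. \<Sum>b\<in>Basis. (w \<bullet> b) * ?DA b h))
        (at (\<psi> x) within J)"
      by (intro has_derivative_sum has_derivative_mult_right DA)
    then have "((\<lambda>y. A y w) has_derivative (\<lambda>h. \<Sum>b\<in>Basis. (w \<bullet> b) * ?DA b h)) (at (\<psi> x) within J)"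
    proof (rule has_derivative_transform[rotated 2])
      show "\<psi> x \<in> J" by (rule \<psi>(2)[OF x])
      show "A y w = (\<Sum>b\<in>Basis. (w \<bullet> b) * A y b)" if "y \<in> J" for y
        using linear_Basis_expand[OF A(1)[OF that], of w] by simp
    qed
    from frechet_derivative_model_open[OF J \<psi>(2)[OF x] this] show ?thesis by simp
  qed
  \<comment> \<open>Product rule: the first summand pairs \<open>A\<close> with a second derivative
    of \<psi>, the second one is the part that survives antisymmetrisation.\<close>
  have *: "frechet_derivative (\<lambda>y. A (\<psi> y) (D y v)) (at x within I) u
      = (\<Sum>b\<in>Basis. (?DD v u \<bullet> b) * A (\<psi> x) b) + ?DA (D x v) (D x u)" for u v
  proof -
    have comp: "((\<lambda>y. A (\<psi> y) b) has_derivative (\<lambda>h. ?DA b (D x h))) (at x within I)" for b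
      by (rule has_derivative_in_compose2[where t = J and g = "\<lambda>y. A y b", OF _ _ x D\<psi>, where g' = "\<lambda>y. frechet_derivative (\<lambda>y. A y b) (at y within J)"])
        (use \<psi>(2) smooth_on_frechet_derivative[OF A(2)] in auto)
    have "((\<lambda>y. \<Sum>b\<in>Basis. (D y v \<bullet> b) * A (\<psi> y) b) has_derivative
        (\<lambda>h. \<Sum>b\<in>Basis. (D x v \<bullet> b) * ?DA b (D x h) + (?DD v h \<bullet> b) * A (\<psi> x) b)) (at x within I)"
      by (intro has_derivative_sum has_derivative_mult comp has_derivative_inner_left DD)
    then have "((\<lambda>y. A (\<psi> y) (D y v)) has_derivative
        (\<lambda>h. \<Sum>b\<in>Basis. (D x v \<bullet> b) * ?DA b (D x h) + (?DD v h \<bullet> b) * A (\<psi> x) b)) (at x within I)"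
    proof (rule has_derivative_transform[rotated 2])
      show "A (\<psi> y) (D y v) = (\<Sum>b\<in>Basis. (D y v \<bullet> b) * A (\<psi> y) b)" if "y \<in> I" for y
        using linear_Basis_expand[OF A(1)[OF \<psi>(2)[OF that]], of "D y v"] by simp
    qed (rule x)
    from frechet_derivative_model_open[OF I x this] show ?thesis
      by (simp add: DAw[of "D x v"] sum.distrib add.commute)
  qed
  have "?DD v u = ?DD u v"
    unfolding D_def by (rule second_derivative_symmetric_within[OF I \<psi>(1) x])
  then show ?thesis unfolding dform_def by (simp add: *)
qed

lemma dform_add:
  fixes A B :: "'a::euclidean_space \<Rightarrow> 'a \<Rightarrow> real"
  assumes "model_open S" "x \<in> S"
    and "\<And>v. (\<lambda>y. A y v) differentiable (at x within S)" "\<And>v. (\<lambda>y. B y v) differentiable (at x within S)"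
  shows "dform S (\<lambda>y v. A y v + B y v) x u v = dform S A x u v + dform S B x u v"
proof -
  have "frechet_derivative (\<lambda>y. A y v + B y v) (at x within S) =
      (\<lambda>h. frechet_derivative (\<lambda>y. A y v) (at x within S) h + frechet_derivative (\<lambda>y. B y v) (at x within S) h)" for v
    using assms(3,4)[of v]
    by (intro frechet_derivative_model_open[OF assms(1,2)] has_derivative_add) (simp_all add: frechet_derivative_works)
  then show ?thesis by (simp add: dform_def)
qed

lemma dform_linear:
  fixes A :: "'a::euclidean_space \<Rightarrow> 'a \<Rightarrow> real"
  assumes S: "model_open S" and x: "x \<in> S"
    and A: "\<And>y. y \<in> S \<Longrightarrow> linear (A y)" "\<And>v. smooth_on S (\<lambda>y. A y v)"
  shows "linear (\<lambda>u. dform S A x u v)" and "linear (\<lambda>v. dform S A x u v)"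
proof -
  let ?D = "\<lambda>v. frechet_derivative (\<lambda>y. A y v) (at x within S)"
  have D: "((\<lambda>y. A y b) has_derivative ?D b) (at x within S)" for b
    by (rule smooth_on_frechet_derivative[OF A(2) x])
  have 1: "linear (?D v)" for v using D has_derivative_linear by blast
  have 2: "linear (\<lambda>v. ?D v u)" for u
  proof (rule linearI)
    fix v w and r :: real
    have "((\<lambda>y. A y (v + w)) has_derivative (\<lambda>h. ?D v h + ?D w h)) (at x within S)"
      by (rule has_derivative_transform[OF x _ has_derivative_add[OF D D]])
        (simp add: linear_add[OF A(1)])
    from frechet_derivative_model_open[OF S x this] show "?D (v + w) u = ?D v u + ?D w u" by simp
    have "((\<lambda>y. A y (r *\<^sub>R v)) has_derivative (\<lambda>h. r * ?D v h)) (at x within S)"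
      by (rule has_derivative_transform[OF x _ has_derivative_mult_right[OF D]])
        (simp add: linear_cmul[OF A(1)])
    from frechet_derivative_model_open[OF S x this] show "?D (r *\<^sub>R v) u = r *\<^sub>R ?D v u" by simp
  qed
  have 3: "dform S A x u v = ?D v u - ?D u v" for u v by (simp add: dform_def)
  show "linear (\<lambda>u. dform S A x u v)" unfolding 3
    by (intro linear_compose_sub 1 2)
  show "linear (\<lambda>v. dform S A x u v)" unfolding 3
    by (intro linear_compose_sub 1 2)
qed

text \<open>Through the inner product \<omega> becomes a linear operator and \<alpha> a vector;
  nondegeneracy says that the operator is injective, hence bijective in finite dimension.\<close>

lemma nondegenerate_ex1:
  fixes \<omega> :: "'a::euclidean_space \<Rightarrow> 'a \<Rightarrow> real"
  assumes l1: "\<And>v. linear (\<lambda>u. \<omega> u v)" and l2: "\<And>u. linear (\<omega> u)"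
    and nd: "\<And>u. u \<noteq> 0 \<Longrightarrow> \<exists>v. \<omega> u v \<noteq> 0" and \<alpha>: "linear \<alpha>"
  shows "\<exists>!u. \<forall>v. \<omega> u v = \<alpha> v"
proof -
  define T where "T u = (\<Sum>b\<in>Basis. \<omega> u b *\<^sub>R b)" for u
  have T: "T u \<bullet> v = \<omega> u v" for u v
    using linear_Basis_expand[OF l2, of u v] by (simp add: T_def inner_sum_left inner_commute[of v] mult.commute)
  have "linear T"
    unfolding T_def by (rule linearI)
      (simp_all add: linear_add[OF l1] linear_cmul[OF l1] scaleR_add_left sum.distrib scaleR_sum_right)
  moreover have "inj T"
    unfolding linear_inj_iff_eq_0[OF \<open>linear T\<close>]
  proof (intro allI impI)
    fix u assume "T u = 0"
    then have "\<omega> u v = 0" for v using T[of u v] by simp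
    then show "u = 0" using nd by blast
  qed
  ultimately have "surj T" using linear_injective_imp_surjective by blast
  define a where "a = (\<Sum>b\<in>Basis. \<alpha> b *\<^sub>R b)"
  have a: "a \<bullet> v = \<alpha> v" for v
    using linear_Basis_expand[OF \<alpha>, of v] by (simp add: a_def inner_sum_left inner_commute[of v] mult.commute)
  have iff: "(\<forall>v. \<omega> u v = \<alpha> v) \<longleftrightarrow> T u = a" for u
    unfolding vector_eq_rdot[symmetric, of "T u" a] T a by (simp add: T a)
  show ?thesis unfolding iff using \<open>surj T\<close> \<open>inj T\<close> by (metis injD surjD)
qed

section \<open>Charts and smooth maps\<close>

text \<open>The homeomorphism condition is split into continuity of \<open>cmap\<close> and of
  \<open>cinv\<close>, the latter into all of \<open>M\<close>, which is the form in which both get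
  composed with other maps.\<close>

definition chart_on :: "('a, 'e::euclidean_space) manifold \<Rightarrow> ('a, 'e) chart \<Rightarrow> bool"
  where "chart_on M c \<longleftrightarrow> openin (mspace M) (cdom c) \<and> model_open (cimg c) \<and> inj_on (cmap c) (cdom c) \<and>
    continuous_map (subtopology (mspace M) (cdom c)) euclidean (cmap c) \<and>
    continuous_map (top_of_set (cimg c)) (mspace M) (cinv c)"

text \<open>The Hausdorff and countability axioms of a smooth manifold play no role in the calculus below and
  are left out, so that they need not be verified for the tube.\<close>

definition smooth_atlas :: "('a, 'e::euclidean_space) manifold \<Rightarrow> bool"
  where "smooth_atlas M \<longleftrightarrow> carr M = (\<Union>c\<in>atlas M. cdom c) \<and> (\<forall>c\<in>atlas M. chart_on M c) \<and>
    (\<forall>c\<in>atlas M. \<forall>c'\<in>atlas M. smooth_on (cmap c ` (cdom c \<inter> cdom c')) (\<lambda>x. cmap c' (cinv c x)))"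

lemma cinv_in: "x \<in> cimg c \<Longrightarrow> cinv c x \<in> cdom c"
  unfolding cinv_def by (rule inv_into_into)

lemma cmap_cinv: "x \<in> cimg c \<Longrightarrow> cmap c (cinv c x) = x"
  unfolding cinv_def by (rule f_inv_into_f)

lemma cinv_cmap: "inj_on (cmap c) (cdom c) \<Longrightarrow> p \<in> cdom c \<Longrightarrow> cinv c (cmap c p) = p"
  unfolding cinv_def by (rule inv_into_f_f)

lemma chart_onD:
  assumes "chart_on M c"
  shows "openin (mspace M) (cdom c)" "model_open (cimg c)" "inj_on (cmap c) (cdom c)"
    "cdom c \<subseteq> carr M"
    "p \<in> cdom c \<Longrightarrow> cinv c (cmap c p) = p"
    "continuous_map (subtopology (mspace M) (cdom c)) euclidean (cmap c)"
    "continuous_map (top_of_set (cimg c)) (mspace M) (cinv c)"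
proof -
  note A = assms[unfolded chart_on_def]
  show 1: "openin (mspace M) (cdom c)" and "model_open (cimg c)" and 2: "inj_on (cmap c) (cdom c)"
    and "continuous_map (subtopology (mspace M) (cdom c)) euclidean (cmap c)"
    and "continuous_map (top_of_set (cimg c)) (mspace M) (cinv c)"
    using A by simp_all
  show "cdom c \<subseteq> carr M" by (rule openin_subset[OF 1])
  show "p \<in> cdom c \<Longrightarrow> cinv c (cmap c p) = p" by (rule cinv_cmap[OF 2])
qed

lemma smooth_atlasD:
  assumes "smooth_atlas M"
  shows "carr M = (\<Union>c\<in>atlas M. cdom c)" "c \<in> atlas M \<Longrightarrow> chart_on M c"
    "c \<in> atlas M \<Longrightarrow> c' \<in> atlas M \<Longrightarrow> smooth_on (cmap c ` (cdom c \<inter> cdom c')) (\<lambda>x. cmap c' (cinv c x))"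
proof -
  note A = assms[unfolded smooth_atlas_def]
  show "carr M = (\<Union>c\<in>atlas M. cdom c)" by (rule conjunct1[OF A])
  show "c \<in> atlas M \<Longrightarrow> chart_on M c" by (rule bspec[OF conjunct1[OF conjunct2[OF A]]])
  show "c \<in> atlas M \<Longrightarrow> c' \<in> atlas M \<Longrightarrow>
      smooth_on (cmap c ` (cdom c \<inter> cdom c')) (\<lambda>x. cmap c' (cinv c x))"
    by (rule bspec[OF bspec[OF conjunct2[OF conjunct2[OF A]]]])
qed

lemma smooth_manifold_smooth_atlas:
  assumes "smooth_manifold M" shows "smooth_atlas M"
  unfolding smooth_atlas_def
proof (intro conjI ballI)
  show "carr M = (\<Union>c\<in>atlas M. cdom c)" using assms unfolding smooth_manifold_def by (elim conjE)
next
  fix c assume c: "c \<in> atlas M"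
  have o: "openin (mspace M) (cdom c)" "model_open (cimg c)"
    and h: "homeomorphic_map (subtopology (mspace M) (cdom c)) (top_of_set (cimg c)) (cmap c)"
    using assms c unfolding smooth_manifold_def by simp_all
  have top: "topspace (subtopology (mspace M) (cdom c)) = cdom c"
    using openin_subset[OF o(1)] by auto
  obtain g where g: "continuous_map (subtopology (mspace M) (cdom c)) (top_of_set (cimg c)) (cmap c)"
    "continuous_map (top_of_set (cimg c)) (subtopology (mspace M) (cdom c)) g"
    "\<And>p. p \<in> cdom c \<Longrightarrow> g (cmap c p) = p"
    using h unfolding homeomorphic_map_maps homeomorphic_maps_def top by auto
  have inj: "inj_on (cmap c) (cdom c)" using g(3) by (metis inj_onI)
  have "continuous_map (top_of_set (cimg c)) (mspace M) g"
    using g(2) continuous_map_in_subtopology by blast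
  then have "continuous_map (top_of_set (cimg c)) (mspace M) (cinv c)"
    by (rule continuous_map_eq) (use g(3) cinv_cmap[OF inj] in auto)
  moreover have "continuous_map (subtopology (mspace M) (cdom c)) euclidean (cmap c)"
    using g(1) continuous_map_in_subtopology by blast
  ultimately show "chart_on M c" unfolding chart_on_def using o inj by blast
next
  fix c c' assume "c \<in> atlas M" "c' \<in> atlas M"
  then show "smooth_on (cmap c ` (cdom c \<inter> cdom c')) (\<lambda>x. cmap c' (cinv c x))"
    using assms by (simp add: smooth_manifold_def comp_def)
qed

lemma chart_at:
  assumes "smooth_atlas M" "p \<in> carr M"
  shows "chart_at M p \<in> atlas M" "p \<in> cdom (chart_at M p)"
proof -
  have "\<exists>c. c \<in> atlas M \<and> p \<in> cdom c" using smooth_atlasD(1)[OF assms(1)] assms(2) by blast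
  then have "chart_at M p \<in> atlas M \<and> p \<in> cdom (chart_at M p)" unfolding chart_at_def by (rule someI_ex)
  then show "chart_at M p \<in> atlas M" "p \<in> cdom (chart_at M p)" by auto
qed

lemma chart_image_openin:
  assumes c: "chart_on M c" and W: "openin (mspace M) W" "W \<subseteq> cdom c"
  shows "openin (top_of_set (cimg c)) (cmap c ` W)"
proof -
  have "openin (top_of_set (cimg c)) {x \<in> topspace (top_of_set (cimg c)). cinv c x \<in> W}"
    using chart_onD(7)[OF c] W(1) by (rule openin_continuous_map_preimage)
  moreover have "{x \<in> topspace (top_of_set (cimg c)). cinv c x \<in> W} = cmap c ` W"
  proof (intro set_eqI iffI)
    fix x assume "x \<in> {x \<in> topspace (top_of_set (cimg c)). cinv c x \<in> W}"
    then have "x \<in> cimg c" "cinv c x \<in> W" by auto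
    then show "x \<in> cmap c ` W" using cmap_cinv[of x c] by (metis imageI)
  next
    fix x assume "x \<in> cmap c ` W"
    then obtain q where "q \<in> W" "x = cmap c q" by blast
    then show "x \<in> {x \<in> topspace (top_of_set (cimg c)). cinv c x \<in> W}"
      using W(2) chart_onD(5)[OF c, of q] by auto
  qed
  ultimately show ?thesis by simp
qed

text \<open>Turns a neighbourhood in the manifold into an open set of the model space, where
  derivatives within a set are unaffected by restriction.\<close>

lemma chart_nhd:
  assumes c: "chart_on M c" and W: "openin (mspace M) W" and p: "p \<in> W" "p \<in> cdom c"
  obtains U where "open U" "cmap c p \<in> U" "\<And>q. q \<in> cdom c \<Longrightarrow> cmap c q \<in> U \<Longrightarrow> q \<in> W"
proof -
  have "openin (top_of_set (cimg c)) (cmap c ` (W \<inter> cdom c))"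
    by (rule chart_image_openin[OF c openin_Int[OF W chart_onD(1)[OF c]]]) simp
  then obtain U where U: "open U" "cmap c ` (W \<inter> cdom c) = cimg c \<inter> U"
    unfolding openin_open by blast
  show thesis
  proof (rule that[OF U(1)])
    show "cmap c p \<in> U" using U(2) p by blast
    fix q assume q: "q \<in> cdom c" "cmap c q \<in> U"
    then obtain q' where "q' \<in> W \<inter> cdom c" "cmap c q = cmap c q'" using U(2) by blast
    then show "q \<in> W" using q(1) chart_onD(3)[OF c] by (metis IntD1 IntD2 inj_onD)
  qed
qed

lemma preimage_nhd:
  assumes c: "chart_on M c" and f: "continuous_map (subtopology (mspace M) D) (mspace N) f"
    and W: "openin (mspace N) W" and p: "p \<in> D" "p \<in> cdom c" "f p \<in> W"
  obtains U where "open U" "cmap c p \<in> U" "\<And>q. q \<in> cdom c \<Longrightarrow> q \<in> D \<Longrightarrow> cmap c q \<in> U \<Longrightarrow> f q \<in> W"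
proof -
  have "openin (subtopology (mspace M) D) {q \<in> topspace (subtopology (mspace M) D). f q \<in> W}"
    using f W by (rule openin_continuous_map_preimage)
  then obtain V where V: "openin (mspace M) V" "{q \<in> topspace (subtopology (mspace M) D). f q \<in> W} = V \<inter> D"
    unfolding openin_subtopology by blast
  have sub: "cdom c \<subseteq> carr M" by (rule chart_onD(4)[OF c])
  have "p \<in> V" using V(2) p sub by auto
  then obtain U where U: "open U" "cmap c p \<in> U" "\<And>q. q \<in> cdom c \<Longrightarrow> cmap c q \<in> U \<Longrightarrow> q \<in> V"
    using chart_nhd[OF c V(1) _ p(2)] by metis
  show thesis by (rule that[OF U(1,2)]) (use U(3) V(2) in auto)
qed

lemma smooth_map_onD:
  assumes "smooth_map_on M D N f"
  shows "continuous_map (subtopology (mspace M) D) (mspace N) f"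
    "c \<in> atlas M \<Longrightarrow> e \<in> atlas N \<Longrightarrow>
      smooth_on (cmap c ` (cdom c \<inter> D \<inter> f -` cdom e)) (\<lambda>x. cmap e (f (cinv c x)))"
proof -
  note A = assms[unfolded smooth_map_on_def comp_def]
  show "continuous_map (subtopology (mspace M) D) (mspace N) f" by (rule conjunct1[OF A])
  show "c \<in> atlas M \<Longrightarrow> e \<in> atlas N \<Longrightarrow>
      smooth_on (cmap c ` (cdom c \<inter> D \<inter> f -` cdom e)) (\<lambda>x. cmap e (f (cinv c x)))"
    by (rule bspec[OF bspec[OF conjunct2[OF A]]])
qed

lemma smooth_map_onI:
  assumes "continuous_map (subtopology (mspace M) D) (mspace N) f"
    "\<And>c e. c \<in> atlas M \<Longrightarrow> e \<in> atlas N \<Longrightarrow>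
      smooth_on (cmap c ` (cdom c \<inter> D \<inter> f -` cdom e)) (\<lambda>x. cmap e (f (cinv c x)))"
  shows "smooth_map_on M D N f"
  unfolding smooth_map_on_def comp_def by (intro conjI ballI assms)

lemma smooth_map_on_subset:
  assumes "smooth_map_on M D N f" "D' \<subseteq> D"
  shows "smooth_map_on M D' N f"
proof (rule smooth_map_onI)
  show "continuous_map (subtopology (mspace M) D') (mspace N) f"
    using smooth_map_onD(1)[OF assms(1)] assms(2) by (rule continuous_map_from_subtopology_mono)
  show "smooth_on (cmap c ` (cdom c \<inter> D' \<inter> f -` cdom e)) (\<lambda>x. cmap e (f (cinv c x)))"
    if "c \<in> atlas M" "e \<in> atlas N" for c e
    by (rule smooth_on_subset[OF smooth_map_onD(2)[OF assms(1) that]]) (use assms(2) in auto)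
qed

lemma smooth_map_on_cong:
  assumes M: "smooth_atlas M" and f: "smooth_map_on M D N f" and eq: "\<And>p. p \<in> D \<Longrightarrow> p \<in> carr M \<Longrightarrow> f p = g p"
  shows "smooth_map_on M D N g"
proof (rule smooth_map_onI)
  show "continuous_map (subtopology (mspace M) D) (mspace N) g"
    by (rule continuous_map_eq[OF smooth_map_onD(1)[OF f]]) (use eq in simp)
  fix c e assume ce: "c \<in> atlas M" "e \<in> atlas N"
  note c = smooth_atlasD(2)[OF M ce(1)]
  show "smooth_on (cmap c ` (cdom c \<inter> D \<inter> g -` cdom e)) (\<lambda>x. cmap e (g (cinv c x)))"
  proof (rule smooth_on_cong_subset[OF smooth_map_onD(2)[OF f ce]])
    show "cmap c ` (cdom c \<inter> D \<inter> g -` cdom e) \<subseteq> cmap c ` (cdom c \<inter> D \<inter> f -` cdom e)"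
      using eq chart_onD(4)[OF c] by (intro image_mono) auto
    show "cmap e (f (cinv c x)) = cmap e (g (cinv c x))"
      if "x \<in> cmap c ` (cdom c \<inter> D \<inter> g -` cdom e)" for x
      using that chart_onD(4,5)[OF c] eq by auto
  qed
qed

lemma smooth_map_on_compose:
  assumes M: "smooth_atlas M" and N: "smooth_atlas N"
    and f: "smooth_map_on M D N f" and g: "smooth_map_on N B K g"
    and fD: "\<And>p. p \<in> D \<Longrightarrow> p \<in> carr M \<Longrightarrow> f p \<in> B"
  shows "smooth_map_on M D K (\<lambda>p. g (f p))"
proof (rule smooth_map_onI)
  note fc = smooth_map_onD(1)[OF f]
  have "continuous_map (subtopology (mspace M) D) (subtopology (mspace N) B) f"
    by (rule continuous_map_into_subtopology[OF fc]) (use fD in auto)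
  then have "continuous_map (subtopology (mspace M) D) (mspace K) (g \<circ> f)"
    using smooth_map_onD(1)[OF g] by (rule continuous_map_compose)
  then show "continuous_map (subtopology (mspace M) D) (mspace K) (\<lambda>p. g (f p))"
    by (simp add: comp_def)
  fix c e assume ce: "c \<in> atlas M" "e \<in> atlas K"
  note c = smooth_atlasD(2)[OF M ce(1)]
  let ?S = "cmap c ` (cdom c \<inter> D \<inter> (\<lambda>p. g (f p)) -` cdom e)"
  show "smooth_on ?S (\<lambda>x. cmap e (g (f (cinv c x))))"
  proof (rule smooth_on_local)
    fix x assume "x \<in> ?S"
    then obtain p where p: "x = cmap c p" "p \<in> cdom c" "p \<in> D" "g (f p) \<in> cdom e" by blast
    have "p \<in> carr M" using p(2) chart_onD(4)[OF c] by blast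
    then have "f p \<in> carr N"
      using fc p(3) unfolding continuous_map_def by (auto simp: Pi_iff)
    \<comment> \<open>An intermediate chart around \<open>f p\<close>. The image of f need not stay
      in it, so smoothness is shown on a neighbourhood and then glued.\<close>
    then obtain d where d: "d \<in> atlas N" "f p \<in> cdom d" using chart_at[OF N] by blast
    note dc = smooth_atlasD(2)[OF N d(1)]
    obtain U where U: "open U" "cmap c p \<in> U"
      "\<And>q. q \<in> cdom c \<Longrightarrow> q \<in> D \<Longrightarrow> cmap c q \<in> U \<Longrightarrow> f q \<in> cdom d"
      by (rule preimage_nhd[OF c fc chart_onD(1)[OF dc] p(3,2) d(2)]) blast
    have "smooth_on (?S \<inter> U) (\<lambda>x. cmap d (f (cinv c x)))"
      by (rule smooth_on_subset[OF smooth_map_onD(2)[OF f ce(1) d(1)]]) (use U(3) in auto)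
    then have "smooth_on (?S \<inter> U) (\<lambda>x. cmap e (g (cinv d (cmap d (f (cinv c x))))))"
    proof (rule smooth_on_compose[OF _ smooth_map_onD(2)[OF g d(1) ce(2)]])
      fix x assume "x \<in> ?S \<inter> U"
      then obtain q where q: "q \<in> cdom c" "q \<in> D" "g (f q) \<in> cdom e" "x = cmap c q" "cmap c q \<in> U"
        by blast
      moreover have "f q \<in> B" using q chart_onD(4)[OF c] by (intro fD) auto
      ultimately show "cmap d (f (cinv c x)) \<in> cmap d ` (cdom d \<inter> B \<inter> g -` cdom e)"
        using U(3) chart_onD(5)[OF c] by auto
    qed
    then have "smooth_on (?S \<inter> U) (\<lambda>x. cmap e (g (f (cinv c x))))"
      by (rule smooth_on_cong) (use U(3) chart_onD(5)[OF c] chart_onD(5)[OF dc] in auto)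
    then show "\<exists>T. open T \<and> x \<in> T \<and> smooth_on (?S \<inter> T) (\<lambda>x. cmap e (g (f (cinv c x))))"
      using U p(1) by blast
  qed
qed

lemma smooth_map_on_ident:
  assumes "smooth_atlas M"
  shows "smooth_map_on M D M (\<lambda>p. p)"
proof (rule smooth_map_onI)
  show "continuous_map (subtopology (mspace M) D) (mspace M) (\<lambda>p. p)"
    by (rule continuous_map_from_subtopology) simp
  show "smooth_on (cmap c ` (cdom c \<inter> D \<inter> (\<lambda>p. p) -` cdom e)) (\<lambda>x. cmap e (cinv c x))"
    if "c \<in> atlas M" "e \<in> atlas M" for c e
    by (rule smooth_on_subset[OF smooth_atlasD(3)[OF assms that]]) auto
qed

section \<open>Derivatives in charts\<close>

text \<open>\<open>has_mderiv_on\<close> knows only the preferred charts; factoring maps through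
  other charts requires derivatives with respect to freely chosen ones.\<close>

definition rderiv ::
    "('a, 'e::euclidean_space) chart \<Rightarrow> 'a set \<Rightarrow> ('b, 'f::euclidean_space) chart \<Rightarrow> ('a \<Rightarrow> 'b) \<Rightarrow> 'a \<Rightarrow> ('e \<Rightarrow> 'f) \<Rightarrow> bool"
  where "rderiv c D e f p L \<longleftrightarrow>
    ((\<lambda>x. cmap e (f (cinv c x))) has_derivative L) (at (cmap c p) within cmap c ` (cdom c \<inter> D))"

lemma has_mderiv_on_rderiv:
  "has_mderiv_on M D N f p L = rderiv (chart_at M p) D (chart_at N (f p)) f p L"
  by (simp add: has_mderiv_on_def rderiv_def comp_def)

lemma rderiv_linear: "rderiv c D e f p L \<Longrightarrow> linear L"
  unfolding rderiv_def using has_derivative_linear by blast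

lemma rderiv_mono: "rderiv c D e f p L \<Longrightarrow> D' \<subseteq> D \<Longrightarrow> rderiv c D' e f p L"
  unfolding rderiv_def by (rule has_derivative_subset) auto

lemma rderiv_cong:
  assumes "rderiv c D e f p L" "inj_on (cmap c) (cdom c)" "p \<in> cdom c" "p \<in> D"
    "\<And>q. q \<in> cdom c \<Longrightarrow> q \<in> D \<Longrightarrow> f q = g q"
  shows "rderiv c D e g p L"
  using assms(1) unfolding rderiv_def
  by (rule has_derivative_transform[rotated 2]) (use assms cinv_cmap[OF assms(2)] in auto)

text \<open>The open set \<open>U\<close> expresses that f has to land in the middle chart and in
  \<open>B\<close> only near p, since derivatives are local.\<close>

lemma rderiv_chain:
  assumes f: "rderiv c D e f p L" and g: "rderiv e B k g (f p) L'"
    and inj: "inj_on (cmap c) (cdom c)" "inj_on (cmap e) (cdom e)"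
    and p: "p \<in> cdom c" "p \<in> D"
    and U: "open U" "cmap c p \<in> U" "\<And>q. q \<in> cdom c \<Longrightarrow> q \<in> D \<Longrightarrow> cmap c q \<in> U \<Longrightarrow> f q \<in> cdom e \<and> f q \<in> B"
  shows "rderiv c D k (\<lambda>p. g (f p)) p (\<lambda>v. L' (L v))"
proof -
  let ?S = "cmap c ` (cdom c \<inter> D)"
  have cx: "cinv c (cmap c p) = p" by (rule cinv_cmap[OF inj(1) p(1)])
  have fp: "f p \<in> cdom e" using U(3)[OF p U(2)] by simp
  have nhd: "at (cmap c p) within ?S \<inter> U = at (cmap c p) within ?S"
    by (rule at_within_nhd[OF U(2,1)]) auto
  have 1: "((\<lambda>x. cmap e (f (cinv c x))) has_derivative L) (at (cmap c p) within ?S \<inter> U)"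
    using f unfolding rderiv_def nhd .
  have sub: "(\<lambda>x. cmap e (f (cinv c x))) ` (?S \<inter> U) \<subseteq> cmap e ` (cdom e \<inter> B)"
    using U(3) cinv_cmap[OF inj(1)] by auto
  have "((\<lambda>x. cmap k (g (cinv e x))) has_derivative L') (at (cmap e (f (cinv c (cmap c p)))) within cmap e ` (cdom e \<inter> B))"
    using g unfolding rderiv_def cx .
  then have 2: "((\<lambda>x. cmap k (g (cinv e x))) has_derivative L')
      (at (cmap e (f (cinv c (cmap c p)))) within (\<lambda>x. cmap e (f (cinv c x))) ` (?S \<inter> U))"
    using sub by (rule has_derivative_subset)
  have "((\<lambda>x. cmap k (g (cinv e (cmap e (f (cinv c x)))))) has_derivative (\<lambda>v. L' (L v)))
      (at (cmap c p) within ?S \<inter> U)"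
    by (rule has_derivative_in_compose[OF 1 2])
  then have "((\<lambda>x. cmap k (g (f (cinv c x)))) has_derivative (\<lambda>v. L' (L v)))
      (at (cmap c p) within ?S \<inter> U)"
  proof (rule has_derivative_transform[rotated 2])
    show "cmap c p \<in> ?S \<inter> U" using p U by blast
    fix x assume "x \<in> ?S \<inter> U"
    then obtain q where "q \<in> cdom c" "q \<in> D" "x = cmap c q" "cmap c q \<in> U" by blast
    then show "cmap k (g (f (cinv c x))) = cmap k (g (cinv e (cmap e (f (cinv c x)))))"
      using U(3)[of q] cinv_cmap[OF inj(1)] cinv_cmap[OF inj(2)] by simp
  qed
  then show ?thesis unfolding rderiv_def nhd .
qed

lemma rderiv_exists:
  assumes M: "chart_on M c" and N: "chart_on N e" and f: "smooth_map_on M D N f"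
    and c: "c \<in> atlas M" "p \<in> cdom c" "p \<in> D" and e: "e \<in> atlas N" "f p \<in> cdom e"
  obtains L where "rderiv c D e f p L"
proof -
  obtain U where U: "open U" "cmap c p \<in> U"
    "\<And>q. q \<in> cdom c \<Longrightarrow> q \<in> D \<Longrightarrow> cmap c q \<in> U \<Longrightarrow> f q \<in> cdom e"
    by (rule preimage_nhd[OF M smooth_map_onD(1)[OF f] chart_onD(1)[OF N] c(3,2) e(2)]) blast
  let ?S = "cmap c ` (cdom c \<inter> D \<inter> f -` cdom e)"
  have "cmap c p \<in> ?S" using c e by blast
  then obtain L where L: "((\<lambda>x. cmap e (f (cinv c x))) has_derivative L) (at (cmap c p) within ?S)"
    using smooth_on_has_derivative[OF smooth_map_onD(2)[OF f c(1) e(1)]] by metis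
  have "at (cmap c p) within ?S = at (cmap c p) within cmap c ` (cdom c \<inter> D)"
    by (rule at_within_nhd[OF U(2,1)]) (use U(3) in auto)
  then show thesis using that L unfolding rderiv_def by simp
qed

text \<open>Stated for the full carrier, where the chart image is a model set; for a general domain,
  such as a rescaled one, the image may lack the directions that determine a derivative.\<close>

lemma rderiv_unique:
  assumes "chart_on M c" "p \<in> cdom c" "rderiv c (carr M) e f p L" "rderiv c (carr M) e f p L'"
  shows "L = L'"
proof -
  have "cdom c \<inter> carr M = cdom c" using chart_onD(4)[OF assms(1)] by blast
  note d = assms(3,4)[unfolded rderiv_def this]
  show ?thesis
    by (rule model_open_derivative_unique[OF chart_onD(2)[OF assms(1)] _ d]) (use assms(2) in simp)
qed

lemma mderiv:
  assumes M: "smooth_atlas M" and N: "smooth_atlas N" and f: "smooth_map_on M (carr M) N f"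
    and p: "p \<in> carr M"
  shows "has_mderiv_on M (carr M) N f p (mderiv M N f p)"
    and "has_mderiv_on M (carr M) N f p L \<Longrightarrow> mderiv M N f p = L"
    and "linear (mderiv M N f p)"
proof -
  have "f p \<in> carr N"
    using smooth_map_onD(1)[OF f] p unfolding continuous_map_def by (auto simp: Pi_iff)
  note c = chart_at[OF M p] and e = chart_at[OF N this]
  obtain L0 where "rderiv (chart_at M p) (carr M) (chart_at N (f p)) f p L0"
    by (rule rderiv_exists[OF smooth_atlasD(2)[OF M c(1)] smooth_atlasD(2)[OF N e(1)] f c p e])
  then show *: "has_mderiv_on M (carr M) N f p (mderiv M N f p)"
    unfolding mderiv_def has_mderiv_on_rderiv by (rule someI[of "\<lambda>L. rderiv _ _ _ _ _ L"])
  then show "has_mderiv_on M (carr M) N f p L \<Longrightarrow> mderiv M N f p = L"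
    unfolding has_mderiv_on_rderiv by (rule rderiv_unique[OF smooth_atlasD(2)[OF M c(1)] c(2)])
  show "linear (mderiv M N f p)" by (rule rderiv_linear[OF *[unfolded has_mderiv_on_rderiv]])
qed

lemma has_mderiv_on_chain:
  assumes X: "smooth_atlas X" and M: "smooth_atlas M"
    and fc: "continuous_map (subtopology (mspace X) D) (mspace M) f"
    and f: "has_mderiv_on X D M f p L" and g: "has_mderiv_on M (carr M) N g (f p) L'"
    and p: "p \<in> D" "p \<in> carr X"
  shows "has_mderiv_on X D N (\<lambda>p. g (f p)) p (\<lambda>v. L' (L v))"
proof -
  have fq: "f q \<in> carr M" if "q \<in> D" "q \<in> carr X" for q
    using fc that unfolding continuous_map_def by (auto simp: Pi_iff)
  note c = chart_at[OF X p(2)] and e = chart_at[OF M fq[OF p]]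
  note cc = smooth_atlasD(2)[OF X c(1)] and ec = smooth_atlasD(2)[OF M e(1)]
  obtain U where U: "open U" "cmap (chart_at X p) p \<in> U"
    "\<And>q. q \<in> cdom (chart_at X p) \<Longrightarrow> q \<in> D \<Longrightarrow> cmap (chart_at X p) q \<in> U \<Longrightarrow> f q \<in> cdom (chart_at M (f p))"
    by (rule preimage_nhd[OF cc fc chart_onD(1)[OF ec] p(1) c(2) e(2)]) blast
  show ?thesis
    using f g unfolding has_mderiv_on_rderiv
    by (rule rderiv_chain[OF _ _ chart_onD(3)[OF cc] chart_onD(3)[OF ec] c(2) p(1) U(1,2)])
      (use U(3) chart_onD(4)[OF ec] in auto)
qed

lemma smooth_atlas_euclidean: "smooth_atlas euclidean_manifold"
  unfolding smooth_atlas_def chart_on_def euclidean_manifold_def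
  by (auto simp: model_open_def cinv_def smooth_on_ident)

lemma euclidean_manifold_simps [simp]:
  "mspace euclidean_manifold = euclidean" "atlas euclidean_manifold = {(UNIV, id)}"
  "chart_at euclidean_manifold p = (UNIV, id)" "cinv (UNIV, id) = id"
  by (auto simp: euclidean_manifold_def chart_at_def cinv_def)

lemma smooth_map_on_euclidean_iff:
  assumes M: "smooth_atlas M"
  shows "smooth_map_on M D euclidean_manifold f \<longleftrightarrow>
    continuous_map (subtopology (mspace M) D) euclidean f \<and>
    (\<forall>c\<in>atlas M. smooth_on (cmap c ` (cdom c \<inter> D)) (\<lambda>x. f (cinv c x)))"
  by (simp add: smooth_map_on_def comp_def)

lemma has_mderiv_on_euclidean_const:
  "has_mderiv_on M D euclidean_manifold (\<lambda>p. k) p (\<lambda>v. 0)"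
  by (simp add: has_mderiv_on_rderiv rderiv_def)

section \<open>1-forms and their exterior derivatives\<close>

lemma smooth_map_in:
  assumes "smooth_map_on M (carr M) N f" "p \<in> carr M"
  shows "f p \<in> carr N"
  using smooth_map_onD(1)[OF assms(1)] assms(2) unfolding continuous_map_def by (auto simp: Pi_iff)

lemma rderiv_whole:
  assumes M: "chart_on M c" and p: "p \<in> cdom c"
  shows "rderiv c (carr M) e f p L \<longleftrightarrow> ((\<lambda>x. cmap e (f (cinv c x))) has_derivative L) (at (cmap c p) within cimg c)"
proof -
  have "cdom c \<inter> carr M = cdom c" using chart_onD(4)[OF M] by blast
  then show ?thesis unfolding rderiv_def by simp
qed

text \<open>The preferred chart may change from point to point without any continuity. The formula
  is pointwise, with \<open>L\<close> the differential of the transition to the preferred chart at p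
  itself.\<close>

lemma form_in_chart_rderiv:
  assumes M: "smooth_atlas M" and c: "c \<in> atlas M" "p \<in> cdom c"
    and L: "rderiv c (carr M) (chart_at M p) (\<lambda>p. p) p L"
  shows "form_in_chart M \<theta> c (cmap c p) v = \<theta> p (L v)"
proof -
  note cc = smooth_atlasD(2)[OF M c(1)]
  have "((\<lambda>x. cmap (chart_at M p) (cinv c x)) has_derivative L) (at (cmap c p) within cimg c)"
    by (rule iffD1[OF rderiv_whole[OF cc c(2)] L])
  from frechet_derivative_model_open[OF chart_onD(2)[OF cc] imageI[OF c(2)] this]
  show ?thesis by (simp add: form_in_chart_def comp_def chart_onD(5)[OF cc c(2)])
qed

lemma rderiv_ident_exists:
  assumes M: "smooth_atlas M" and c: "c \<in> atlas M" "p \<in> cdom c"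
  obtains L where "rderiv c (carr M) (chart_at M p) (\<lambda>p. p) p L"
proof -
  note cc = smooth_atlasD(2)[OF M c(1)]
  have p: "p \<in> carr M" using chart_onD(4)[OF cc] c(2) by blast
  note e = chart_at[OF M p]
  show thesis
    by (rule rderiv_exists[OF cc smooth_atlasD(2)[OF M e(1)] smooth_map_on_ident[OF M] c p e that])
qed

lemma form_in_chart_linear:
  assumes M: "smooth_atlas M" and c: "c \<in> atlas M" and \<theta>: "smooth_one_form M \<theta>" and x: "x \<in> cimg c"
  shows "linear (form_in_chart M \<theta> c x)"
proof -
  obtain p where p: "p \<in> cdom c" "x = cmap c p" using x by blast
  obtain L where L: "rderiv c (carr M) (chart_at M p) (\<lambda>p. p) p L"
    by (rule rderiv_ident_exists[OF M c p(1)])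
  have "p \<in> carr M" using chart_onD(4)[OF smooth_atlasD(2)[OF M c]] p(1) by blast
  then have "linear (\<theta> p)" using \<theta> unfolding smooth_one_form_def by simp
  from linear_compose[OF rderiv_linear[OF L] this]
  have "linear (\<lambda>v. \<theta> p (L v))" by (simp add: comp_def)
  moreover have "form_in_chart M \<theta> c x = (\<lambda>v. \<theta> p (L v))"
    using form_in_chart_rderiv[OF M c p(1) L] p(2) by auto
  ultimately show ?thesis by simp
qed

lemma form_in_chart_smooth:
  "smooth_one_form M \<theta> \<Longrightarrow> c \<in> atlas M \<Longrightarrow> smooth_on (cimg c) (\<lambda>x. form_in_chart M \<theta> c x v)"
  unfolding smooth_one_form_def by simp

lemma ext_deriv_dform:
  "ext_deriv M \<theta> p u v = dform (cimg (chart_at M p)) (form_in_chart M \<theta> (chart_at M p)) (cmap (chart_at M p) p) u v"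
  by (simp add: ext_deriv_def dform_def Let_def)

lemma ext_deriv_linear:
  assumes M: "smooth_atlas M" and \<theta>: "smooth_one_form M \<theta>" and p: "p \<in> carr M"
  shows "linear (\<lambda>u. ext_deriv M \<theta> p u v)" "linear (ext_deriv M \<theta> p u)"
proof -
  note c = chart_at[OF M p]
  note l = dform_linear[OF chart_onD(2)[OF smooth_atlasD(2)[OF M c(1)]] imageI[OF c(2)]
      form_in_chart_linear[OF M c(1) \<theta>] form_in_chart_smooth[OF \<theta> c(1)]]
  show "linear (\<lambda>u. ext_deriv M \<theta> p u v)" unfolding ext_deriv_dform by (rule l(1))
  show "linear (ext_deriv M \<theta> p u)" unfolding ext_deriv_dform by (rule l(2))
qed

lemma ext_deriv_antisym: "ext_deriv M \<theta> p u v = - ext_deriv M \<theta> p v u"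
  by (simp add: ext_deriv_dform dform_def)

definition pullback_form ::
    "('a, 'e::euclidean_space) manifold \<Rightarrow> ('b, 'f::euclidean_space) manifold \<Rightarrow> ('a \<Rightarrow> 'b) \<Rightarrow>
     ('b \<Rightarrow> 'f \<Rightarrow> real) \<Rightarrow> 'a \<Rightarrow> 'e \<Rightarrow> real"
  where "pullback_form M N f \<theta> p v = \<theta> (f p) (mderiv M N f p v)"

text \<open>There are two routes from the chart \<open>c\<close> at q to the preferred chart at
  \<open>f q\<close>: through the preferred chart at q, or through \<open>d\<close>. The chain rule
  and uniqueness make their differentials equal.\<close>

lemma form_in_chart_pullback:
  assumes M: "smooth_atlas M" and N: "smooth_atlas N" and f: "smooth_map_on M (carr M) N f"
    and c: "c \<in> atlas M" "q \<in> cdom c" and d: "d \<in> atlas N" "f q \<in> cdom d"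
    and K: "rderiv c (carr M) d f q K"
  shows "form_in_chart M (pullback_form M N f \<theta>) c (cmap c q) v = form_in_chart N \<theta> d (cmap d (f q)) (K v)"
proof -
  note cc = smooth_atlasD(2)[OF M c(1)] and dc = smooth_atlasD(2)[OF N d(1)]
  have q: "q \<in> carr M" using chart_onD(4)[OF cc] c(2) by blast
  note fq = smooth_map_in[OF f q]
  note cq = chart_at[OF M q] and e = chart_at[OF N fq]
  note cqc = smooth_atlasD(2)[OF M cq(1)]
  obtain L1 where L1: "rderiv c (carr M) (chart_at M q) (\<lambda>p. p) q L1"
    by (rule rderiv_ident_exists[OF M c])
  obtain L3 where L3: "rderiv d (carr N) (chart_at N (f q)) (\<lambda>p. p) (f q) L3"
    by (rule rderiv_ident_exists[OF N d])
  note L2 = mderiv(1)[OF M N f q, unfolded has_mderiv_on_rderiv]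
  obtain U where U: "open U" "cmap c q \<in> U" "\<And>p. p \<in> cdom c \<Longrightarrow> cmap c p \<in> U \<Longrightarrow> p \<in> cdom (chart_at M q)"
    using chart_nhd[OF cc chart_onD(1)[OF cqc] cq(2) c(2)] by metis
  have A: "rderiv c (carr M) (chart_at N (f q)) f q (\<lambda>v. mderiv M N f q (L1 v))"
    by (rule rderiv_chain[OF L1 L2 chart_onD(3)[OF cc] chart_onD(3)[OF cqc] c(2) q U(1,2)])
      (use U(3) in auto)
  obtain V where V: "open V" "cmap c q \<in> V"
    "\<And>p. p \<in> cdom c \<Longrightarrow> p \<in> carr M \<Longrightarrow> cmap c p \<in> V \<Longrightarrow> f p \<in> cdom d"
    by (rule preimage_nhd[OF cc smooth_map_onD(1)[OF f] chart_onD(1)[OF dc] q c(2) d(2)]) blast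
  have B: "rderiv c (carr M) (chart_at N (f q)) f q (\<lambda>v. L3 (K v))"
    by (rule rderiv_chain[OF K L3 chart_onD(3)[OF cc] chart_onD(3)[OF dc] c(2) q V(1,2)])
      (use V(3) smooth_map_in[OF f] in auto)
  have "mderiv M N f q (L1 v) = L3 (K v)"
    using rderiv_unique[OF cc c(2) A B] by meson
  then show ?thesis
    by (simp add: form_in_chart_rderiv[OF M c L1] form_in_chart_rderiv[OF N d L3] pullback_form_def)
qed

lemma dform_restrict:
  assumes "open U" "x \<in> U"
  shows "dform (S \<inter> U) A x u v = dform S A x u v"
proof -
  have "at x within S \<inter> U = at x within S" by (rule at_within_nhd[OF assms(2,1)]) auto
  then show ?thesis by (simp add: dform_def)
qed

text \<open>Naturality of d, reduced to \<open>dform_pullback\<close> in the preferred charts. The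
  second claim provides the differentiability of the pulled-back form that
  \<open>ext_deriv_add\<close> asks for.\<close>

lemma ext_deriv_pullback:
  assumes M: "smooth_atlas M" and N: "smooth_atlas N" and f: "smooth_map_on M (carr M) N f"
    and \<theta>: "smooth_one_form N \<theta>" and p: "p \<in> carr M"
  shows "ext_deriv M (pullback_form M N f \<theta>) p u v
      = ext_deriv N \<theta> (f p) (mderiv M N f p u) (mderiv M N f p v)"
    and "(\<lambda>x. form_in_chart M (pullback_form M N f \<theta>) (chart_at M p) x v) differentiable
      (at (cmap (chart_at M p) p) within cimg (chart_at M p))"
proof -
  let ?c = "chart_at M p" and ?d = "chart_at N (f p)"
  note fp = smooth_map_in[OF f p]
  note c = chart_at[OF M p] and d = chart_at[OF N fp]
  note cc = smooth_atlasD(2)[OF M c(1)] and dc = smooth_atlasD(2)[OF N d(1)]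
  obtain U where U: "open U" "cmap ?c p \<in> U"
    "\<And>q. q \<in> cdom ?c \<Longrightarrow> q \<in> carr M \<Longrightarrow> cmap ?c q \<in> U \<Longrightarrow> f q \<in> cdom ?d"
    by (rule preimage_nhd[OF cc smooth_map_onD(1)[OF f] chart_onD(1)[OF dc] p c(2) d(2)]) blast
  \<comment> \<open>The part of the chart image that f maps into the preferred chart at
    \<open>f p\<close>.\<close>
  let ?I = "cimg ?c \<inter> U"
  have I: "model_open ?I" by (rule model_open_Int_open[OF chart_onD(2)[OF cc] U(1)])
  have J: "model_open (cimg ?d)" by (rule chart_onD(2)[OF dc])
  have x: "cmap ?c p \<in> ?I" using c(2) U(2) by simp
  let ?\<psi> = "\<lambda>x. cmap ?d (f (cinv ?c x))"
  have Iq: "\<exists>q. q \<in> cdom ?c \<and> q \<in> carr M \<and> f q \<in> cdom ?d \<and> y = cmap ?c q \<and> cinv ?c y = q" if "y \<in> ?I" for y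
    using that U(3) chart_onD(4,5)[OF cc] by fastforce
  have \<psi>J: "?\<psi> y \<in> cimg ?d" if "y \<in> ?I" for y using Iq[OF that] by auto
  have \<psi>: "smooth_on ?I ?\<psi>"
  proof (rule smooth_on_subset[OF smooth_map_onD(2)[OF f c(1) d(1)]])
    show "?I \<subseteq> cmap ?c ` (cdom ?c \<inter> carr M \<inter> f -` cdom ?d)" using Iq by fast
  qed
  let ?A = "form_in_chart N \<theta> ?d"
  let ?D = "\<lambda>y. frechet_derivative ?\<psi> (at y within ?I)"
  have der: "rderiv ?c (carr M) ?d f q (?D y)" if "y \<in> ?I" "q \<in> cdom ?c" "y = cmap ?c q" for y q
  proof -
    have "at y within ?I = at y within cimg ?c" by (rule at_within_nhd[of _ U]) (use U that in auto)
    then show ?thesis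
      unfolding rderiv_whole[OF cc that(2)] using smooth_on_frechet_derivative[OF \<psi> that(1)] that(3) by simp
  qed
  have eq: "form_in_chart M (pullback_form M N f \<theta>) ?c y w = ?A (?\<psi> y) (?D y w)" if y: "y \<in> ?I" for y w
  proof -
    obtain q where q: "q \<in> cdom ?c" "f q \<in> cdom ?d" "y = cmap ?c q" "cinv ?c y = q" using Iq[OF y] by blast
    show ?thesis
      using form_in_chart_pullback[OF M N f c(1) q(1) d(1) q(2) der[OF y q(1,3)], of \<theta> w] q(3,4) by simp
  qed
  have Dp: "?D (cmap ?c p) = mderiv M N f p"
    using rderiv_unique[OF cc c(2) der[OF x c(2) refl] mderiv(1)[OF M N f p, unfolded has_mderiv_on_rderiv]] .
  have \<psi>p: "?\<psi> (cmap ?c p) = cmap ?d (f p)" by (simp add: chart_onD(5)[OF cc c(2)])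
  note Alin = form_in_chart_linear[OF N d(1) \<theta>] and Asm = form_in_chart_smooth[OF \<theta> d(1)]
  have "ext_deriv M (pullback_form M N f \<theta>) p u v
      = dform ?I (form_in_chart M (pullback_form M N f \<theta>) ?c) (cmap ?c p) u v"
    by (simp add: ext_deriv_dform dform_restrict[OF U(1,2)])
  also have "\<dots> = dform ?I (\<lambda>y w. ?A (?\<psi> y) (?D y w)) (cmap ?c p) u v"
    by (rule dform_cong[OF eq x])
  also have "\<dots> = dform (cimg ?d) ?A (?\<psi> (cmap ?c p)) (?D (cmap ?c p) u) (?D (cmap ?c p) v)"
    by (rule dform_pullback[OF I J x \<psi> \<psi>J Alin Asm])
  finally show "ext_deriv M (pullback_form M N f \<theta>) p u v
      = ext_deriv N \<theta> (f p) (mderiv M N f p u) (mderiv M N f p v)"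
    unfolding Dp \<psi>p ext_deriv_dform .
  have "smooth_on ?I (\<lambda>y. \<Sum>b\<in>Basis. (?D y v \<bullet> b) *\<^sub>R ?A (?\<psi> y) b)"
    by (intro smooth_on_sum smooth_on_scaleR smooth_on_inner smooth_on_const
        smooth_on_frechet[OF I \<psi>] smooth_on_compose[OF \<psi> Asm \<psi>J])
  then have "smooth_on ?I (\<lambda>y. form_in_chart M (pullback_form M N f \<theta>) ?c y v)"
  proof (rule smooth_on_cong)
    fix y assume y: "y \<in> ?I"
    show "(\<Sum>b\<in>Basis. (?D y v \<bullet> b) *\<^sub>R ?A (?\<psi> y) b) = form_in_chart M (pullback_form M N f \<theta>) ?c y v"
      unfolding eq[OF y] by (rule linear_Basis_expand[OF Alin[OF \<psi>J[OF y]], symmetric])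
  qed
  then obtain L where L: "((\<lambda>y. form_in_chart M (pullback_form M N f \<theta>) ?c y v) has_derivative L) (at (cmap ?c p) within ?I)"
    by (rule smooth_on_has_derivative[OF _ x])
  have "at (cmap ?c p) within ?I = at (cmap ?c p) within cimg ?c" by (rule at_within_nhd[OF U(2,1)]) auto
  with L show "(\<lambda>x. form_in_chart M (pullback_form M N f \<theta>) ?c x v) differentiable
      (at (cmap ?c p) within cimg ?c)"
    unfolding differentiable_def by auto
qed

lemma ext_deriv_add:
  assumes M: "smooth_atlas M" and p: "p \<in> carr M"
    and "\<And>v. (\<lambda>x. form_in_chart M \<theta> (chart_at M p) x v) differentiable
      (at (cmap (chart_at M p) p) within cimg (chart_at M p))"
    and "\<And>v. (\<lambda>x. form_in_chart M \<eta> (chart_at M p) x v) differentiable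
      (at (cmap (chart_at M p) p) within cimg (chart_at M p))"
  shows "ext_deriv M (\<lambda>q v. \<theta> q v + \<eta> q v) p u v = ext_deriv M \<theta> p u v + ext_deriv M \<eta> p u v"
proof -
  note c = chart_at[OF M p]
  note cc = smooth_atlasD(2)[OF M c(1)]
  have "form_in_chart M (\<lambda>q v. \<theta> q v + \<eta> q v) (chart_at M p)
      = (\<lambda>x v. form_in_chart M \<theta> (chart_at M p) x v + form_in_chart M \<eta> (chart_at M p) x v)"
    by (intro ext) (simp add: form_in_chart_def)
  then show ?thesis
    unfolding ext_deriv_dform using dform_add[OF chart_onD(2)[OF cc] imageI[OF c(2)] assms(3,4)] by simp
qed

section \<open>Liouville and Hamiltonian vector fields\<close>

lemma liouville_domainD:
  assumes "liouville_domain (M, lam)"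
  shows "smooth_atlas M" "compact_space (mspace M)" "smooth_one_form M lam"
    "p \<in> carr M \<Longrightarrow> v \<noteq> 0 \<Longrightarrow> \<exists>u. ext_deriv M lam p v u \<noteq> 0"
    "p \<in> manifold_boundary M \<Longrightarrow> outward_pointing M p (liouville_field (M, lam) p)"
proof -
  note A = assms[unfolded liouville_domain_def fst_conv snd_conv]
  show "smooth_atlas M" by (rule smooth_manifold_smooth_atlas[OF conjunct1[OF A]])
  show "compact_space (mspace M)" "smooth_one_form M lam" using A by simp_all
  show "p \<in> carr M \<Longrightarrow> v \<noteq> 0 \<Longrightarrow> \<exists>u. ext_deriv M lam p v u \<noteq> 0"
    "p \<in> manifold_boundary M \<Longrightarrow> outward_pointing M p (liouville_field (M, lam) p)"
    using A by simp_all
qed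

context
  fixes M :: "('a, 'e::euclidean_space) manifold" and lam
  assumes W: "liouville_domain (M, lam)"
begin

lemma symplectic_ex1:
  assumes "p \<in> carr M" "linear \<alpha>"
  shows "\<exists>!u. \<forall>v. ext_deriv M lam p u v = \<alpha> v"
  by (rule nondegenerate_ex1[OF ext_deriv_linear[OF liouville_domainD(1,3)[OF W] assms(1)]
        liouville_domainD(4)[OF W assms(1)] assms(2)])

lemma liouville_field:
  assumes p: "p \<in> carr M"
  shows "ext_deriv M lam p (liouville_field (M, lam) p) u = lam p u"
    and "(\<And>u. ext_deriv M lam p y u = lam p u) \<Longrightarrow> liouville_field (M, lam) p = y"
proof -
  have "linear (lam p)" using liouville_domainD(3)[OF W] p unfolding smooth_one_form_def by simp
  note ex = symplectic_ex1[OF p this]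
  show "ext_deriv M lam p (liouville_field (M, lam) p) u = lam p u"
    using theI'[OF ex] unfolding liouville_field_def by simp
  show "liouville_field (M, lam) p = y" if "\<And>u. ext_deriv M lam p y u = lam p u"
    unfolding liouville_field_def using ex that by (simp add: the1_equality)
qed

lemma hamiltonian_field:
  assumes p: "p \<in> carr M" and h: "smooth_map_on M (carr M) euclidean_manifold h"
  shows "ext_deriv M lam p (hamiltonian_field (M, lam) h p) u = mdiff M h p u"
    and "(\<And>u. ext_deriv M lam p y u = mdiff M h p u) \<Longrightarrow> hamiltonian_field (M, lam) h p = y"
proof -
  have "linear (mdiff M h p)" 
    by (rule mderiv(3)[OF liouville_domainD(1)[OF W] smooth_atlas_euclidean h p])
  note ex = symplectic_ex1[OF p this]
  show "ext_deriv M lam p (hamiltonian_field (M, lam) h p) u = mdiff M h p u"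
    using theI'[OF ex] unfolding hamiltonian_field_def by simp
  show "hamiltonian_field (M, lam) h p = y" if "\<And>u. ext_deriv M lam p y u = mdiff M h p u"
    unfolding hamiltonian_field_def using ex that by (simp add: the1_equality)
qed

text \<open>Antisymmetry of d\<lambda> exchanges the two defining equations. The sign condition in
  \<open>Ham_plus\<close> thereby becomes monotonicity along the flow, and positivity of
  \<open>tau\<close> becomes a strict sign at the boundary.\<close>

lemma mdiff_liouville_field:
  assumes p: "p \<in> carr M" and h: "smooth_map_on M (carr M) euclidean_manifold h"
  shows "mdiff M h p (liouville_field (M, lam) p) = - lam p (hamiltonian_field (M, lam) h p)"
proof -
  have "mdiff M h p (liouville_field (M, lam) p)
      = ext_deriv M lam p (hamiltonian_field (M, lam) h p) (liouville_field (M, lam) p)"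
    by (simp add: hamiltonian_field(1)[OF assms])
  also have "\<dots> = - ext_deriv M lam p (liouville_field (M, lam) p) (hamiltonian_field (M, lam) h p)"
    by (rule ext_deriv_antisym)
  finally show ?thesis by (simp add: liouville_field(1)[OF p])
qed

end

section \<open>Cylinders over a manifold\<close>

text \<open>Euclidean space has a single chart, so every product chart of the cylinder has this
  form.\<close>

definition cyl :: "('a, 'e) chart \<Rightarrow> ('a \<times> 'v::euclidean_space, 'e \<times> 'v) chart"
  where "cyl c = (cdom c \<times> UNIV, map_prod (cmap c) id)"

abbreviation cylinder :: "('a, 'e) manifold \<Rightarrow> ('a \<times> 'v::euclidean_space, 'e \<times> 'v) manifold"
  where "cylinder M \<equiv> prod_manifold M euclidean_manifold"

lemma cyl_simps [simp]:
  "cdom (cyl c) = cdom c \<times> UNIV" "cmap (cyl c) (p, z) = (cmap c p, z)" "cmap (cyl c) ` (cdom c \<times> UNIV) = cimg c \<times> UNIV"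
  by (auto simp: cyl_def image_iff)

lemma cmap_cyl: "cmap (cyl c) q = (cmap c (fst q), snd q)"
  by (cases q) simp

lemma cylinder_simps:
  "mspace (cylinder M) = prod_topology (mspace M) euclidean"
  "atlas (cylinder M) = cyl ` atlas M"
proof -
  show "mspace (cylinder M) = prod_topology (mspace M) euclidean" by (simp add: prod_manifold_def)
  have "atlas (cylinder M) = {cyl c | c. c \<in> atlas M}"
    by (simp add: prod_manifold_def cyl_def)
  also have "\<dots> = cyl ` atlas M" by blast
  finally show "atlas (cylinder M) = cyl ` atlas M" .
qed

lemma cinv_cyl:
  assumes "inj_on (cmap c) (cdom c)" "x \<in> cimg c"
  shows "cinv (cyl c) (x, z) = (cinv c x, z)"
proof -
  have inj: "inj_on (cmap (cyl c)) (cdom (cyl c))"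
    using assms(1) by (auto simp: inj_on_def)
  have "cmap (cyl c) (cinv c x, z) = (x, z)" using cmap_cinv[OF assms(2)] by simp
  then show ?thesis using cinv_cmap[OF inj, of "(cinv c x, z)"] cinv_in[OF assms(2)] by simp
qed

lemma cinv_cyl_cmap:
  assumes "inj_on (cmap c) (cdom c)" "p \<in> cdom c"
  shows "cinv (cyl c) (cmap c p, z) = (p, z)"
  using cinv_cyl[OF assms(1), of "cmap c p" z] cinv_cmap[OF assms] assms(2) by simp

lemma chart_on_cyl:
  assumes c: "chart_on M c"
  shows "chart_on (cylinder M) (cyl c :: ('a \<times> 'v::euclidean_space, 'e::euclidean_space \<times> 'v) chart)"
  unfolding chart_on_def
proof (intro conjI)
  let ?k = "cyl c :: ('a \<times> 'v, 'e \<times> 'v) chart"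
  show "openin (mspace (cylinder M)) (cdom ?k)"
    using chart_onD(1)[OF c] by (simp add: cylinder_simps openin_prod_Times_iff)
  show "model_open (cimg ?k)"
    using model_open_Times_UNIV[OF chart_onD(2)[OF c]] by simp
  show "inj_on (cmap ?k) (cdom ?k)"
    using chart_onD(3)[OF c] by (auto simp: inj_on_def)
  have "continuous_map (subtopology (mspace (cylinder M)) (cdom ?k)) (prod_topology euclidean euclidean) (cmap ?k)"
    unfolding continuous_map_pairwise
  proof
    have "continuous_map (subtopology (prod_topology (mspace M) (euclidean::'v topology)) (cdom c \<times> UNIV))
        euclidean (\<lambda>q. cmap c (fst q))"
      unfolding subtopology_Times
      using continuous_map_compose[OF continuous_map_fst chart_onD(6)[OF c], unfolded comp_def] .
    then show "continuous_map (subtopology (mspace (cylinder M)) (cdom ?k)) euclidean (fst \<circ> cmap ?k)"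
      by (simp add: cylinder_simps comp_def cmap_cyl)
    show "continuous_map (subtopology (mspace (cylinder M)) (cdom ?k)) euclidean (snd \<circ> cmap ?k)"
      using continuous_map_snd[of "subtopology (mspace M) (cdom c)" "euclidean::'v topology"]
      by (simp add: cylinder_simps comp_def cmap_cyl subtopology_Times)
  qed
  then show "continuous_map (subtopology (mspace (cylinder M)) (cdom ?k)) euclidean (cmap ?k)" by simp
  have fst: "fst (cinv ?k y) = cinv c (fst y)" and snd: "snd (cinv ?k y) = snd y" if "y \<in> cimg ?k" for y
    using that cinv_cyl[OF chart_onD(3)[OF c], where z = "snd y :: 'v" and x = "fst y"] by (auto simp: mem_Times_iff)
  show "continuous_map (top_of_set (cimg ?k)) (mspace (cylinder M)) (cinv ?k)"
    unfolding cylinder_simps continuous_map_pairwise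
  proof
    have "continuous_map (top_of_set (cimg c \<times> (UNIV::'v set))) (mspace M) (\<lambda>y. cinv c (fst y))"
      using continuous_map_compose[OF continuous_map_fst[of "top_of_set (cimg c)" "euclidean::'v topology"] chart_onD(7)[OF c], unfolded comp_def]
      unfolding prod_topology_subtopology_eu[of "cimg c" "UNIV::'v set", unfolded subtopology_UNIV] .
    then show "continuous_map (top_of_set (cimg ?k)) (mspace M) (fst \<circ> cinv ?k)"
      unfolding cyl_simps by (rule continuous_map_eq) (simp add: fst[unfolded cyl_simps])
    have "continuous_map (top_of_set (cimg ?k)) euclidean (snd :: 'e \<times> 'v \<Rightarrow> 'v)"
      unfolding continuous_map_iff_continuous by (intro continuous_intros)
    then show "continuous_map (top_of_set (cimg ?k)) euclidean (snd \<circ> cinv ?k)"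
      unfolding cyl_simps by (rule continuous_map_eq) (simp add: snd[unfolded cyl_simps])
  qed
qed

lemma smooth_atlas_cylinder:
  assumes M: "smooth_atlas M"
  shows "smooth_atlas (cylinder M :: ('a \<times> 'v::euclidean_space, 'e::euclidean_space \<times> 'v) manifold)"
  unfolding smooth_atlas_def
proof (intro conjI ballI)
  let ?P = "cylinder M :: ('a \<times> 'v, 'e \<times> 'v) manifold"
  show "carr ?P = (\<Union>c\<in>atlas ?P. cdom c)"
    using smooth_atlasD(1)[OF M] by (auto simp: cylinder_simps)
  show "chart_on ?P c" if "c \<in> atlas ?P" for c
  proof -
    obtain d where "d \<in> atlas M" "c = cyl d" using \<open>c \<in> atlas ?P\<close> unfolding cylinder_simps by blast
    then show ?thesis using chart_on_cyl[OF smooth_atlasD(2)[OF M]] by blast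
  qed
  fix k k' assume "k \<in> atlas ?P" "k' \<in> atlas ?P"
  then obtain c c' where c: "c \<in> atlas M" "c' \<in> atlas M" "k = cyl c" "k' = cyl c'"
    unfolding cylinder_simps by blast
  note cc = smooth_atlasD(2)[OF M c(1)]
  let ?S = "cmap c ` (cdom c \<inter> cdom c') \<times> (UNIV :: 'v set)"
  have "smooth_on ?S (\<lambda>y. (cmap c' (cinv c (fst y)), snd y))"
    by (intro smooth_on_Pair smooth_on_compose[OF smooth_on_fst[OF smooth_on_ident] smooth_atlasD(3)[OF M c(1,2)]]
        smooth_on_snd smooth_on_ident) auto
  then show "smooth_on (cmap k ` (cdom k \<inter> cdom k')) (\<lambda>x. cmap k' (cinv k x))"
  proof (rule smooth_on_cong_subset)
    show "cmap k ` (cdom k \<inter> cdom k') \<subseteq> ?S" using c by auto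
    show "(cmap c' (cinv c (fst y)), snd y) = cmap k' (cinv k y)" if "y \<in> cmap k ` (cdom k \<inter> cdom k')" for y
      using that c by (auto simp: cinv_cyl_cmap[OF chart_onD(3)[OF cc]] chart_onD(5)[OF cc])
  qed
qed

lemma smooth_map_on_cylinder_fst:
  assumes M: "smooth_atlas M"
  shows "smooth_map_on (cylinder M :: ('a \<times> 'v::euclidean_space, 'e::euclidean_space \<times> 'v) manifold) D M fst"
proof (rule smooth_map_onI)
  let ?P = "cylinder M :: ('a \<times> 'v, 'e \<times> 'v) manifold"
  show "continuous_map (subtopology (mspace ?P) D) (mspace M) fst"
    by (rule continuous_map_from_subtopology) (simp add: cylinder_simps continuous_map_fst)
  fix k e assume "k \<in> atlas ?P" and e: "e \<in> atlas M"
  then obtain c where c: "c \<in> atlas M" "k = cyl c" unfolding cylinder_simps by blast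
  note cc = smooth_atlasD(2)[OF M c(1)]
  have "smooth_on (cmap c ` (cdom c \<inter> cdom e) \<times> (UNIV :: 'v set)) (\<lambda>y. cmap e (cinv c (fst y)))"
    by (intro smooth_on_compose[OF smooth_on_fst[OF smooth_on_ident] smooth_atlasD(3)[OF M c(1) e]]) auto
  then show "smooth_on (cmap k ` (cdom k \<inter> D \<inter> fst -` cdom e)) (\<lambda>x. cmap e (fst (cinv k x)))"
    by (rule smooth_on_cong_subset) (use c in \<open>auto simp: cinv_cyl_cmap[OF chart_onD(3)[OF cc]] chart_onD(5)[OF cc]\<close>)
qed

lemma smooth_map_on_cylinder_snd:
  assumes M: "smooth_atlas M"
  shows "smooth_map_on (cylinder M :: ('a \<times> 'v::euclidean_space, 'e::euclidean_space \<times> 'v) manifold) D euclidean_manifold snd"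
proof (rule smooth_map_onI)
  let ?P = "cylinder M :: ('a \<times> 'v, 'e \<times> 'v) manifold"
  show "continuous_map (subtopology (mspace ?P) D) (mspace euclidean_manifold) snd"
    by (rule continuous_map_from_subtopology) (simp add: cylinder_simps continuous_map_snd)
  fix k e assume "k \<in> atlas ?P" and e: "e \<in> atlas (euclidean_manifold :: ('v, 'v) manifold)"
  then obtain c where c: "c \<in> atlas M" "k = cyl c" unfolding cylinder_simps by blast
  note cc = smooth_atlasD(2)[OF M c(1)]
  have "smooth_on (UNIV :: ('e \<times> 'v) set) (\<lambda>y. snd y)" by (intro smooth_on_snd smooth_on_ident)
  then show "smooth_on (cmap k ` (cdom k \<inter> D \<inter> snd -` cdom e)) (\<lambda>x. cmap e (snd (cinv k x)))"
    by (rule smooth_on_cong_subset) (use c e in \<open>auto simp: cinv_cyl_cmap[OF chart_onD(3)[OF cc]]\<close>)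
qed

lemma smooth_map_on_cylinder_Pair:
  fixes g :: "'c \<Rightarrow> 'v::euclidean_space" and M :: "('a, 'e::euclidean_space) manifold"
  assumes X: "smooth_atlas X" and M: "smooth_atlas M"
    and f: "smooth_map_on X D M f" and g: "smooth_map_on X D euclidean_manifold g"
  shows "smooth_map_on X D (cylinder M) (\<lambda>p. (f p, g p))"
proof (rule smooth_map_onI)
  show "continuous_map (subtopology (mspace X) D) (mspace (cylinder M)) (\<lambda>p. (f p, g p))"
    using smooth_map_onD(1)[OF f] smooth_map_onD(1)[OF g]
    by (simp add: cylinder_simps continuous_map_pairwise comp_def)
  fix c k assume c: "c \<in> atlas X" and "k \<in> atlas (cylinder M :: ('a \<times> 'v, 'e \<times> 'v) manifold)"
  then obtain e where e: "e \<in> atlas M" "k = cyl e" unfolding cylinder_simps by blast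
  let ?S = "cmap c ` (cdom c \<inter> D \<inter> (\<lambda>p. (f p, g p)) -` cdom k)"
  have "smooth_on (cmap c ` (cdom c \<inter> D \<inter> f -` cdom e)) (\<lambda>x. cmap e (f (cinv c x)))"
    by (rule smooth_map_onD(2)[OF f c e(1)])
  then have 1: "smooth_on ?S (\<lambda>x. cmap e (f (cinv c x)))"
    by (rule smooth_on_subset) (use e in auto)
  have "smooth_on (cmap c ` (cdom c \<inter> D)) (\<lambda>x. g (cinv c x))"
    using smooth_map_onD(2)[OF g c, of "(UNIV, id)"] by simp
  then have 2: "smooth_on ?S (\<lambda>x. g (cinv c x))"
    by (rule smooth_on_subset) auto
  show "smooth_on ?S (\<lambda>x. cmap k (f (cinv c x), g (cinv c x)))"
    using smooth_on_Pair[OF 1 2] by (simp add: e(2))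
qed

section \<open>Codimension-0 domains\<close>

lemma domain_manifold_simps:
  "mspace (domain_manifold P D) = subtopology (mspace P) D"
  "c \<in> atlas (domain_manifold P D) \<longleftrightarrow> openin (subtopology (mspace P) D) (cdom c) \<and> inj_on (cmap c) (cdom c) \<and>
    model_open (cimg c) \<and> smooth_map_on P (cdom c) euclidean_manifold (cmap c) \<and>
    smooth_map_on euclidean_manifold (cimg c) P (cinv c)"
  unfolding domain_manifold_def by simp_all

lemma domain_manifold_chart:
  assumes c: "c \<in> atlas (domain_manifold P D)"
  shows "chart_on (domain_manifold P D) c"
proof -
  note c' = c[unfolded domain_manifold_simps]
  have s: "openin (subtopology (mspace P) D) (cdom c)" "smooth_map_on P (cdom c) euclidean_manifold (cmap c)"
    "smooth_map_on euclidean_manifold (cimg c) P (cinv c)" using c' by simp_all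
  have cD: "cdom c \<subseteq> D" using openin_subset[OF s(1)] by auto
  have "continuous_map (top_of_set (cimg c)) (subtopology (mspace P) D) (cinv c)"
  proof (rule continuous_map_into_subtopology)
    show "continuous_map (top_of_set (cimg c)) (mspace P) (cinv c)"
      using smooth_map_onD(1)[OF s(3)] by simp
    show "cinv c \<in> topspace (top_of_set (cimg c)) \<rightarrow> D"
    proof
      fix y assume "y \<in> topspace (top_of_set (cimg c))"
      then have "y \<in> cimg c" by simp
      then show "cinv c y \<in> D" by (rule subsetD[OF cD cinv_in])
    qed
  qed
  moreover have "continuous_map (subtopology (subtopology (mspace P) D) (cdom c)) euclidean (cmap c)"
    unfolding subtopology_subtopology Int_absorb1[OF cD] using smooth_map_onD(1)[OF s(2)] by simp
  ultimately show ?thesis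
    unfolding chart_on_def domain_manifold_simps(1) using c' by (intro conjI) simp_all
qed

text \<open>The atlas consists by definition of all charts that are diffeomorphisms for the ambient
  structure, so transition maps are smooth by composing through \<open>P\<close>. What has to be
  supplied from outside is that the charts cover \<open>D\<close>.\<close>

lemma smooth_atlas_domain_manifold:
  assumes P: "smooth_atlas P" and D: "D \<subseteq> carr P"
    and cover: "\<And>p. p \<in> D \<Longrightarrow> \<exists>c\<in>atlas (domain_manifold P D). p \<in> cdom c"
  shows "smooth_atlas (domain_manifold P D)"
    and "carr (domain_manifold P D) = D"
    and "smooth_map_on (domain_manifold P D) D P (\<lambda>p. p)"
    and "smooth_map_on P D (domain_manifold P D) (\<lambda>p. p)"
proof -
  let ?N = "domain_manifold P D"
  show carr: "carr ?N = D" using D by (auto simp: domain_manifold_simps)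
  have ch: "smooth_map_on P (cdom c) euclidean_manifold (cmap c)"
    "smooth_map_on euclidean_manifold (cimg c) P (cinv c)" if "c \<in> atlas ?N" for c
    using that by (simp_all add: domain_manifold_simps)
  show "smooth_atlas ?N"
    unfolding smooth_atlas_def
  proof (intro conjI ballI)
    show "carr ?N = (\<Union>c\<in>atlas ?N. cdom c)"
    proof
      show "carr ?N \<subseteq> (\<Union>c\<in>atlas ?N. cdom c)" unfolding carr using cover by blast
      show "(\<Union>c\<in>atlas ?N. cdom c) \<subseteq> carr ?N"
        using chart_onD(4)[OF domain_manifold_chart] by blast
    qed
    show "chart_on ?N c" if "c \<in> atlas ?N" for c by (rule domain_manifold_chart[OF that])
    fix c c' assume c: "c \<in> atlas ?N" and c': "c' \<in> atlas ?N"
    note cc = domain_manifold_chart[OF c]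
    let ?S = "cmap c ` (cdom c \<inter> cdom c')"
    have "smooth_map_on euclidean_manifold ?S P (cinv c)"
      by (rule smooth_map_on_subset[OF ch(2)[OF c]]) auto
    then have "smooth_map_on euclidean_manifold ?S euclidean_manifold (\<lambda>x. cmap c' (cinv c x))"
      by (rule smooth_map_on_compose[OF smooth_atlas_euclidean P _ ch(1)[OF c']])
        (use chart_onD(5)[OF cc] in auto)
    then show "smooth_on ?S (\<lambda>x. cmap c' (cinv c x))"
      using smooth_map_onD(2)[of euclidean_manifold ?S euclidean_manifold _ "(UNIV, id)" "(UNIV, id)"] by simp
  qed
  show "smooth_map_on ?N D P (\<lambda>p. p)"
  proof (rule smooth_map_onI)
    show "continuous_map (subtopology (mspace ?N) D) (mspace P) (\<lambda>p. p)"
      unfolding domain_manifold_simps by (intro continuous_map_from_subtopology) simp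
    fix c e assume c: "c \<in> atlas ?N" and e: "e \<in> atlas P"
    have "smooth_on (cimg c \<inter> cinv c -` cdom e) (\<lambda>x. cmap e (cinv c x))"
      using smooth_map_onD(2)[OF ch(2)[OF c] _ e, of "(UNIV, id)"] by simp
    then show "smooth_on (cmap c ` (cdom c \<inter> D \<inter> (\<lambda>p. p) -` cdom e)) (\<lambda>x. cmap e (cinv c x))"
      by (rule smooth_on_subset) (use chart_onD(5)[OF domain_manifold_chart[OF c]] in auto)
  qed
  show "smooth_map_on P D ?N (\<lambda>p. p)"
  proof (rule smooth_map_onI)
    show "continuous_map (subtopology (mspace P) D) (mspace ?N) (\<lambda>p. p)"
      unfolding domain_manifold_simps by simp
    fix c e assume c: "c \<in> atlas P" and e: "e \<in> atlas ?N"
    have "smooth_on (cmap c ` (cdom c \<inter> cdom e)) (\<lambda>x. cmap e (cinv c x))"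
      using smooth_map_onD(2)[OF ch(1)[OF e] c, of "(UNIV, id)"] by simp
    then show "smooth_on (cmap c ` (cdom c \<inter> D \<inter> (\<lambda>p. p) -` cdom e)) (\<lambda>x. cmap e (cinv c x))"
      by (rule smooth_on_subset) auto
  qed
qed

text \<open>The inverse function theorem for the map that replaces the b-coordinate of x by f
  x.\<close>

lemma straighten:
  fixes f :: "'a::euclidean_space \<Rightarrow> real"
  assumes T: "open T" "x0 \<in> T" and f: "smooth_on T f" and b: "b \<in> Basis"
    and nz: "frechet_derivative f (at x0) b \<noteq> 0"
  obtains U V g where "open U" "x0 \<in> U" "U \<subseteq> T" "open V"
    "homeomorphism U V (\<lambda>x. x + (f x - x \<bullet> b) *\<^sub>R b) g" "smooth_on V g"
proof -
  let ?\<Phi> = "\<lambda>x. x + (f x - x \<bullet> b) *\<^sub>R b"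
  let ?D = "\<lambda>x. frechet_derivative f (at x)"
  define F where "F x = Blinfun (\<lambda>v. v + (?D x v - v \<bullet> b) *\<^sub>R b)" for x
  have Df: "(f has_derivative ?D x) (at x)" if "x \<in> T" for x
    by (rule smooth_on_open_derivative(1)[OF T(1) f that])
  have bl: "bounded_linear (\<lambda>v. v + (?D x v - v \<bullet> b) *\<^sub>R b)" if "x \<in> T" for x
    by (intro bounded_linear_add bounded_linear_ident bounded_linear_scaleR_const bounded_linear_sub
        bounded_linear_inner_left has_derivative_bounded_linear[OF Df[OF that]])
  have F: "blinfun_apply (F x) v = v + (?D x v - v \<bullet> b) *\<^sub>R b" if "x \<in> T" for x v
    unfolding F_def using bounded_linear_Blinfun_apply[OF bl[OF that]] by simp
  have der: "(?\<Phi> has_derivative blinfun_apply (F x)) (at x)" if "x \<in> T" for x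
  proof -
    have "(?\<Phi> has_derivative (\<lambda>v. v + (?D x v - v \<bullet> b) *\<^sub>R b)) (at x)"
      by (intro has_derivative_add has_derivative_ident has_derivative_scaleR_left has_derivative_diff
          Df[OF that] has_derivative_inner_left)
    then show ?thesis using F[OF that] by presburger
  qed
  have cont: "continuous_on T F"
  proof (rule continuous_on_blinfun_componentwise)
    fix i :: 'a assume "i \<in> Basis"
    have "continuous_on T (\<lambda>x. i + (?D x i - i \<bullet> b) *\<^sub>R b)"
      using smooth_on_imp_continuous_on[OF smooth_on_open_derivative(2)[OF T(1) f, of i]]
      by (intro continuous_intros)
    then show "continuous_on T (\<lambda>x. blinfun_apply (F x) i)"
      by (rule continuous_on_eq) (simp add: F)
  qed
  \<comment> \<open>The inverse of \<open>F x\<close>. That map changes only the b-component,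
    setting it to Df v, so the inverse corrects the b-component until Df takes the value w \<bullet>
    b.\<close>
  define G where "G x w = w + ((w \<bullet> b - ?D x w) * inverse (?D x b)) *\<^sub>R b" for x w
  have bb: "b \<bullet> b = 1" using b by simp
  have GF: "G x (blinfun_apply (F x) v) = v" if "x \<in> T" "?D x b \<noteq> 0" for x v
  proof -
    note l = has_derivative_linear[OF Df[OF that(1)]]
    have "?D x (v + (?D x v - v \<bullet> b) *\<^sub>R b) = ?D x v + (?D x v - v \<bullet> b) * ?D x b"
      using linear_add[OF l] linear_cmul[OF l] by simp
    then have "(v + (?D x v - v \<bullet> b) *\<^sub>R b) \<bullet> b - ?D x (v + (?D x v - v \<bullet> b) *\<^sub>R b)
        = - (?D x v - v \<bullet> b) * ?D x b"
      by (simp add: inner_add_left bb algebra_simps)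
    then have "G x (blinfun_apply (F x) v) = v + (?D x v - v \<bullet> b) *\<^sub>R b
        + (- (?D x v - v \<bullet> b) * ?D x b * inverse (?D x b)) *\<^sub>R b"
      unfolding G_def F[OF that(1)] by (simp only:)
    also have "- (?D x v - v \<bullet> b) * ?D x b * inverse (?D x b) = - (?D x v - v \<bullet> b)"
      using that(2) by (simp add: mult.assoc)
    finally show ?thesis by (simp only: scaleR_minus_left add.assoc) simp
  qed
  have FG: "blinfun_apply (F x) (G x w) = w" if "x \<in> T" "?D x b \<noteq> 0" for x w
  proof -
    note l = has_derivative_linear[OF Df[OF that(1)]]
    have "?D x (G x w) = w \<bullet> b"
      unfolding G_def linear_add[OF l] linear_cmul[OF l] using that(2) by (simp add: mult.assoc)
    moreover have "G x w \<bullet> b = w \<bullet> b + (w \<bullet> b - ?D x w) * inverse (?D x b)"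
      by (simp add: G_def inner_add_left bb)
    ultimately have "blinfun_apply (F x) (G x w) = G x w + (- ((w \<bullet> b - ?D x w) * inverse (?D x b))) *\<^sub>R b"
      unfolding F[OF that(1)] by simp
    then show ?thesis unfolding G_def by (simp only: scaleR_minus_left) simp
  qed
  have blG: "bounded_linear (G x0)"
    unfolding G_def
    by (rule bounded_linear_add[OF bounded_linear_ident bounded_linear_scaleR_const[OF bounded_linear_mult_const[OF
        bounded_linear_sub[OF bounded_linear_inner_left has_derivative_bounded_linear[OF Df[OF T(2)]]]]]])
  have inv: "Blinfun (G x0) o\<^sub>L F x0 = id_blinfun"
    by (rule blinfun_eqI) (simp add: bounded_linear_Blinfun_apply[OF blG] GF[OF T(2) nz])
  show thesis
  proof (rule inverse_function_theorem[OF T(1) der cont T(2) inv])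
    fix U V g g'
    assume U: "open U" "U \<subseteq> T" "x0 \<in> U" "open V" "homeomorphism U V ?\<Phi> g"
      and g: "\<And>y. y \<in> V \<Longrightarrow> (g has_derivative (g' y)) (at y)"
      and g': "\<And>y. y \<in> V \<Longrightarrow> g' y = inv (blinfun_apply (F (g y)))"
      and bij: "\<And>y. y \<in> V \<Longrightarrow> bij (blinfun_apply (F (g y)))"
    have gT: "g y \<in> T" if "y \<in> V" for y using U(2,5) that unfolding homeomorphism_def by blast
    \<comment> \<open>The theorem gives bijectivity of the differential on all of V; were Df b zero,
      the differential would kill b.\<close>
    have nz': "?D (g y) b \<noteq> 0" if y: "y \<in> V" for y
    proof
      assume "?D (g y) b = 0"
      then have "blinfun_apply (F (g y)) b = 0" using F[OF gT[OF y], of b] bb by simp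
      then have "b = 0" using bij[OF y] by (metis bij_is_inj blinfun.zero_right injD)
      then show False using b by simp
    qed
    have g'_eq: "g' y w = G (g y) w" if y: "y \<in> V" for y w
    proof -
      have "g' y w = inv (blinfun_apply (F (g y))) (blinfun_apply (F (g y)) (G (g y) w))"
        using FG[OF gT[OF y] nz'[OF y]] g'[OF y] by simp
      also have "\<dots> = G (g y) w" by (rule inv_f_f[OF bij_is_inj[OF bij[OF y]]])
      finally show ?thesis .
    qed
    \<comment> \<open>The derivative of g is a rational expression in the first derivatives of f at
      g y, so regularity of g can be bootstrapped.\<close>
    have "smooth_on V g"
    proof (rule smooth_onI_bootstrap[OF U(4) g])
      fix k v assume k: "Ck_on k g V"
      have D: "Ck_on k (\<lambda>y. ?D (g y) w) V" for w
        by (rule Ck_on_compose[OF U(4) T(1) k smooth_on_imp_Ck_on[OF smooth_on_open_derivative(2)[OF T(1) f] T(1)]])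
          (use gT in auto)
      have o: "open {x::real. x \<noteq> 0}" by (simp add: open_Collect_neq)
      have I: "Ck_on k (\<lambda>y. inverse (?D (g y) b)) V"
        by (rule Ck_on_compose[OF U(4) o D smooth_on_imp_Ck_on[OF smooth_on_inverse o]])
          (use nz' in auto)
      have N: "Ck_on k (\<lambda>y. v \<bullet> b + - ?D (g y) v) V"
        by (intro Ck_on_add[OF U(4)] Ck_on_const[OF U(4)]
            Ck_on_bounded_linear[OF bounded_linear_minus[OF bounded_linear_ident] U(4)] D)
      have "Ck_on k (\<lambda>y. v + ((v \<bullet> b + - ?D (g y) v) * inverse (?D (g y) b)) *\<^sub>R b) V"
        by (rule Ck_on_add[OF U(4) Ck_on_const[OF U(4)] Ck_on_bilinear[OF bounded_bilinear_scaleR U(4)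
                Ck_on_bilinear[OF bounded_bilinear_mult U(4) N I] Ck_on_const[OF U(4)]]])
      then show "Ck_on k (\<lambda>y. g' y v) V"
        by (rule Ck_on_cong[OF _ U(4)]) (simp add: g'_eq G_def)
    qed
    then show thesis by (rule that[OF U(1,3,2,4,5)])
  qed
qed

text \<open>A chart of the domain arises from an ambient chart by restriction, followed by a change
  of coordinates that carries the image of \<open>D\<close> to a model set.\<close>

lemma domain_chartI:
  assumes P: "smooth_atlas P" and D: "D \<subseteq> carr P" and \<kappa>: "\<kappa> \<in> atlas P"
    and U: "open U" and UD: "S = cmap \<kappa> ` {q \<in> cdom \<kappa> \<inter> D. cmap \<kappa> q \<in> U}" "S \<subseteq> U"
    and h: "homeomorphism U V \<Phi> \<Psi>" "smooth_on U \<Phi>" "smooth_on V \<Psi>" and m: "model_open (\<Phi> ` S)"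
  shows "({q \<in> cdom \<kappa> \<inter> D. cmap \<kappa> q \<in> U}, \<lambda>q. \<Phi> (cmap \<kappa> q)) \<in> atlas (domain_manifold P D)"
proof -
  note kc = smooth_atlasD(2)[OF P \<kappa>]
  let ?O = "{q \<in> cdom \<kappa> \<inter> D. cmap \<kappa> q \<in> U}"
  let ?c = "(?O, \<lambda>q. \<Phi> (cmap \<kappa> q))"
  have \<Psi>\<Phi>: "\<Psi> (\<Phi> x) = x" if "x \<in> U" for x using h(1) that unfolding homeomorphism_def by blast
  have \<Phi>V: "\<Phi> x \<in> V" if "x \<in> U" for x using h(1) that unfolding homeomorphism_def by blast
  have img: "cimg ?c = \<Phi> ` S" using UD(1) by auto
  have inj: "inj_on (cmap ?c) (cdom ?c)"
  proof (rule inj_onI)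
    fix p q assume pq: "p \<in> cdom ?c" "q \<in> cdom ?c" "cmap ?c p = cmap ?c q"
    then have d: "p \<in> cdom \<kappa>" "q \<in> cdom \<kappa>" "cmap \<kappa> p \<in> U" "cmap \<kappa> q \<in> U" by simp_all
    have "\<Phi> (cmap \<kappa> p) = \<Phi> (cmap \<kappa> q)" using pq(3) by simp
    then have "cmap \<kappa> p = cmap \<kappa> q" using \<Psi>\<Phi>[OF d(3)] \<Psi>\<Phi>[OF d(4)] by metis
    then show "p = q" by (rule inj_onD[OF chart_onD(3)[OF kc] _ d(1,2)])
  qed
  have cinv: "cinv ?c y = cinv \<kappa> (\<Psi> y)" "\<Psi> y \<in> cmap \<kappa> ` ?O" "cinv ?c y \<in> ?O" if y: "y \<in> cimg ?c" for y
  proof -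
    from y obtain q where q: "y = cmap ?c q" "q \<in> cdom ?c" by (rule imageE)
    then have d: "q \<in> cdom \<kappa>" "cmap \<kappa> q \<in> U" by simp_all
    have y\<Phi>: "y = \<Phi> (cmap \<kappa> q)" using q(1) by simp
    have "\<Psi> y = cmap \<kappa> q" unfolding y\<Phi> by (rule \<Psi>\<Phi>[OF d(2)])
    moreover have "cinv ?c y = q" unfolding q(1) by (rule cinv_cmap[OF inj q(2)])
    ultimately show "cinv ?c y = cinv \<kappa> (\<Psi> y)" using chart_onD(5)[OF kc d(1)] by simp
    show "\<Psi> y \<in> cmap \<kappa> ` ?O" unfolding \<open>\<Psi> y = cmap \<kappa> q\<close> using q(2) by (intro imageI) simp
    show "cinv ?c y \<in> ?O" using q(2) unfolding \<open>cinv ?c y = q\<close> by simp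
  qed
  have "openin (subtopology (mspace P) D) ?O"
  proof -
    have top: "topspace (subtopology (mspace P) (cdom \<kappa>)) = cdom \<kappa>" using chart_onD(4)[OF kc] by auto
    have "openin (subtopology (mspace P) (cdom \<kappa>)) {q \<in> cdom \<kappa>. cmap \<kappa> q \<in> U}"
      using openin_continuous_map_preimage[OF chart_onD(6)[OF kc], of U] U unfolding top by simp
    then have "openin (mspace P) {q \<in> cdom \<kappa>. cmap \<kappa> q \<in> U}"
      by (rule openin_trans_full[OF _ chart_onD(1)[OF kc]])
    moreover have "?O = {q \<in> cdom \<kappa>. cmap \<kappa> q \<in> U} \<inter> D" by auto
    ultimately show ?thesis unfolding openin_subtopology by (intro exI[of _ "{q \<in> cdom \<kappa>. cmap \<kappa> q \<in> U}"] conjI)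
  qed
  moreover have "smooth_map_on P ?O euclidean_manifold (\<lambda>q. \<Phi> (cmap \<kappa> q))"
    unfolding smooth_map_on_euclidean_iff[OF P]
  proof (intro conjI ballI)
    have "continuous_map (subtopology (mspace P) ?O) euclidean (cmap \<kappa>)"
      by (rule continuous_map_from_subtopology_mono[OF chart_onD(6)[OF kc]]) auto
    then have "continuous_map (subtopology (mspace P) ?O) (top_of_set U) (cmap \<kappa>)"
      by (rule continuous_map_into_subtopology) auto
    moreover have "continuous_map (top_of_set U) euclidean \<Phi>"
      using smooth_on_imp_continuous_on[OF h(2)] by simp
    ultimately have "continuous_map (subtopology (mspace P) ?O) euclidean (\<Phi> \<circ> cmap \<kappa>)"
      by (rule continuous_map_compose)
    then show "continuous_map (subtopology (mspace P) ?O) euclidean (\<lambda>q. \<Phi> (cmap \<kappa> q))"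
      by (simp add: comp_def)
    fix e assume e: "e \<in> atlas P"
    note ec = smooth_atlasD(2)[OF P e]
    have "smooth_on (cmap e ` (cdom e \<inter> ?O)) (\<lambda>x. cmap \<kappa> (cinv e x))"
      by (rule smooth_on_subset[OF smooth_atlasD(3)[OF P e \<kappa>]]) auto
    then show "smooth_on (cmap e ` (cdom e \<inter> ?O)) (\<lambda>x. \<Phi> (cmap \<kappa> (cinv e x)))"
      by (rule smooth_on_compose[OF _ h(2)]) (use chart_onD(5)[OF ec] in auto)
  qed
  moreover have "smooth_map_on euclidean_manifold (cimg ?c) P (cinv ?c)"
  proof (rule smooth_map_onI)
    have VS: "cimg ?c \<subseteq> V" using \<Phi>V UD(2) unfolding img by blast
    have "continuous_on (cimg ?c) \<Psi>"
      by (rule continuous_on_subset[OF smooth_on_imp_continuous_on[OF h(3)] VS])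
    then have "continuous_map (top_of_set (cimg ?c)) euclidean \<Psi>" by simp
    then have "continuous_map (top_of_set (cimg ?c)) (top_of_set (cimg \<kappa>)) \<Psi>"
      by (rule continuous_map_into_subtopology) (use cinv(2) in auto)
    then have "continuous_map (top_of_set (cimg ?c)) (mspace P) (cinv \<kappa> \<circ> \<Psi>)"
      using chart_onD(7)[OF kc] by (rule continuous_map_compose)
    then have "continuous_map (top_of_set (cimg ?c)) (mspace P) (cinv ?c)"
      by (rule continuous_map_eq) (use cinv(1) in simp)
    then show "continuous_map (subtopology (mspace euclidean_manifold) (cimg ?c)) (mspace P) (cinv ?c)"
      by simp
    fix u e assume "u \<in> atlas (euclidean_manifold :: ('b, 'b) manifold)" and e: "e \<in> atlas P"
    then have u: "u = (UNIV, id)" by simp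
    let ?S = "cimg ?c \<inter> cinv ?c -` cdom e"
    have "smooth_on ?S \<Psi>" by (rule smooth_on_subset[OF h(3)]) (use VS in auto)
    then have "smooth_on ?S (\<lambda>y. cmap e (cinv \<kappa> (\<Psi> y)))"
    proof (rule smooth_on_compose[OF _ smooth_atlasD(3)[OF P \<kappa> e]])
      fix y assume y: "y \<in> ?S"
      then obtain q where q: "q \<in> ?O" "\<Psi> y = cmap \<kappa> q" using cinv(2) by blast
      then have "cinv ?c y = q" using y cinv(1) chart_onD(5)[OF kc] by auto
      then show "\<Psi> y \<in> cmap \<kappa> ` (cdom \<kappa> \<inter> cdom e)" using q y by auto
    qed
    then have "smooth_on ?S (\<lambda>y. cmap e (cinv ?c y))"
      by (rule smooth_on_cong) (use cinv(1) in simp)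
    then show "smooth_on (cmap u ` (cdom u \<inter> cimg ?c \<inter> cinv ?c -` cdom e)) (\<lambda>x. cmap e (cinv ?c (cinv u x)))"
      by (simp add: u)
  qed
  ultimately show ?thesis
    unfolding domain_manifold_simps using inj m img by simp
qed

text \<open>Near a zero of \<open>f\<close>, the function \<open>f\<close> itself becomes a coordinate.\<close>

lemma domain_chart_exists:
  fixes P :: "('a, 'e::euclidean_space) manifold" and f :: "'e \<Rightarrow> real"
  assumes P: "smooth_atlas P" and D: "D \<subseteq> carr P" and \<kappa>: "\<kappa> \<in> atlas P" and p: "p \<in> cdom \<kappa>" "p \<in> D"
    and T: "open T" "cmap \<kappa> p \<in> T" and f: "smooth_on T f"
    and Tf: "{x \<in> T. 0 \<le> f x} = cmap \<kappa> ` {q \<in> cdom \<kappa> \<inter> D. cmap \<kappa> q \<in> T}"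
    and reg: "0 < f (cmap \<kappa> p) \<or> (\<exists>v. frechet_derivative f (at (cmap \<kappa> p)) v \<noteq> 0)"
  shows "\<exists>c\<in>atlas (domain_manifold P D). p \<in> cdom c"
proof -
  have sub: "cmap \<kappa> ` {q \<in> cdom \<kappa> \<inter> D. cmap \<kappa> q \<in> U} = {x \<in> U. 0 \<le> f x}" if "U \<subseteq> T" for U
  proof -
    have "cmap \<kappa> ` {q \<in> cdom \<kappa> \<inter> D. cmap \<kappa> q \<in> U} = cmap \<kappa> ` {q \<in> cdom \<kappa> \<inter> D. cmap \<kappa> q \<in> T} \<inter> U"
      using that by auto
    also have "\<dots> = {x \<in> T. 0 \<le> f x} \<inter> U" by (simp only: Tf)
    also have "\<dots> = {x \<in> U. 0 \<le> f x}" using that by auto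
    finally show ?thesis .
  qed
  from reg show ?thesis
  proof
    assume pos: "0 < f (cmap \<kappa> p)"
    \<comment> \<open>Where f is positive, the domain fills an open part of the chart, so \<kappa>
      itself restricts to a chart there.\<close>
    define U where "U = T \<inter> f -` {0<..}"
    have U: "open U" unfolding U_def
      by (rule continuous_open_preimage[OF smooth_on_imp_continuous_on[OF f] T(1)]) (rule open_greaterThan)
    have UT: "U \<subseteq> T" by (simp add: U_def)
    have US: "U = cmap \<kappa> ` {q \<in> cdom \<kappa> \<inter> D. cmap \<kappa> q \<in> U}"
      unfolding sub[OF UT] by (auto simp: U_def)
    have hom: "homeomorphism U U (\<lambda>x. x) (\<lambda>x. x)" by (simp add: homeomorphism_def)
    have m: "model_open ((\<lambda>x. x) ` U)" using U by (simp add: model_open_def)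
    have "({q \<in> cdom \<kappa> \<inter> D. cmap \<kappa> q \<in> U}, \<lambda>q. cmap \<kappa> q) \<in> atlas (domain_manifold P D)"
      by (rule domain_chartI[OF P D \<kappa> U US subset_refl hom smooth_on_ident smooth_on_ident m])
    moreover have "p \<in> cdom ({q \<in> cdom \<kappa> \<inter> D. cmap \<kappa> q \<in> U}, \<lambda>q. cmap \<kappa> q)"
      using p T pos by (simp add: U_def)
    ultimately show ?thesis by (rule bexI[rotated])
  next
    assume "\<exists>v. frechet_derivative f (at (cmap \<kappa> p)) v \<noteq> 0"
    then obtain v where v: "frechet_derivative f (at (cmap \<kappa> p)) v \<noteq> 0" by blast
    have lin: "linear (frechet_derivative f (at (cmap \<kappa> p)))"
      by (rule has_derivative_linear[OF smooth_on_open_derivative(1)[OF T(1) f T(2)]])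
    obtain b where b: "b \<in> Basis" "frechet_derivative f (at (cmap \<kappa> p)) b \<noteq> 0"
    proof -
      have "\<exists>b\<in>Basis. frechet_derivative f (at (cmap \<kappa> p)) b \<noteq> 0"
      proof (rule ccontr)
        assume "\<not> ?thesis"
        then have "frechet_derivative f (at (cmap \<kappa> p)) v = 0"
          unfolding linear_Basis_expand[OF lin, of v] by (intro sum.neutral) simp
        then show False using v by simp
      qed
      then show thesis using that by metis
    qed
    let ?\<Phi> = "\<lambda>x. x + (f x - x \<bullet> b) *\<^sub>R b"
    obtain U V g where U: "open U" "cmap \<kappa> p \<in> U" "U \<subseteq> T" "open V"
      "homeomorphism U V ?\<Phi> g" "smooth_on V g"
      by (rule straighten[OF T f b])
    let ?S = "{x \<in> U. 0 \<le> f x}"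
    have \<Phi>b: "?\<Phi> x \<bullet> b = f x" for x using b(1) by (simp add: inner_add_left)
    have \<Phi>: "smooth_on U ?\<Phi>"
      using smooth_on_subset[OF f U(3)]
      by (intro smooth_on_add smooth_on_scaleR smooth_on_diff smooth_on_inner smooth_on_ident smooth_on_const)
    \<comment> \<open>The new b-coordinate is f, so the condition 0 \<le> f becomes the half-space
      condition.\<close>
    have "?\<Phi> ` ?S = half_space b \<inter> V"
    proof
      show "?\<Phi> ` ?S \<subseteq> half_space b \<inter> V"
        using U(5) \<Phi>b unfolding homeomorphism_def half_space_def by auto
      show "half_space b \<inter> V \<subseteq> ?\<Phi> ` ?S"
      proof
        fix y assume y: "y \<in> half_space b \<inter> V"
        then have gU: "g y \<in> U" and \<open>?\<Phi> (g y) = y\<close> using U(5) unfolding homeomorphism_def by auto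
        have "0 \<le> f (g y)" using \<Phi>b[of "g y"] y \<open>?\<Phi> (g y) = y\<close> by (simp add: half_space_def)
        with gU have "g y \<in> ?S" by simp
        then have "?\<Phi> (g y) \<in> ?\<Phi> ` ?S" by (rule imageI)
        then show "y \<in> ?\<Phi> ` ?S" unfolding \<open>?\<Phi> (g y) = y\<close> .
      qed
    qed
    then have m: "model_open (?\<Phi> ` ?S)"
      unfolding model_open_def openin_open by (intro disjI2 bexI[OF _ b(1)] exI[of _ V] conjI U(4))
    have "({q \<in> cdom \<kappa> \<inter> D. cmap \<kappa> q \<in> U}, \<lambda>q. ?\<Phi> (cmap \<kappa> q)) \<in> atlas (domain_manifold P D)"
      by (rule domain_chartI[OF P D \<kappa> U(1) sub[OF U(3), symmetric] _ U(5) \<Phi> U(6) m]) auto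
    moreover have "p \<in> cdom ({q \<in> cdom \<kappa> \<inter> D. cmap \<kappa> q \<in> U}, \<lambda>q. ?\<Phi> (cmap \<kappa> q))" using p U(2) by simp
    ultimately show ?thesis by (rule bexI[rotated])
  qed
qed

section \<open>Time-periodic Hamiltonians\<close>

text \<open>A point lies in the boundary as soon as one half-space chart puts it on the face, so
  outside the boundary the b-coordinate is positive in every half-space chart.\<close>

lemma interior_nhd:
  assumes d: "chart_on M d" "d \<in> atlas M" "p \<in> cdom d" and p: "p \<notin> manifold_boundary M"
  obtains B where "open B" "cmap d p \<in> B" "B \<subseteq> cimg d"
  using chart_onD(2)[OF d(1)]
proof (cases rule: model_openE)
  case (plain U)
  show thesis by (rule that[of U]) (use plain d(3) in auto)
next
  case (half b U)
  have op: "openin (top_of_set (half_space b)) (cimg d)"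
    unfolding openin_open by (rule exI[of _ U]) (use half in simp)
  have "cmap d p \<in> half_space b \<inter> U" using half(3) d(3) by blast
  then have x: "0 \<le> cmap d p \<bullet> b" "cmap d p \<in> U" by (simp_all add: half_space_def)
  have "cmap d p \<bullet> b \<noteq> 0"
  proof
    assume "cmap d p \<bullet> b = 0"
    then have "p \<in> manifold_boundary M"
      unfolding manifold_boundary_def using d(2,3) half(1) op by blast
    then show False using p by simp
  qed
  show thesis
  proof (rule that[of "U \<inter> {x. 0 < b \<bullet> x}"])
    show "open (U \<inter> {x. 0 < b \<bullet> x})" using half(2) open_halfspace_gt[of 0 b] by (rule open_Int)
    show "cmap d p \<in> U \<inter> {x. 0 < b \<bullet> x}"
      using x \<open>cmap d p \<bullet> b \<noteq> 0\<close> by (simp add: inner_commute)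
    show "U \<inter> {x. 0 < b \<bullet> x} \<subseteq> cimg d"
      unfolding half(3) half_space_def by (auto simp: inner_commute)
  qed
qed

lemma prod_euclidean_atlas:
  "d \<in> atlas M \<Longrightarrow> (UNIV \<times> cdom d, map_prod id (cmap d)) \<in> atlas (prod_manifold euclidean_manifold M)"
proof -
  assume d: "d \<in> atlas M"
  show ?thesis
    unfolding prod_manifold_def manifold.select_convs mem_Collect_eq
    by (intro exI[of _ "(UNIV, id)"] exI[of _ d] conjI d) simp_all
qed

section \<open>Regularity and positivity of H, and membership in the tube\<close>

locale liouville_ham =
  fixes M :: "('a, 'e::euclidean_space) manifold" and lam H
  assumes W: "liouville_domain (M, lam)" and Ham: "H \<in> Ham (M, lam)"
begin

lemmas at_M = liouville_domainD(1)[OF W]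

lemma H_props:
  "w \<in> carr M \<Longrightarrow> H (t + 1) w = H t w"
  "smooth_map_on (prod_manifold euclidean_manifold M) (UNIV \<times> carr M) euclidean_manifold (\<lambda>(t, w). H t w)"
  "\<exists>U. openin (mspace M) U \<and> manifold_boundary M \<subseteq> U \<and> (\<forall>w\<in>U. \<forall>s t. H s w = H t w)"
  "w \<in> manifold_boundary M \<Longrightarrow> H t w = 0"
  "w \<in> carr M \<Longrightarrow> 0 < tau (M, lam) H t w"
proof -
  note A = Ham[unfolded Ham_def mem_Collect_eq fst_conv]
  note A1 = conjunct1[OF A] and A2 = conjunct1[OF conjunct2[OF A]]
    and A3 = conjunct1[OF conjunct2[OF conjunct2[OF A]]]
    and A4 = conjunct1[OF conjunct2[OF conjunct2[OF conjunct2[OF A]]]]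
    and A5 = conjunct2[OF conjunct2[OF conjunct2[OF conjunct2[OF A]]]]
  show "w \<in> carr M \<Longrightarrow> H (t + 1) w = H t w" using A1 by simp
  show "smooth_map_on (prod_manifold euclidean_manifold M) (UNIV \<times> carr M) euclidean_manifold (\<lambda>(t, w). H t w)"
    by (rule A2)
  show "\<exists>U. openin (mspace M) U \<and> manifold_boundary M \<subseteq> U \<and> (\<forall>w\<in>U. \<forall>s t. H s w = H t w)"
    by (rule A3)
  show "w \<in> manifold_boundary M \<Longrightarrow> H t w = 0" using A4 by simp
  show "w \<in> carr M \<Longrightarrow> 0 < tau (M, lam) H t w" using A5 by simp
qed

lemma H_periodic: "w \<in> carr M \<Longrightarrow> H (t + of_int n) w = H t w"
proof (induction n rule: int_induct[where k = 0])
  case (step1 i)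
  then show ?case using H_props(1)[of w "t + of_int i"] by (simp add: algebra_simps)
next
  case (step2 i)
  then show ?case using H_props(1)[of w "t + of_int (i - 1)"] by (simp add: algebra_simps)
qed simp

lemma H_continuous: "continuous_map (prod_topology euclidean (mspace M)) euclidean (\<lambda>(t, w). H t w)"
proof -
  have "continuous_map (subtopology (prod_topology euclidean (mspace M)) (UNIV \<times> carr M)) euclidean (\<lambda>(t, w). H t w)"
    using smooth_map_onD(1)[OF H_props(2)] by (simp add: prod_manifold_def)
  moreover have "subtopology (prod_topology euclidean (mspace M)) (UNIV \<times> carr M) = prod_topology (euclidean :: real topology) (mspace M)"
    by (simp add: subtopology_Times)
  ultimately show ?thesis by simp
qed

text \<open>Joint smoothness in time and position is what allows time to be replaced by the angle of
  z in tube coordinates.\<close>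

lemma H_chart:
  assumes d: "d \<in> atlas M"
  shows "smooth_on (UNIV \<times> cimg d) (\<lambda>(t, x). H t (cinv d x))"
proof -
  note dc = smooth_atlasD(2)[OF at_M d]
  let ?k = "(UNIV \<times> cdom d, map_prod id (cmap d)) :: (real \<times> 'a, real \<times> 'e) chart"
  have inj: "inj_on (cmap ?k) (cdom ?k)"
    using chart_onD(3)[OF dc] by (auto simp: inj_on_def)
  have "smooth_on (cmap ?k ` (cdom ?k \<inter> UNIV \<times> carr M \<inter> (\<lambda>(t, w). H t w) -` cdom (UNIV :: real set, id :: real \<Rightarrow> real)))
      (\<lambda>x. cmap (UNIV :: real set, id :: real \<Rightarrow> real) ((\<lambda>(t, w). H t w) (cinv ?k x)))"
    by (rule smooth_map_onD(2)[OF H_props(2) prod_euclidean_atlas[OF d]]) simp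
  then show ?thesis
  proof (rule smooth_on_cong_subset)
    fix y :: "real \<times> 'e" assume "y \<in> UNIV \<times> cimg d"
    then obtain t q where q: "y = (t, cmap d q)" "q \<in> cdom d" by auto
    then have "cinv ?k y = (t, q)" using cinv_cmap[OF inj, of "(t, q)"] by simp
    then show "cmap (UNIV, id) ((\<lambda>(t, w). H t w) (cinv ?k y)) = (\<lambda>(t, x). H t (cinv d x)) y"
      using chart_onD(5)[OF dc q(2)] by (simp add: q(1))
  next
    show "UNIV \<times> cimg d \<subseteq> cmap ?k ` (cdom ?k \<inter> UNIV \<times> carr M \<inter> (\<lambda>(t, w). H t w) -` cdom (UNIV, id))"
    proof
      fix y :: "real \<times> 'e" assume "y \<in> UNIV \<times> cimg d"
      then obtain t q where q: "y = (t, cmap d q)" "q \<in> cdom d" by auto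
      have "(t, q) \<in> cdom ?k \<inter> UNIV \<times> carr M \<inter> (\<lambda>(t, w). H t w) -` cdom (UNIV :: real set, id :: real \<Rightarrow> real)"
        using q(2) chart_onD(4)[OF dc] by auto
      moreover have "y = cmap ?k (t, q)" using q(1) by simp
      ultimately show "y \<in> cmap ?k ` (cdom ?k \<inter> UNIV \<times> carr M \<inter> (\<lambda>(t, w). H t w) -` cdom (UNIV :: real set, id :: real \<Rightarrow> real))"
        by (rule image_eqI[rotated])
    qed
  qed
qed

lemma H_chart_slice:
  assumes d: "d \<in> atlas M"
  shows "smooth_on (cimg d) (\<lambda>x. H t (cinv d x))"
proof -
  have "smooth_on (cimg d) (\<lambda>x. (\<lambda>(t, x). H t (cinv d x)) (t, x))"
    by (rule smooth_on_compose[OF smooth_on_Pair[OF smooth_on_const smooth_on_ident] H_chart[OF d]]) simp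
  then show ?thesis by simp
qed

lemma H_smooth: "smooth_map_on M (carr M) euclidean_manifold (H t)"
  unfolding smooth_map_on_euclidean_iff[OF at_M]
proof (intro conjI ballI)
  have "continuous_map (mspace M) (prod_topology euclidean (mspace M)) (\<lambda>w. (t, w))"
    by (simp add: continuous_map_pairwise comp_def)
  from continuous_map_compose[OF this H_continuous]
  show "continuous_map (subtopology (mspace M) (carr M)) euclidean (H t)"
    by (simp add: comp_def)
  fix c assume c: "c \<in> atlas M"
  show "smooth_on (cmap c ` (cdom c \<inter> carr M)) (\<lambda>x. H t (cinv c x))"
    by (rule smooth_on_subset[OF H_chart_slice[OF c]]) auto
qed

lemma mdiff_H_minimum:
  assumes w: "w \<in> carr M" "w \<notin> manifold_boundary M" and min: "\<And>v. v \<in> carr M \<Longrightarrow> H t w \<le> H t v"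
  shows "mdiff M (H t) w u = 0"
proof -
  let ?d = "chart_at M w"
  note d = chart_at[OF at_M w(1)]
  note dc = smooth_atlasD(2)[OF at_M d(1)]
  obtain B where B: "open B" "cmap ?d w \<in> B" "B \<subseteq> cimg ?d"
    by (rule interior_nhd[OF dc d w(2)])
  have "((\<lambda>x. cmap (chart_at euclidean_manifold (H t w)) (H t (cinv ?d x))) has_derivative mdiff M (H t) w)
      (at (cmap ?d w) within cimg ?d)"
    by (rule iffD1[OF rderiv_whole[OF dc d(2)]
          mderiv(1)[OF at_M smooth_atlas_euclidean H_smooth w(1), unfolded has_mderiv_on_rderiv]])
  then have "((\<lambda>x. H t (cinv ?d x)) has_derivative mdiff M (H t) w) (at (cmap ?d w) within cimg ?d)"
    by simp
  from has_derivative_subset[OF this B(3)]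
  have "((\<lambda>x. H t (cinv ?d x)) has_derivative mdiff M (H t) w) (at (cmap ?d w))"
    using at_within_open[OF B(2,1)] by simp
  moreover have "\<forall>y\<in>B. H t (cinv ?d (cmap ?d w)) \<le> H t (cinv ?d y)"
  proof
    fix y assume "y \<in> B"
    then have "y \<in> cimg ?d" using B(3) by (rule subsetD[rotated])
    then have "cinv ?d y \<in> carr M" by (rule subsetD[OF chart_onD(4)[OF dc] cinv_in])
    then show "H t (cinv ?d (cmap ?d w)) \<le> H t (cinv ?d y)"
      using min chart_onD(5)[OF dc d(2)] by simp
  qed
  ultimately have "mdiff M (H t) w = (\<lambda>v. 0)"
    by (intro differential_zero_maxmin[OF B(2,1)] disjI2)
  then show ?thesis by simp
qed

text \<open>At a critical point the Hamiltonian field vanishes, so \<open>tau\<close> reduces to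
  H.\<close>

lemma tau_H_critical:
  assumes w: "w \<in> carr M" and crit: "\<And>u. mdiff M (H t) w u = 0"
  shows "0 < H t w"
proof -
  have l: "linear (\<lambda>u. ext_deriv M lam w u v)" for v
    by (rule ext_deriv_linear(1)[OF at_M liouville_domainD(3)[OF W] w])
  have "hamiltonian_field (M, lam) (H t) w = 0"
    by (rule hamiltonian_field(2)[OF W w H_smooth]) (simp add: crit linear_0[OF l])
  moreover have "linear (lam w)" using liouville_domainD(3)[OF W] w by (simp add: smooth_one_form_def)
  ultimately show ?thesis using H_props(5)[OF w, of t] by (simp add: tau_def linear_0)
qed

text \<open>By compactness H t attains its minimum, either on the boundary, where it is 0, or at an
  interior critical point, where it is positive.\<close>

lemma H_nonneg_pos:
  assumes w: "w \<in> carr M"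
  shows "0 \<le> H t w" and "w \<notin> manifold_boundary M \<Longrightarrow> 0 < H t w"
proof -
  have "compactin euclidean (H t ` carr M)"
    by (rule image_compactin[OF liouville_domainD(2)[OF W, unfolded compact_space_def]])
      (use smooth_map_onD(1)[OF H_smooth, of t] in simp)
  then have "compact (H t ` carr M)" by simp
  then obtain m where "m \<in> H t ` carr M" "\<And>y. y \<in> H t ` carr M \<Longrightarrow> m \<le> y"
    using compact_attains_inf[of "H t ` carr M"] w by blast
  then obtain v where v: "v \<in> carr M" "\<And>u. u \<in> carr M \<Longrightarrow> H t v \<le> H t u" by blast
  have nonneg: "0 \<le> H t v"
  proof (cases "v \<in> manifold_boundary M")
    case False
    then show ?thesis using tau_H_critical[OF v(1) mdiff_H_minimum[OF v(1) False v(2)]] by simp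
  qed (simp add: H_props(4))
  then show "0 \<le> H t w" using v(2)[OF w] by simp
  show "0 < H t w" if "w \<notin> manifold_boundary M"
  proof (rule ccontr)
    assume "\<not> 0 < H t w"
    \<comment> \<open>A nonpositive value at w would itself be a global minimum at an interior
      point.\<close>
    then have "H t w \<le> H t u" if "u \<in> carr M" for u using nonneg v(2)[OF that] by simp
    from tau_H_critical[OF w mdiff_H_minimum[OF w \<open>w \<notin> manifold_boundary M\<close> this]] \<open>\<not> 0 < H t w\<close>
    show False by simp
  qed
qed

text \<open>Membership may be tested with any polar representation of z. For z \<noteq> 0 two angles
  differ by an integer and H is periodic; for z = 0 the angle is arbitrary, but the condition then
  holds by nonnegativity of H.\<close>

lemma tube_iff:
  assumes z: "z = of_real (cmod z) * cis (2 * pi * s)"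
  shows "(w, z) \<in> tube_set (M, lam) H \<longleftrightarrow> w \<in> carr M \<and> pi * (cmod z)\<^sup>2 \<le> H s w"
proof
  assume "w \<in> carr M \<and> pi * (cmod z)\<^sup>2 \<le> H s w"
  then show "(w, z) \<in> tube_set (M, lam) H"
    unfolding tube_set_def mem_Collect_eq case_prod_conv fst_conv
    using z by (intro conjI exI[of _ "cmod z"] exI[of _ s]) simp_all
next
  assume "(w, z) \<in> tube_set (M, lam) H"
  then obtain r t where w: "w \<in> carr M" and r: "0 \<le> r" "z = of_real r * cis (2 * pi * t)" "pi * (cmod z)\<^sup>2 \<le> H t w"
    unfolding tube_set_def by auto
  have "pi * (cmod z)\<^sup>2 \<le> H s w"
  proof (cases "z = 0")
    case True
    then show ?thesis using H_nonneg_pos(1)[OF w] by simp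
  next
    case False
    have "cmod z = r" using r(1,2) by (simp add: norm_mult)
    then have "of_real r * cis (2 * pi * t) = of_real r * cis (2 * pi * s)" "r \<noteq> 0"
      using z r(2) False by auto
    then have "cis (2 * pi * t) = cis (2 * pi * s)" by simp
    then have "sin (2 * pi * t) = sin (2 * pi * s)" "cos (2 * pi * t) = cos (2 * pi * s)"
      by (metis cis.sel(2), metis cis.sel(1))
    then obtain n :: int where "2 * pi * t = 2 * pi * s + 2 * pi * n"
      using sin_cos_eq_iff[of "2 * pi * t" "2 * pi * s"] by blast
    then have "2 * pi * t = 2 * pi * (s + n)" by (simp add: algebra_simps)
    then have "t = s + of_int n" by simp
    then show ?thesis using r(3) H_periodic[OF w, of s n] by simp
  qed
  with w show "w \<in> carr M \<and> pi * (cmod z)\<^sup>2 \<le> H s w" by simp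
qed

lemma polar_angle: "\<exists>s. z = of_real (cmod z) * cis (2 * pi * s)"
  by (rule exI[of _ "Arg z / (2 * pi)"]) (use rcis_cmod_Arg[of z] in \<open>simp add: rcis_def\<close>)

lemma tube_set_carr: "tube_set (M, lam) H \<subseteq> carr (cylinder M :: ('a \<times> complex, 'e \<times> complex) manifold)"
  by (auto simp: tube_set_def cylinder_simps)

lemma mdiff_H_boundary:
  assumes w: "w \<in> manifold_boundary M" "w \<in> carr M"
  shows "mdiff M (H t) w (liouville_field (M, lam) w) < 0"
  using H_props(5)[OF w(2), of t] H_props(4)[OF w(1)] mdiff_liouville_field[OF W w(2) H_smooth, of t]
  by (simp add: tau_def)

end

section \<open>Charts of the tube\<close>

lemma frechet_derivative_along_line:
  fixes f :: "'a::euclidean_space \<Rightarrow> real"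
  assumes T: "open T" "x \<in> T" and f: "smooth_on T f"
    and d: "((\<lambda>s. f (x + s *\<^sub>R v)) has_real_derivative k) (at 0)"
  shows "frechet_derivative f (at x) v = k"
proof -
  have "((\<lambda>s. f (x + s *\<^sub>R v)) has_real_derivative frechet_derivative f (at x) v) (at 0)"
    by (rule has_real_derivative_along_line) (use smooth_on_open_derivative(1)[OF T(1) f T(2)] in simp)
  then show ?thesis using d by (rule DERIV_unique)
qed

lemma smooth_on_norm_square:
  fixes f :: "'a::euclidean_space \<Rightarrow> 'b::euclidean_space"
  shows "smooth_on S f \<Longrightarrow> smooth_on S (\<lambda>x. (norm (f x))\<^sup>2)"
  unfolding power2_norm_eq_inner by (rule smooth_on_inner)

context liouville_ham
begin

abbreviation tube_dom :: "('a \<times> complex) set" where "tube_dom \<equiv> tube_set (M, lam) H"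
abbreviation tube_mf :: "('a \<times> complex, 'e \<times> complex) manifold" where "tube_mf \<equiv> tube_manifold (M, lam) H"

text \<open>Here f is a defining function of the tube in cylinder coordinates. At the boundary of W
  the open set \<open>T\<close> reaches beyond the chart image; \<open>Tf\<close> then says that f
  is negative there.\<close>

lemma tube_chartI:
  fixes f :: "'e \<times> complex \<Rightarrow> real"
  assumes d: "d \<in> atlas M" "w \<in> cdom d" and wz: "(w, z) \<in> tube_dom"
    and T: "open T" "(cmap d w, z) \<in> T" and f: "smooth_on T f"
    and Tf: "\<And>x \<zeta>. (x, \<zeta>) \<in> T \<Longrightarrow> 0 \<le> f (x, \<zeta>) \<Longrightarrow> x \<in> cimg d \<and> (cinv d x, \<zeta>) \<in> tube_dom"
    and fT: "\<And>v \<zeta>. v \<in> cdom d \<Longrightarrow> (cmap d v, \<zeta>) \<in> T \<Longrightarrow> (v, \<zeta>) \<in> tube_dom \<Longrightarrow> 0 \<le> f (cmap d v, \<zeta>)"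
    and reg: "0 < f (cmap d w, z) \<or> (\<exists>v. frechet_derivative f (at (cmap d w, z)) v \<noteq> 0)"
  shows "\<exists>c\<in>atlas tube_mf. (w, z) \<in> cdom c"
proof -
  have k: "cyl d \<in> atlas (cylinder M)" using d(1) by (simp add: cylinder_simps)
  note dc = smooth_atlasD(2)[OF at_M d(1)]
  have eq: "{x \<in> T. 0 \<le> f x} = cmap (cyl d) ` {q \<in> cdom (cyl d) \<inter> tube_dom. cmap (cyl d) q \<in> T}" (is "?L = ?R")
  proof
    show "?L \<subseteq> ?R"
    proof
      fix y assume y: "y \<in> ?L"
      obtain x \<zeta> where xz: "y = (x, \<zeta>)" by (rule prod.exhaust)
      have x: "x \<in> cimg d" "(cinv d x, \<zeta>) \<in> tube_dom" using Tf[of x \<zeta>] y xz by auto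
      have "y = cmap (cyl d) (cinv d x, \<zeta>)" using cmap_cinv[OF x(1)] xz by simp
      moreover have "(cinv d x, \<zeta>) \<in> {q \<in> cdom (cyl d) \<inter> tube_dom. cmap (cyl d) q \<in> T}"
        using cinv_in[OF x(1)] x(2) cmap_cinv[OF x(1)] y xz by simp
      ultimately show "y \<in> ?R" by (rule image_eqI)
    qed
    show "?R \<subseteq> ?L"
    proof
      fix y assume "y \<in> ?R"
      then obtain q where q: "y = cmap (cyl d) q" "q \<in> {q \<in> cdom (cyl d) \<inter> tube_dom. cmap (cyl d) q \<in> T}"
        by (rule imageE)
      obtain v \<zeta> where vz: "q = (v, \<zeta>)" by (rule prod.exhaust)
      show "y \<in> ?L" using q fT[of v \<zeta>] unfolding vz by simp
    qed
  qed
  show ?thesis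
    unfolding tube_manifold_def fst_conv
    by (rule domain_chart_exists[OF smooth_atlas_cylinder[OF at_M] tube_set_carr k _ wz T(1) _ f eq])
      (use d(2) T(2) reg in simp_all)
qed

text \<open>Near z \<noteq> 0 the angle is a smooth function of the plane coordinate, so H - pi
  |z|^2 is smooth; moving radially leaves the angle fixed and changes the function at a nonzero
  rate.\<close>

lemma tube_chart_off_axis:
  assumes wz: "(w, z) \<in> tube_dom" and z: "z \<noteq> 0"
  shows "\<exists>c\<in>atlas tube_mf. (w, z) \<in> cdom c"
proof -
  obtain s where s: "z = of_real (cmod z) * cis (2 * pi * s)" using polar_angle by blast
  have w: "w \<in> carr M" "pi * (cmod z)\<^sup>2 \<le> H s w" using wz tube_iff[OF s] by auto
  \<comment> \<open>H vanishes over the boundary of W, so a tube point off the axis lies over the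
    interior.\<close>
  have "0 < pi * (cmod z)\<^sup>2" using z by simp
  then have "H s w \<noteq> 0" using w(2) by linarith
  then have wb: "w \<notin> manifold_boundary M" using H_props(4) by blast
  let ?d = "chart_at M w"
  note d = chart_at[OF at_M w(1)]
  note dc = smooth_atlasD(2)[OF at_M d(1)]
  obtain B where B: "open B" "cmap ?d w \<in> B" "B \<subseteq> cimg ?d"
    by (rule interior_nhd[OF dc d wb])
  \<comment> \<open>The branch of the angle with value s at z. On \<open>Z\<close> the quotient
    \<zeta>/z has positive real part, so the principal logarithm is smooth.\<close>
  define \<theta> where "\<theta> = (\<lambda>\<zeta>. s + Im (Ln (\<zeta> * inverse z)) / (2 * pi))"
  define Z where "Z = {\<zeta>. 0 < Re (\<zeta> * inverse z)}"
  have Z: "open Z"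
    unfolding Z_def by (intro open_Collect_less continuous_intros)
  have \<theta>Z: "smooth_on Z \<theta>"
  proof -
    have "smooth_on Z (\<lambda>\<zeta>. Ln (\<zeta> * inverse z))"
      by (rule smooth_on_compose[OF smooth_on_bounded_linear[OF bounded_linear_mult_left smooth_on_ident] smooth_on_Ln])
        (simp add: Z_def)
    from smooth_on_bounded_linear[OF bounded_linear_divide[of "2 * pi"] smooth_on_bounded_linear[OF bounded_linear_Im this]]
    show ?thesis unfolding \<theta>_def by (rule smooth_on_add[OF smooth_on_const])
  qed
  have pol: "\<zeta> = of_real (cmod \<zeta>) * cis (2 * pi * \<theta> \<zeta>)" if "\<zeta> \<in> Z" for \<zeta>
  proof -
    define u where "u = \<zeta> * inverse z"
    have u: "u \<noteq> 0" using that by (auto simp: Z_def u_def)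
    have "u = exp (Ln u)" using u by simp
    also have "\<dots> = of_real (exp (Re (Ln u))) * cis (Im (Ln u))" by (simp add: exp_eq_polar)
    finally have u1: "u = of_real (cmod u) * cis (Im (Ln u))" using u by simp
    have "\<zeta> = u * z" using z by (simp add: u_def)
    also have "\<dots> = (of_real (cmod u) * cis (Im (Ln u))) * (of_real (cmod z) * cis (2 * pi * s))"
      using u1 s by metis
    also have "\<dots> = of_real (cmod u * cmod z) * (cis (2 * pi * s) * cis (Im (Ln u)))"
      by simp
    also have "cmod u * cmod z = cmod \<zeta>" using \<open>\<zeta> = u * z\<close> by (simp add: norm_mult)
    also have "cis (2 * pi * s) * cis (Im (Ln u)) = cis (2 * pi * \<theta> \<zeta>)"
      by (simp add: cis_mult \<theta>_def u_def algebra_simps)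
    finally show ?thesis .
  qed
  define f where "f = (\<lambda>y :: 'e \<times> complex. H (\<theta> (snd y)) (cinv ?d (fst y)) - pi * (cmod (snd y))\<^sup>2)"
  let ?T = "B \<times> Z"
  have f: "smooth_on ?T f"
  proof -
    have "smooth_on ?T (\<lambda>y. (\<lambda>(t, x). H t (cinv ?d x)) (\<theta> (snd y), fst y))"
    proof (rule smooth_on_compose[OF _ H_chart[OF d(1)]])
      show "smooth_on ?T (\<lambda>y. (\<theta> (snd y), fst y))"
        by (rule smooth_on_Pair[OF smooth_on_compose[OF smooth_on_snd[OF smooth_on_ident] \<theta>Z] smooth_on_fst[OF smooth_on_ident]])
          auto
    qed (use B(3) in auto)
    then have 1: "smooth_on ?T (\<lambda>y. H (\<theta> (snd y)) (cinv ?d (fst y)))" by simp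
    have 2: "smooth_on ?T (\<lambda>y. pi * (cmod (snd y))\<^sup>2)"
      by (rule smooth_on_bounded_linear[OF bounded_linear_mult_right smooth_on_norm_square[OF smooth_on_snd[OF smooth_on_ident]]])
    show ?thesis unfolding f_def by (rule smooth_on_diff[OF 1 2])
  qed
  have zZ: "z \<in> Z" using z by (simp add: Z_def del: complex_inverse times_complex.sel inverse_complex.sel)
  have T: "open ?T" "(cmap ?d w, z) \<in> ?T" using B Z zZ by (auto intro: open_Times)
  show ?thesis
  proof (rule tube_chartI[OF d wz T f])
    fix x \<zeta> assume xz: "(x, \<zeta>) \<in> ?T" "0 \<le> f (x, \<zeta>)"
    then have x: "x \<in> cimg ?d" "\<zeta> \<in> Z" using B(3) by auto
    have "cinv ?d x \<in> carr M" by (rule subsetD[OF chart_onD(4)[OF dc] cinv_in[OF x(1)]])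
    then have "(cinv ?d x, \<zeta>) \<in> tube_dom"
      using xz(2) unfolding tube_iff[OF pol[OF x(2)]] by (simp add: f_def)
    then show "x \<in> cimg ?d \<and> (cinv ?d x, \<zeta>) \<in> tube_dom" using x(1) by simp
  next
    fix v \<zeta> assume v: "v \<in> cdom ?d" "(cmap ?d v, \<zeta>) \<in> ?T" "(v, \<zeta>) \<in> tube_dom"
    then have "\<zeta> \<in> Z" by simp
    from v(3)[unfolded tube_iff[OF pol[OF this]]] show "0 \<le> f (cmap ?d v, \<zeta>)"
      using chart_onD(5)[OF dc v(1)] by (simp add: f_def)
  next
    \<comment> \<open>On the ray through z the angle remains s and f becomes a quadratic function of
      the factor 1 + u.\<close>
    have "((\<lambda>u. f ((cmap ?d w, z) + u *\<^sub>R (0, z))) has_real_derivative - (2 * pi * (cmod z)\<^sup>2)) (at 0)"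
    proof (rule has_field_derivative_transform_within_open)
      show "((\<lambda>u. H s w - pi * ((1 + u)\<^sup>2 * (cmod z)\<^sup>2)) has_real_derivative - (2 * pi * (cmod z)\<^sup>2)) (at 0)"
        by (auto intro!: derivative_eq_intros)
      show "open {-1<..<1::real}" "(0::real) \<in> {-1<..<1}" by auto
      fix u :: real assume u: "u \<in> {-1<..<1}"
      have e: "z + u *\<^sub>R z = of_real (1 + u) * z" by (simp add: algebra_simps scaleR_conv_of_real)
      have "(z + u *\<^sub>R z) * inverse z = of_real (1 + u)" using z unfolding e by simp
      moreover have "Ln (of_real (1 + u)) = of_real (ln (1 + u))" using u by (intro Ln_of_real) simp
      ultimately have "\<theta> (z + u *\<^sub>R z) = s" unfolding \<theta>_def by (simp only: Im_complex_of_real)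
      moreover have "cmod (z + u *\<^sub>R z) = (1 + u) * cmod z" using u unfolding e by (simp add: norm_mult del: of_real_add)
      ultimately show "H s w - pi * ((1 + u)\<^sup>2 * (cmod z)\<^sup>2) = f ((cmap ?d w, z) + u *\<^sub>R (0, z))"
        using chart_onD(5)[OF dc d(2)] by (simp add: f_def power_mult_distrib)
    qed
    from frechet_derivative_along_line[OF T f this]
    have "frechet_derivative f (at (cmap ?d w, z)) (0, z) \<noteq> 0" using z by simp
    then show "0 < f (cmap ?d w, z) \<or> (\<exists>v. frechet_derivative f (at (cmap ?d w, z)) v \<noteq> 0)" by blast
  qed
qed

text \<open>A bound uniform in time: periodicity reduces to the compact interval [0,1], where the
  tube lemma gives one neighbourhood of w for all times.\<close>

lemma H_lower_bound_nhd:
  assumes w: "w \<in> carr M" "w \<notin> manifold_boundary M"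
  obtains m V where "0 < m" "openin (mspace M) V" "w \<in> V" "\<And>t v. v \<in> V \<Longrightarrow> m < H t v"
proof -
  have cont: "continuous_on {0..1} (\<lambda>t. H t w)"
  proof -
    have "continuous_map euclidean (prod_topology euclidean (mspace M)) (\<lambda>t::real. (t, w))"
      using w(1) by (simp add: continuous_map_pairwise comp_def)
    from continuous_map_compose[OF this H_continuous] have "continuous_on UNIV (\<lambda>t. H t w)"
      by (simp add: comp_def)
    then show ?thesis by (rule continuous_on_subset) simp
  qed
  obtain t0 where t0: "t0 \<in> {0..1}" "\<And>t. t \<in> {0..1} \<Longrightarrow> H t0 w \<le> H t w"
    using continuous_attains_inf[OF compact_Icc _ cont] by auto
  \<comment> \<open>Half of the minimum over one period, so that the strict bound persists near
    w.\<close>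
  define m where "m = H t0 w / 2"
  have m: "0 < m" "m < H t0 w" using H_nonneg_pos(2)[OF w, of t0] by (auto simp: m_def)
  let ?A = "{y \<in> topspace (prod_topology (euclidean :: real topology) (mspace M)). (\<lambda>(t, w). H t w) y \<in> {m<..}}"
  have A: "openin (prod_topology euclidean (mspace M)) ?A"
    by (rule openin_continuous_map_preimage[OF H_continuous]) simp
  have "{0..1} \<times> {w} \<subseteq> ?A" using w(1) t0(2) m(2) by fastforce
  then obtain U V where V: "openin (mspace M) V" "{0..1} \<subseteq> U" "w \<in> V" "U \<times> V \<subseteq> ?A"
    using tube_lemma_left[OF A _ w(1), of "{0..1}"] by auto
  show thesis
  proof (rule that[OF m(1) V(1,3)])
    fix t :: real and v assume v: "v \<in> V"
    then have vc: "v \<in> carr M" using openin_subset[OF V(1)] by blast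
    have "t - of_int \<lfloor>t\<rfloor> \<in> {0..1}" using floor_correct[of t] by (simp add: algebra_simps)
    then have "(t - of_int \<lfloor>t\<rfloor>, v) \<in> ?A" using V(2,4) v by blast
    then have "m < H (t - of_int \<lfloor>t\<rfloor>) v" by simp
    then show "m < H t v" using H_periodic[OF vc, of "t - of_int \<lfloor>t\<rfloor>" "\<lfloor>t\<rfloor>"] by simp
  qed
qed

text \<open>Over an interior point a whole neighbourhood of the axis belongs to the tube, so the
  constant 1 serves as defining function; the angle, which is singular on the axis, does not
  enter.\<close>

lemma tube_chart_axis_interior:
  assumes w: "w \<in> carr M" "w \<notin> manifold_boundary M"
  shows "\<exists>c\<in>atlas tube_mf. (w, 0) \<in> cdom c"
proof -
  have "(0::complex) = of_real (cmod 0) * cis (2 * pi * 0)" by simp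
  from tube_iff[OF this] have wz: "(w, 0) \<in> tube_dom" using H_nonneg_pos(1)[OF w(1)] w(1) by simp
  let ?d = "chart_at M w"
  note d = chart_at[OF at_M w(1)]
  note dc = smooth_atlasD(2)[OF at_M d(1)]
  obtain B where B: "open B" "cmap ?d w \<in> B" "B \<subseteq> cimg ?d"
    by (rule interior_nhd[OF dc d w(2)])
  obtain m V where V: "0 < m" "openin (mspace M) V" "w \<in> V" "\<And>t v. v \<in> V \<Longrightarrow> m < H t v"
    using H_lower_bound_nhd[OF w] by metis
  obtain U where U: "open U" "cmap ?d w \<in> U" "\<And>q. q \<in> cdom ?d \<Longrightarrow> cmap ?d q \<in> U \<Longrightarrow> q \<in> V"
    using chart_nhd[OF dc V(2,3) d(2)] by metis
  \<comment> \<open>Chosen such that pi r^2 = m.\<close>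
  define r where "r = sqrt (m / pi)"
  have r: "0 < r" using V(1) by (simp add: r_def)
  let ?T = "(B \<inter> U) \<times> ball (0::complex) r"
  have T: "open ?T" "(cmap ?d w, 0) \<in> ?T" using B U r by (auto intro: open_Times)
  show ?thesis
  proof (rule tube_chartI[OF d wz T smooth_on_const[of _ 1]])
    fix x \<zeta> assume "(x, \<zeta>) \<in> ?T"
    then have x: "x \<in> cimg ?d" "x \<in> U" "cmod \<zeta> < r" using B(3) by auto
    have vV: "cinv ?d x \<in> V" by (rule U(3)[OF cinv_in[OF x(1)]]) (simp only: cmap_cinv[OF x(1)] x(2))
    obtain s where s: "\<zeta> = of_real (cmod \<zeta>) * cis (2 * pi * s)" using polar_angle by blast
    have "(cmod \<zeta>)\<^sup>2 < r\<^sup>2" using x(3) by (intro power_strict_mono) auto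
    also have "r\<^sup>2 = m / pi" using V(1) by (simp add: r_def)
    finally have "pi * (cmod \<zeta>)\<^sup>2 < m" by (simp add: field_simps)
    then have "pi * (cmod \<zeta>)\<^sup>2 \<le> H s (cinv ?d x)" using V(4)[OF vV, of s] by simp
    then have "(cinv ?d x, \<zeta>) \<in> tube_dom"
      unfolding tube_iff[OF s] using subsetD[OF chart_onD(4)[OF dc] cinv_in[OF x(1)]] by simp
    then show "x \<in> cimg ?d \<and> (cinv ?d x, \<zeta>) \<in> tube_dom" using x(1) by simp
  qed simp_all
qed

text \<open>Near the boundary H is autonomous, so H - pi |z|^2 is smooth across the axis. A smooth
  extension of H beyond the half-space chart is shown to be negative outside, so that the condition
  H - pi |z|^2 \<ge> 0 already includes membership in W.\<close>

lemma tube_chart_boundary: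
  assumes w: "w \<in> manifold_boundary M" "w \<in> carr M"
  shows "\<exists>c\<in>atlas tube_mf. (w, 0) \<in> cdom c"
proof -
  have "(0::complex) = of_real (cmod 0) * cis (2 * pi * 0)" by simp
  from tube_iff[OF this] have wz: "(w, 0) \<in> tube_dom" using H_nonneg_pos(1)[OF w(2)] w(2) by simp
  let ?d = "chart_at M w" and ?x0 = "cmap (chart_at M w) w" and ?Y = "liouville_field (M, lam) w"
  note d = chart_at[OF at_M w(2)]
  note dc = smooth_atlasD(2)[OF at_M d(1)]
  obtain b where b: "b \<in> Basis" "openin (top_of_set (half_space b)) (cimg ?d)" "?x0 \<bullet> b = 0" "?Y \<bullet> b < 0"
    using liouville_domainD(5)[OF W w(1)] unfolding outward_pointing_def by auto
  obtain U0 where U0: "open U0" "cimg ?d = half_space b \<inter> U0"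
    using b(2) unfolding openin_open by auto
  obtain U1 where U1: "openin (mspace M) U1" "manifold_boundary M \<subseteq> U1" "\<And>v s t. v \<in> U1 \<Longrightarrow> H s v = H t v"
    using H_props(3) by metis
  have wU1: "w \<in> U1" using U1(2) w(1) by (rule subsetD)
  obtain U2 where U2: "open U2" "?x0 \<in> U2" "\<And>q. q \<in> cdom ?d \<Longrightarrow> cmap ?d q \<in> U2 \<Longrightarrow> q \<in> U1"
    using chart_nhd[OF dc U1(1) wU1 d(2)] by metis
  have x0: "?x0 \<in> cimg ?d" using d(2) by (rule imageI)
  note sl = H_chart_slice[OF d(1), of 0]
  obtain T0 h where T0: "open T0" "?x0 \<in> T0" "smooth_on T0 h"
    "\<And>y. y \<in> cimg ?d \<Longrightarrow> y \<in> T0 \<Longrightarrow> h y = H 0 (cinv ?d y)"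
    using smooth_on_extend[OF sl x0] by metis
  define T1 where "T1 = T0 \<inter> U0 \<inter> U2"
  have T1: "open T1" "?x0 \<in> T1" using T0 U0 U2 x0 by (auto simp: T1_def)
  have h1: "smooth_on T1 h" by (rule smooth_on_subset[OF T0(3)]) (auto simp: T1_def)
  let ?D = "\<lambda>x. frechet_derivative h (at x)"
  have D_mdiff: "?D ?x0 = mdiff M (H 0) w"
  proof -
    have "((\<lambda>x. H 0 (cinv ?d x)) has_derivative mdiff M (H 0) w) (at ?x0 within cimg ?d)"
      using iffD1[OF rderiv_whole[OF dc d(2)]
          mderiv(1)[OF at_M smooth_atlas_euclidean H_smooth[of 0] w(2), unfolded has_mderiv_on_rderiv]]
      by simp
    from frechet_derivative_model_open[OF chart_onD(2)[OF dc] x0 this]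
      frechet_derivative_extension[OF chart_onD(2)[OF dc] T0(1,3,4) x0 T0(2)]
    show ?thesis by simp
  qed
  have face: "h x = 0" if x: "x \<in> T1" "x \<bullet> b = 0" for x
  proof -
    have xi: "x \<in> cimg ?d" using x unfolding U0(2) by (simp add: T1_def half_space_def)
    have "cinv ?d x \<in> manifold_boundary M"
      unfolding manifold_boundary_def mem_Collect_eq
      using cinv_in[OF xi] cmap_cinv[OF xi] x(2) by (intro bexI[OF _ d(1)] bexI[OF _ b(1)] conjI b(2)) simp_all
    then show ?thesis using T0(4)[OF xi] x(1) H_props(4) by (simp add: T1_def)
  qed
  \<comment> \<open>H vanishes along the face, so its differential at \<open>?x0\<close> annihilates
    all directions tangent to the face.\<close>
  have tang: "?D ?x0 v = 0" if v: "v \<bullet> b = 0" for v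
  proof (rule frechet_derivative_along_line[OF T1 h1])
    have o: "open ((\<lambda>s. ?x0 + s *\<^sub>R v) -` T1)"
      by (intro open_vimage T1(1) continuous_intros)
    show "((\<lambda>s. h (?x0 + s *\<^sub>R v)) has_real_derivative 0) (at 0)"
    proof (rule has_field_derivative_transform_within_open[OF _ o])
      show "((\<lambda>s. 0) has_real_derivative 0) (at 0)" by simp
      show "0 \<in> (\<lambda>s. ?x0 + s *\<^sub>R v) -` T1" using T1(2) by simp
      fix s assume "s \<in> (\<lambda>s. ?x0 + s *\<^sub>R v) -` T1"
      then show "0 = h (?x0 + s *\<^sub>R v)" using face[of "?x0 + s *\<^sub>R v"] b(3) v by (simp add: inner_add_left)
    qed
  qed
  have lin: "linear (?D ?x0)"
    by (rule has_derivative_linear[OF smooth_on_open_derivative(1)[OF T1(1) h1 T1(2)]])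
  \<comment> \<open>Up to a tangential vector, the Liouville field is the negative multiple (Y
    \<bullet> b) b; since dH is negative on it, dH is positive on the inward direction b.\<close>
  have Dpos: "0 < ?D ?x0 b"
  proof -
    have "(?Y - (?Y \<bullet> b) *\<^sub>R b) \<bullet> b = 0" using b(1) by (simp add: inner_diff_left)
    from tang[OF this] have "?D ?x0 ?Y = (?Y \<bullet> b) * ?D ?x0 b"
      by (simp add: linear_diff[OF lin] linear_cmul[OF lin])
    moreover have "?D ?x0 ?Y < 0" unfolding D_mdiff by (rule mdiff_H_boundary[OF w])
    ultimately show ?thesis using b(4) by (simp add: mult_less_0_iff)
  qed
  have "open (T1 \<inter> (\<lambda>x. ?D x b) -` {0<..})"
    by (rule continuous_open_preimage[OF smooth_on_imp_continuous_on[OF smooth_on_open_derivative(2)[OF T1(1) h1]] T1(1)])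
      (rule open_greaterThan)
  moreover have "?x0 \<in> T1 \<inter> (\<lambda>x. ?D x b) -` {0<..}" using T1(2) Dpos by simp
  ultimately obtain r where r: "0 < r" "ball ?x0 r \<subseteq> T1 \<inter> (\<lambda>x. ?D x b) -` {0<..}"
    by (rule openE)
  \<comment> \<open>From a point beyond the face one walks along b back to the face: h increases on
    the way and ends at 0.\<close>
  have neg: "h x < 0" if x: "x \<in> ball ?x0 r" "x \<bullet> b < 0" for x
  proof -
    define k where "k = - (x \<bullet> b)"
    have k: "0 < k" using x(2) by (simp add: k_def)
    have bb: "b \<bullet> b = 1" using b(1) by simp
    \<comment> \<open>The centre of the ball lies on the face, so the perpendicular walk towards the
      face does not increase the distance to it.\<close>
    have inb: "x + s *\<^sub>R b \<in> ball ?x0 r" if s: "0 \<le> s" "s \<le> k" for s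
    proof -
      have "(norm (x + s *\<^sub>R b - ?x0))\<^sup>2 = (norm (x - ?x0 + s *\<^sub>R b))\<^sup>2" by (simp add: algebra_simps)
      also have "\<dots> = (norm (x - ?x0))\<^sup>2 + 2 * s * ((x - ?x0) \<bullet> b) + s\<^sup>2"
        unfolding power2_norm_eq_inner
        by (simp add: inner_add_left inner_add_right bb inner_commute algebra_simps power2_eq_square)
      also have "(x - ?x0) \<bullet> b = - k" using b(3) by (simp add: k_def inner_diff_left)
      also have "(norm (x - ?x0))\<^sup>2 + 2 * s * - k + s\<^sup>2 \<le> (norm (x - ?x0))\<^sup>2"
      proof -
        have "s * s \<le> s * (2 * k)" using s k by (intro mult_left_mono) auto
        then show ?thesis by (simp add: power2_eq_square algebra_simps)
      qed
      finally have "norm (x + s *\<^sub>R b - ?x0) \<le> norm (x - ?x0)" by (rule power2_le_imp_le) simp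
      then show ?thesis using x(1) by (simp add: dist_norm norm_minus_commute)
    qed
    have der: "((\<lambda>s. h (x + s *\<^sub>R b)) has_real_derivative ?D (x + s *\<^sub>R b) b) (at s)" if "0 \<le> s" "s \<le> k" for s
      by (rule has_real_derivative_along_line[OF smooth_on_open_derivative(1)[OF T1(1) h1]])
        (use inb[OF that] r(2) in auto)
    obtain s where s: "0 < s" "s < k" "h (x + k *\<^sub>R b) - h (x + 0 *\<^sub>R b) = (k - 0) * ?D (x + s *\<^sub>R b) b"
      using MVT2[OF k der] by auto
    have "0 < ?D (x + s *\<^sub>R b) b" using inb[of s] s r(2) by auto
    then have "0 < (k - 0) * ?D (x + s *\<^sub>R b) b" using k by simp
    moreover have "h (x + k *\<^sub>R b) = 0"
    proof (rule face)
      show "x + k *\<^sub>R b \<in> T1" using inb[of k] k r(2) by auto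
      show "(x + k *\<^sub>R b) \<bullet> b = 0" by (simp add: inner_add_left inner_diff_left bb k_def)
    qed
    ultimately show ?thesis using s(3) by simp
  qed
  let ?T = "ball ?x0 r \<times> (UNIV :: complex set)"
  define f where "f = (\<lambda>y :: 'e \<times> complex. h (fst y) - pi * (cmod (snd y))\<^sup>2)"
  have T: "open ?T" "(?x0, 0) \<in> ?T" using r by (auto intro: open_Times)
  have f: "smooth_on ?T f"
    unfolding f_def
    by (rule smooth_on_diff[OF smooth_on_compose[OF smooth_on_fst[OF smooth_on_ident] h1]
          smooth_on_bounded_linear[OF bounded_linear_mult_right smooth_on_norm_square[OF smooth_on_snd[OF smooth_on_ident]]]])
      (use r(2) in auto)
  have hH: "h (cmap ?d v) = H s v" if v: "v \<in> cdom ?d" "cmap ?d v \<in> ball ?x0 r" for v s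
  proof -
    have vT: "cmap ?d v \<in> T0" "cmap ?d v \<in> U2" using r(2) v(2) by (auto simp: T1_def)
    have "h (cmap ?d v) = H 0 v" using T0(4)[OF imageI[OF v(1)] vT(1)] chart_onD(5)[OF dc v(1)] by simp
    also have "\<dots> = H s v" by (rule U1(3)[OF U2(3)[OF v(1) vT(2)]])
    finally show ?thesis .
  qed
  show ?thesis
  proof (rule tube_chartI[OF d wz T f])
    fix x \<zeta> assume xz: "(x, \<zeta>) \<in> ?T" "0 \<le> f (x, \<zeta>)"
    obtain s where s: "\<zeta> = of_real (cmod \<zeta>) * cis (2 * pi * s)" using polar_angle by blast
    have x: "x \<in> ball ?x0 r" using xz(1) by simp
    have "0 \<le> pi * (cmod \<zeta>)\<^sup>2" by simp
    also have le: "\<dots> \<le> h x" using xz(2) by (simp add: f_def)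
    finally have "\<not> x \<bullet> b < 0" using neg[OF x] by auto
    moreover have "x \<in> U0" using x r(2) by (auto simp: T1_def)
    ultimately have xi: "x \<in> cimg ?d" unfolding U0(2) by (simp add: half_space_def)
    have "h x = H s (cinv ?d x)" using hH[OF cinv_in[OF xi], of s] cmap_cinv[OF xi] x by simp
    then have "(cinv ?d x, \<zeta>) \<in> tube_dom"
      unfolding tube_iff[OF s] using subsetD[OF chart_onD(4)[OF dc] cinv_in[OF xi]] le by simp
    then show "x \<in> cimg ?d \<and> (cinv ?d x, \<zeta>) \<in> tube_dom" using xi by simp
  next
    fix v \<zeta> assume v: "v \<in> cdom ?d" "(cmap ?d v, \<zeta>) \<in> ?T" "(v, \<zeta>) \<in> tube_dom"
    obtain s where s: "\<zeta> = of_real (cmod \<zeta>) * cis (2 * pi * s)" using polar_angle by blast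
    have "h (cmap ?d v) = H s v" using v by (intro hH) auto
    then show "0 \<le> f (cmap ?d v, \<zeta>)" using v(3)[unfolded tube_iff[OF s]] by (simp add: f_def)
  next
    have "((\<lambda>s. f ((?x0, 0) + s *\<^sub>R (b, 0))) has_real_derivative ?D ?x0 b) (at 0)"
      using has_real_derivative_along_line[of h "?D ?x0" ?x0 0 b] smooth_on_open_derivative(1)[OF T1(1) h1 T1(2)]
      by (simp add: f_def)
    from frechet_derivative_along_line[OF T f this]
    have "frechet_derivative f (at (?x0, 0)) (b, 0) \<noteq> 0" using Dpos by simp
    then show "0 < f (?x0, 0) \<or> (\<exists>v. frechet_derivative f (at (?x0, 0)) v \<noteq> 0)" by blast
  qed
qed

lemma tube_chart_exists:
  assumes "p \<in> tube_dom"
  shows "\<exists>c\<in>atlas (domain_manifold (cylinder M) tube_dom). p \<in> cdom c"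
proof -
  obtain w z where p: "p = (w, z)" by (rule prod.exhaust)
  have w: "w \<in> carr M" using assms by (simp add: p tube_set_def)
  have "\<exists>c\<in>atlas tube_mf. (w, z) \<in> cdom c"
  proof (cases "z = 0")
    case True
    then show ?thesis
      using tube_chart_axis_interior[OF w] tube_chart_boundary[OF _ w] by (cases "w \<in> manifold_boundary M") simp_all
  next
    case False
    then show ?thesis using tube_chart_off_axis assms by (simp add: p)
  qed
  then show ?thesis by (simp add: p tube_manifold_def)
qed

lemmas tube_atlas = smooth_atlas_domain_manifold[OF smooth_atlas_cylinder[OF at_M] tube_set_carr tube_chart_exists,
    folded tube_manifold_def[of "(M, lam)", unfolded fst_conv]]

end

section \<open>The Liouville field of the tube\<close>

text \<open>In real coordinates this is (x dy - y dx) / 2, which exhibits smoothness at the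
  origin.\<close>

lemma angular_form_eq: "angular_form z \<zeta> = Im (\<zeta> * cnj z) / 2"
proof (cases "z = 0")
  case False
  have "\<zeta> / z = \<zeta> * cnj z / of_real ((cmod z)\<^sup>2)"
    using False by (metis complex_div_cnj of_real_power)
  then have "Im (\<zeta> / z) = Im (\<zeta> * cnj z) / (cmod z)\<^sup>2" by (simp only: Im_divide_of_real)
  then show ?thesis using False by (simp add: angular_form_def del: times_complex.sel complex_cnj)
qed (simp add: angular_form_def)

lemma bounded_linear_angular_form:
  "bounded_linear (\<lambda>\<zeta>. angular_form z \<zeta>)" "bounded_linear (\<lambda>z. angular_form z \<zeta>)"
proof -
  show "bounded_linear (\<lambda>\<zeta>. angular_form z \<zeta>)"
    unfolding angular_form_eq
    by (intro bounded_linear_compose[OF bounded_linear_divide bounded_linear_compose[OF bounded_linear_Im bounded_linear_mult_left]])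
  show "bounded_linear (\<lambda>z. angular_form z \<zeta>)"
    unfolding angular_form_eq
    by (intro bounded_linear_compose[OF bounded_linear_divide bounded_linear_compose[OF bounded_linear_Im
            bounded_linear_compose[OF bounded_linear_mult_right bounded_linear_cnj]]])
qed

lemma form_in_chart_euclidean:
  "form_in_chart euclidean_manifold \<theta> (UNIV, id) = \<theta>"
  by (intro ext) (simp add: form_in_chart_def)

lemma smooth_one_form_angular_form: "smooth_one_form euclidean_manifold angular_form"
  unfolding smooth_one_form_def
proof (intro conjI ballI allI)
  show "linear (angular_form p)" for p
    using bounded_linear_angular_form(1)[of p] by (rule bounded_linear.linear)
  fix c v assume "c \<in> atlas (euclidean_manifold :: (complex, complex) manifold)"
  then have c: "c = (UNIV, id)" by simp
  show "smooth_on (cimg c) (\<lambda>x. form_in_chart euclidean_manifold angular_form c x v)"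
    unfolding c form_in_chart_euclidean
    by (rule smooth_on_bounded_linear[OF bounded_linear_angular_form(2) smooth_on_ident])
qed

text \<open>The standard area form of the plane.\<close>

lemma ext_deriv_angular_form:
  "ext_deriv euclidean_manifold angular_form z u v = Im (v * cnj u)"
proof -
  have "frechet_derivative (\<lambda>y. angular_form y v) (at z) = (\<lambda>y. angular_form y v)" for v
    using frechet_derivative_at[OF bounded_linear_imp_has_derivative[OF bounded_linear_angular_form(2)]] by metis
  then show ?thesis
    by (simp add: ext_deriv_dform dform_def form_in_chart_euclidean) (simp add: angular_form_eq field_simps)
qed

section \<open>Tangent spaces of the tube via its two projections\<close>

context liouville_ham
begin

abbreviation "pr1 \<equiv> mderiv tube_mf M fst"
abbreviation "pr2 \<equiv> mdiff tube_mf (snd :: 'a \<times> complex \<Rightarrow> complex)"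

lemma at_tube: "smooth_atlas tube_mf" by (rule tube_atlas(1))
lemma carr_tube: "carr tube_mf = tube_dom" by (rule tube_atlas(2))

lemma tube_ident_smooth:
  "smooth_map_on tube_mf (carr tube_mf) (cylinder M) (\<lambda>p. p)"
  "smooth_map_on (cylinder M) tube_dom tube_mf (\<lambda>p. p)"
proof -
  show "smooth_map_on tube_mf (carr tube_mf) (cylinder M) (\<lambda>p. p)" unfolding carr_tube by (rule tube_atlas(3))
  show "smooth_map_on (cylinder M) tube_dom tube_mf (\<lambda>p. p)" by (rule tube_atlas(4))
qed

lemma tube_fst_smooth: "smooth_map_on tube_mf (carr tube_mf) M fst"
  by (rule smooth_map_on_compose[OF at_tube smooth_atlas_cylinder[OF at_M] tube_ident_smooth(1)
        smooth_map_on_cylinder_fst[OF at_M, of UNIV] UNIV_I])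

lemma tube_snd_smooth: "smooth_map_on tube_mf (carr tube_mf) euclidean_manifold snd"
  by (rule smooth_map_on_compose[OF at_tube smooth_atlas_cylinder[OF at_M] tube_ident_smooth(1)
        smooth_map_on_cylinder_snd[OF at_M, of UNIV] UNIV_I])

lemma fst_tube: "p \<in> tube_dom \<Longrightarrow> fst p \<in> carr M"
  by (auto simp: tube_set_def)

text \<open>The chart of the tube at \<open>p\<close> differs from the cylinder chart by a local diffeomorphism, so the
  differentials of the two projections together form a linear isomorphism; \<open>A\<close> is its inverse.\<close>

lemma tube_derivative_iso:
  assumes p: "p \<in> tube_dom"
  obtains A where "linear A" "\<And>v. A (pr1 p v, pr2 p v) = v" "\<And>y. (pr1 p (A y), pr2 p (A y)) = y"
    "rderiv (cyl (chart_at M (fst p))) tube_dom (chart_at tube_mf p) (\<lambda>p. p) p A"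
proof -
  let ?c = "chart_at tube_mf p" and ?d = "chart_at M (fst p)"
  let ?k = "cyl ?d :: ('a \<times> complex, 'e \<times> complex) chart"
  have pt: "p \<in> carr tube_mf" using p by (simp add: carr_tube)
  note c = chart_at[OF at_tube pt] and d = chart_at[OF at_M fst_tube[OF p]]
  note cc = smooth_atlasD(2)[OF at_tube c(1)] and dc = smooth_atlasD(2)[OF at_M d(1)]
  have k: "?k \<in> atlas (cylinder M)" "p \<in> cdom ?k" using d by (simp_all add: cylinder_simps mem_Times_iff)
  note kc = smooth_atlasD(2)[OF smooth_atlas_cylinder[OF at_M] k(1)]
  obtain A where A: "rderiv ?k tube_dom ?c (\<lambda>p. p) p A"
    by (rule rderiv_exists[OF kc cc tube_ident_smooth(2) k p c])
  obtain B where B: "rderiv ?c (carr tube_mf) ?k (\<lambda>p. p) p B"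
    by (rule rderiv_exists[OF cc kc tube_ident_smooth(1) c pt k])
  have "((\<lambda>x. (cmap ?d (fst (cinv ?c x)), snd (cinv ?c x))) has_derivative B)
      (at (cmap ?c p) within cmap ?c ` (cdom ?c \<inter> carr tube_mf))"
    using B unfolding rderiv_def cmap_cyl .
  from has_derivative_fst[OF this] has_derivative_snd[OF this]
  have B1: "rderiv ?c (carr tube_mf) ?d fst p (\<lambda>v. fst (B v))"
    and B2: "rderiv ?c (carr tube_mf) (UNIV, id) snd p (\<lambda>v. snd (B v))"
    unfolding rderiv_def by simp_all
  have m1: "pr1 p = (\<lambda>v. fst (B v))"
    by (rule mderiv(2)[OF at_tube at_M tube_fst_smooth pt]) (simp add: has_mderiv_on_rderiv B1)
  have m2: "pr2 p = (\<lambda>v. snd (B v))"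
    by (rule mderiv(2)[OF at_tube smooth_atlas_euclidean tube_snd_smooth pt]) (simp add: has_mderiv_on_rderiv B2)
  have Bpr: "(pr1 p v, pr2 p v) = B v" for v by (simp add: m1 m2)
  obtain U where U: "open U" "cmap ?c p \<in> U"
    "\<And>q. q \<in> cdom ?c \<Longrightarrow> q \<in> carr tube_mf \<Longrightarrow> cmap ?c q \<in> U \<Longrightarrow> q \<in> cdom ?k"
    by (rule preimage_nhd[OF cc smooth_map_onD(1)[OF tube_ident_smooth(1)] chart_onD(1)[OF kc] pt c(2) k(2)]) blast
  have AB: "rderiv ?c (carr tube_mf) ?c (\<lambda>p. p) p (\<lambda>v. A (B v))"
    by (rule rderiv_chain[OF B A chart_onD(3)[OF cc] chart_onD(3)[OF kc] c(2) pt U(1,2)])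
      (use U(3) carr_tube in auto)
  have "((\<lambda>x. cmap ?c (cinv ?c x)) has_derivative (\<lambda>v. v)) (at (cmap ?c p) within cimg ?c)"
    by (rule has_derivative_transform[OF imageI[OF c(2)] cmap_cinv has_derivative_ident])
  then have "rderiv ?c (carr tube_mf) ?c (\<lambda>p. p) p (\<lambda>v. v)"
    by (rule iffD2[OF rderiv_whole[OF cc c(2)]])
  from rderiv_unique[OF cc c(2) AB this] have ABv: "A (B v) = v" for v by meson
  \<comment> \<open>Uniqueness of derivatives in the tube chart identifies one composite, A o B,
    with the identity; the other follows because both spaces have the same finite dimension.\<close>
  have "surj B"
    by (rule linear_injective_imp_surjective[OF rderiv_linear[OF B]]) (metis ABv injI, rule refl)
  then have BA: "B (A y) = y" for y using ABv by (metis surjD)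
  show thesis
    by (rule that[OF rderiv_linear[OF A] _ _ A]) (simp_all only: Bpr ABv BA)
qed

text \<open>A candidate derivative into the tube can be checked on its two projections: together
  they give the derivative into the cylinder chart, and the inverse isomorphism carries this to the
  preferred tube chart.\<close>

lemma has_mderiv_on_tube_lift:
  assumes X: "smooth_atlas X" and f: "continuous_map (subtopology (mspace X) D) (mspace tube_mf) f"
    and q: "q \<in> D" "q \<in> carr X" and fq: "f q \<in> tube_dom"
    and L1: "has_mderiv_on X D M (\<lambda>x. fst (f x)) q (\<lambda>v. pr1 (f q) (L v))"
    and L2: "has_mderiv_on X D euclidean_manifold (\<lambda>x. snd (f x)) q (\<lambda>v. pr2 (f q) (L v))"
  shows "has_mderiv_on X D tube_mf f q L"
proof -
  let ?c = "chart_at tube_mf (f q)" and ?d = "chart_at M (fst (f q))" and ?x = "chart_at X q"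
  let ?k = "cyl ?d :: ('a \<times> complex, 'e \<times> complex) chart"
  obtain A where A: "\<And>v. A (pr1 (f q) v, pr2 (f q) v) = v" "rderiv ?k tube_dom ?c (\<lambda>p. p) (f q) A"
    using tube_derivative_iso[OF fq] by metis
  note x = chart_at[OF X q(2)] and d = chart_at[OF at_M fst_tube[OF fq]]
  note xc = smooth_atlasD(2)[OF X x(1)]
  have k: "?k \<in> atlas (cylinder M)" "f q \<in> cdom ?k" using d by (simp_all add: cylinder_simps mem_Times_iff)
  note kc = smooth_atlasD(2)[OF smooth_atlas_cylinder[OF at_M] k(1)]
  have K: "rderiv ?x D ?k f q (\<lambda>v. (pr1 (f q) (L v), pr2 (f q) (L v)))"
    unfolding rderiv_def cmap_cyl
    by (rule has_derivative_Pair) (use L1 L2 in \<open>simp_all add: has_mderiv_on_rderiv rderiv_def\<close>)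
  have op: "openin (mspace tube_mf) (cdom ?k \<inter> tube_dom)"
    unfolding tube_manifold_def domain_manifold_simps fst_conv
    using chart_onD(1)[OF kc] by (rule openin_subtopology_Int)
  have "f q \<in> cdom ?k \<inter> tube_dom" using k(2) fq by simp
  then obtain U where U: "open U" "cmap ?x q \<in> U"
    "\<And>r. r \<in> cdom ?x \<Longrightarrow> r \<in> D \<Longrightarrow> cmap ?x r \<in> U \<Longrightarrow> f r \<in> cdom ?k \<inter> tube_dom"
    by (rule preimage_nhd[OF xc f op q(1) x(2)]) blast
  have "rderiv ?x D ?c f q (\<lambda>v. A (pr1 (f q) (L v), pr2 (f q) (L v)))"
    by (rule rderiv_chain[OF K A(2) chart_onD(3)[OF xc] chart_onD(3)[OF kc] x(2) q(1) U(1,2)])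
      (use U(3) in auto)
  then show ?thesis unfolding has_mderiv_on_rderiv A(1) .
qed

lemma tube_form_pullback:
  "tube_form (M, lam) H = (\<lambda>p v. pullback_form tube_mf M fst lam p v + pullback_form tube_mf euclidean_manifold snd angular_form p v)"
  by (intro ext) (simp add: tube_form_def pullback_form_def)

lemma tube_form_eq: "tube_form (M, lam) H p v = lam (fst p) (pr1 p v) + angular_form (snd p) (pr2 p v)"
  by (simp add: tube_form_def)

text \<open>Naturality of d on each of the two pulled-back summands: the result is d\<lambda> plus
  the area form.\<close>

lemma ext_deriv_tube:
  assumes p: "p \<in> tube_dom"
  shows "ext_deriv tube_mf (tube_form (M, lam) H) p u v
    = ext_deriv M lam (fst p) (pr1 p u) (pr1 p v) + Im (pr2 p v * cnj (pr2 p u))"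
proof -
  have pt: "p \<in> carr tube_mf" using p by (simp add: carr_tube)
  note e1 = ext_deriv_pullback[OF at_tube at_M tube_fst_smooth liouville_domainD(3)[OF W] pt]
  note e2 = ext_deriv_pullback[OF at_tube smooth_atlas_euclidean tube_snd_smooth smooth_one_form_angular_form pt]
  show ?thesis
    unfolding tube_form_pullback ext_deriv_add[OF at_tube pt e1(2) e2(2)] e1(1) e2(1) ext_deriv_angular_form ..
qed

text \<open>The two summands decouple: Y solves the defining equation on W, and z/2 is the Liouville
  field of the area form.\<close>

lemma tube_liouville_field:
  assumes p: "p \<in> tube_dom"
  shows "pr1 p (liouville_field (tube (M, lam) H) p) = liouville_field (M, lam) (fst p)"
    and "pr2 p (liouville_field (tube (M, lam) H) p) = snd p / 2"
proof -
  obtain A where A: "linear A" "\<And>v. A (pr1 p v, pr2 p v) = v" "\<And>y. (pr1 p (A y), pr2 p (A y)) = y"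
    using tube_derivative_iso[OF p] by metis
  note w = fst_tube[OF p]
  let ?Y = "liouville_field (M, lam) (fst p)"
  define Z where "Z = A (?Y, snd p / 2)"
  have Z: "pr1 p Z = ?Y" "pr2 p Z = snd p / 2" using A(3)[of "(?Y, snd p / 2)"] by (simp_all add: Z_def)
  have Zsol: "ext_deriv tube_mf (tube_form (M, lam) H) p Z u = tube_form (M, lam) H p u" for u
    unfolding ext_deriv_tube[OF p] tube_form_eq Z liouville_field(1)[OF W w] angular_form_eq
    by (simp add: field_simps)
  have lin: "linear (ext_deriv M lam (fst p) v)" for v
    by (rule ext_deriv_linear(2)[OF at_M liouville_domainD(3)[OF W] w])
  have lam: "linear (lam (fst p))" using liouville_domainD(3)[OF W] w by (simp add: smooth_one_form_def)
  have uniq: "V = Z" if V: "\<forall>u. ext_deriv tube_mf (tube_form (M, lam) H) p V u = tube_form (M, lam) H p u" for V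
  proof -
    \<comment> \<open>Vectors with prescribed projections (a, b) exist, so a solution can be tested
      on W and on the plane separately.\<close>
    have eq: "ext_deriv M lam (fst p) (pr1 p V) a + Im (b * cnj (pr2 p V))
        = lam (fst p) a + Im (b * cnj (snd p)) / 2" for a b
    proof -
      have "pr1 p (A (a, b)) = a" "pr2 p (A (a, b)) = b" using A(3)[of "(a, b)"] by simp_all
      then show ?thesis
        using V[rule_format, of "A (a, b)"] unfolding ext_deriv_tube[OF p] tube_form_eq angular_form_eq by simp
    qed
    have "pr1 p V = ?Y"
      by (rule liouville_field(2)[OF W w, symmetric]) (use eq[of _ 0] in simp)
    moreover have "pr2 p V = snd p / 2"
    \<comment> \<open>The test vectors 1 and \<i> of the plane read off the imaginary and the real
      part.\<close>
    proof (rule complex_eqI)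
      show "Im (pr2 p V) = Im (snd p / 2)" using eq[of 0 1] linear_0[OF lin] linear_0[OF lam] by simp
      show "Re (pr2 p V) = Re (snd p / 2)" using eq[of 0 \<i>] linear_0[OF lin] linear_0[OF lam] by simp
    qed
    ultimately have "(pr1 p V, pr2 p V) = (pr1 p Z, pr2 p Z)" unfolding Z by (rule arg_cong2)
    then have "A (pr1 p V, pr2 p V) = A (pr1 p Z, pr2 p Z)" by (rule arg_cong)
    then show ?thesis unfolding A(2) .
  qed
  have "liouville_field (tube (M, lam) H) p = Z"
    unfolding liouville_field_def tube_def fst_conv snd_conv
    by (rule the_equality) (use Zsol uniq in auto)
  with Z show "pr1 p (liouville_field (tube (M, lam) H) p) = ?Y"
    "pr2 p (liouville_field (tube (M, lam) H) p) = snd p / 2" by simp_all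
qed

end

section \<open>Symplectomorphisms and integral curves\<close>

lemma mderiv_left_inverse:
  assumes M: "smooth_atlas M" and N: "smooth_atlas N" and f: "smooth_map_on M (carr M) N f"
    and g: "smooth_map_on N (carr N) M g" and gf: "\<And>q. q \<in> carr M \<Longrightarrow> g (f q) = q" and p: "p \<in> carr M"
  shows "mderiv N M g (f p) (mderiv M N f p v) = v"
proof -
  let ?c = "chart_at M p"
  note c = chart_at[OF M p]
  note cc = smooth_atlasD(2)[OF M c(1)]
  have "has_mderiv_on M (carr M) M (\<lambda>q. g (f q)) p (\<lambda>v. mderiv N M g (f p) (mderiv M N f p v))"
    by (rule has_mderiv_on_chain[OF M N smooth_map_onD(1)[OF f] mderiv(1)[OF M N f p]
          mderiv(1)[OF N M g smooth_map_in[OF f p]] p p])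
  then have "rderiv ?c (carr M) ?c (\<lambda>q. g (f q)) p (\<lambda>v. mderiv N M g (f p) (mderiv M N f p v))"
    unfolding has_mderiv_on_rderiv gf[OF p] .
  then have 1: "rderiv ?c (carr M) ?c (\<lambda>q. q) p (\<lambda>v. mderiv N M g (f p) (mderiv M N f p v))"
    by (rule rderiv_cong[OF _ chart_onD(3)[OF cc] c(2) p]) (rule gf)
  have "((\<lambda>x. cmap ?c (cinv ?c x)) has_derivative (\<lambda>v. v)) (at (cmap ?c p) within cimg ?c)"
    by (rule has_derivative_transform[OF imageI[OF c(2)] cmap_cinv has_derivative_ident])
  then have "rderiv ?c (carr M) ?c (\<lambda>q. q) p (\<lambda>v. v)"
    by (rule iffD2[OF rderiv_whole[OF cc c(2)]])
  from rderiv_unique[OF cc c(2) 1 this] show ?thesis by meson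
qed

lemma ext_deriv_cong:
  assumes M: "smooth_atlas M" and eq: "\<And>q v. q \<in> carr M \<Longrightarrow> \<theta> q v = \<eta> q v" and p: "p \<in> carr M"
  shows "ext_deriv M \<theta> p u v = ext_deriv M \<eta> p u v"
proof -
  let ?c = "chart_at M p"
  note c = chart_at[OF M p]
  note cc = smooth_atlasD(2)[OF M c(1)]
  show ?thesis
    unfolding ext_deriv_dform
  proof (rule dform_cong[OF _ imageI[OF c(2)]])
    fix y v assume "y \<in> cimg ?c"
    then have "cinv ?c y \<in> carr M" by (rule subsetD[OF chart_onD(4)[OF cc] cinv_in])
    then show "form_in_chart M \<theta> ?c y v = form_in_chart M \<eta> ?c y v"
      unfolding form_in_chart_def by (rule eq)
  qed
qed

lemma SympD:
  assumes "\<phi> \<in> Symp (M, lam)"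
  shows "bij_betw \<phi> (carr M) (carr M)" "smooth_map_on M (carr M) M \<phi>"
    "smooth_map_on M (carr M) M (inv_into (carr M) \<phi>)"
    "p \<in> carr M \<Longrightarrow> lam (\<phi> p) (mderiv M M \<phi> p v) = lam p v"
    "p \<in> carr M \<Longrightarrow> inv_into (carr M) \<phi> (\<phi> p) = p" "p \<in> carr M \<Longrightarrow> \<phi> (inv_into (carr M) \<phi> p) = p"
    "p \<in> carr M \<Longrightarrow> \<phi> p \<in> carr M" "p \<in> carr M \<Longrightarrow> inv_into (carr M) \<phi> p \<in> carr M"
proof -
  note A = assms[unfolded Symp_def mem_Collect_eq fst_conv snd_conv]
  show b: "bij_betw \<phi> (carr M) (carr M)" "smooth_map_on M (carr M) M \<phi>"
    "smooth_map_on M (carr M) M (inv_into (carr M) \<phi>)" using A by simp_all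
  show "p \<in> carr M \<Longrightarrow> lam (\<phi> p) (mderiv M M \<phi> p v) = lam p v" using A by simp
  show "p \<in> carr M \<Longrightarrow> inv_into (carr M) \<phi> (\<phi> p) = p" by (rule bij_betw_inv_into_left[OF b(1)])
  show "p \<in> carr M \<Longrightarrow> \<phi> (inv_into (carr M) \<phi> p) = p" by (rule bij_betw_inv_into_right[OF b(1)])
  show "p \<in> carr M \<Longrightarrow> \<phi> p \<in> carr M" by (rule bij_betwE[OF b(1), rule_format])
  show "p \<in> carr M \<Longrightarrow> inv_into (carr M) \<phi> p \<in> carr M"
    by (rule bij_betwE[OF bij_betw_inv_into[OF b(1)], rule_format])
qed

lemma Symp_inv_into:
  assumes M: "smooth_atlas M" and \<phi>: "\<phi> \<in> Symp (M, lam)"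
  shows "inv_into (carr M) \<phi> \<in> Symp (M, lam)"
proof -
  let ?\<psi> = "inv_into (carr M) \<phi>"
  note s = SympD[OF \<phi>]
  \<comment> \<open>Inverting twice returns \<phi> on the carrier only, hence the passage through
    \<open>smooth_map_on_cong\<close>.\<close>
  have "smooth_map_on M (carr M) M (inv_into (carr M) ?\<psi>)"
    by (rule smooth_map_on_cong[OF M s(2)]) (rule inv_into_inv_into_eq[OF s(1), symmetric])
  moreover have "lam (?\<psi> p) (mderiv M M ?\<psi> p v) = lam p v" if p: "p \<in> carr M" for p v
  proof -
    have "mderiv M M \<phi> (?\<psi> p) (mderiv M M ?\<psi> p v) = v"
      by (rule mderiv_left_inverse[OF M M s(3,2,6) p])
    then show ?thesis using s(4)[OF s(8)[OF p], of "mderiv M M ?\<psi> p v"] s(6)[OF p] by simp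
  qed
  ultimately show ?thesis
    unfolding Symp_def using bij_betw_inv_into[OF s(1)] s(3) by simp
qed

text \<open>Preserving \<lambda> implies preserving d\<lambda> by naturality, and these two
  determine the Liouville field.\<close>

lemma Symp_liouville_field:
  assumes W: "liouville_domain (M, lam)" and \<phi>: "\<phi> \<in> Symp (M, lam)" and p: "p \<in> carr M"
  shows "mderiv M M \<phi> p (liouville_field (M, lam) p) = liouville_field (M, lam) (\<phi> p)"
proof -
  note M = liouville_domainD(1)[OF W]
  note s = SympD[OF \<phi>]
  let ?Y = "liouville_field (M, lam) p" and ?\<psi> = "inv_into (carr M) \<phi>"
  have "ext_deriv M lam (\<phi> p) (mderiv M M \<phi> p ?Y) u = lam (\<phi> p) u" for u
  proof -
    \<comment> \<open>Every tangent vector at \<phi> p is the image of a vector at p, obtained with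
      the differential of the inverse.\<close>
    define u' where "u' = mderiv M M ?\<psi> (\<phi> p) u"
    have u: "u = mderiv M M \<phi> p u'"
      using mderiv_left_inverse[OF M M s(3,2,6) s(7)[OF p], of u] s(5)[OF p] by (simp add: u'_def)
    have "ext_deriv M lam (\<phi> p) (mderiv M M \<phi> p ?Y) u = ext_deriv M (pullback_form M M \<phi> lam) p ?Y u'"
      unfolding u by (rule ext_deriv_pullback(1)[OF M M s(2) liouville_domainD(3)[OF W] p, symmetric])
    also have "\<dots> = ext_deriv M lam p ?Y u'"
      by (rule ext_deriv_cong[OF M _ p]) (simp add: pullback_form_def s(4))
    also have "\<dots> = lam p u'" by (rule liouville_field(1)[OF W p])
    finally show ?thesis using s(4)[OF p, of u'] u by simp
  qed
  then show ?thesis by (rule liouville_field(2)[OF W s(7)[OF p], symmetric])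
qed

section \<open>Integral curves under smooth maps and time shifts\<close>

lemma integral_curve_on_iff:
  "integral_curve_on X Y I \<gamma> \<longleftrightarrow> continuous_map (top_of_set I) (mspace X) \<gamma> \<and>
    (\<forall>t\<in>I. has_mderiv_on euclidean_manifold I X \<gamma> t (\<lambda>s. s *\<^sub>R Y (\<gamma> t)))"
  by (simp add: integral_curve_on_def has_mderiv_on_rderiv rderiv_def has_vector_derivative_def)

lemma integral_curve_in:
  assumes "integral_curve_on X Y I \<gamma>" "t \<in> I" shows "\<gamma> t \<in> carr X"
  using assms unfolding integral_curve_on_def continuous_map_def by (auto simp: Pi_iff)

lemma has_mderiv_on_curve_chain:
  assumes X: "smooth_atlas X" and N: "smooth_atlas N" and \<gamma>: "integral_curve_on X Y I \<gamma>" and t: "t \<in> I"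
    and f: "smooth_map_on X (carr X) N f"
  shows "has_mderiv_on euclidean_manifold I N (\<lambda>s. f (\<gamma> s)) t (\<lambda>s. s *\<^sub>R mderiv X N f (\<gamma> t) (Y (\<gamma> t)))"
proof -
  note g = \<gamma>[unfolded integral_curve_on_iff]
  have 1: "continuous_map (subtopology (mspace euclidean_manifold) I) (mspace X) \<gamma>" using g by simp
  have 2: "has_mderiv_on euclidean_manifold I X \<gamma> t (\<lambda>s. s *\<^sub>R Y (\<gamma> t))" using g t by simp
  note p = integral_curve_in[OF \<gamma> t]
  have "has_mderiv_on euclidean_manifold I N (\<lambda>s. f (\<gamma> s)) t (\<lambda>s. mderiv X N f (\<gamma> t) (s *\<^sub>R Y (\<gamma> t)))"
    by (rule has_mderiv_on_chain[OF smooth_atlas_euclidean X 1 2 mderiv(1)[OF X N f p] t]) simp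
  then show ?thesis unfolding linear_cmul[OF mderiv(3)[OF X N f p]] .
qed

lemma integral_curve_map:
  assumes X: "smooth_atlas X" and N: "smooth_atlas N" and \<gamma>: "integral_curve_on X Y I \<gamma>"
    and f: "smooth_map_on X (carr X) N f"
    and Z: "\<And>t. t \<in> I \<Longrightarrow> mderiv X N f (\<gamma> t) (Y (\<gamma> t)) = Z (f (\<gamma> t))"
  shows "integral_curve_on N Z I (\<lambda>s. f (\<gamma> s))"
  unfolding integral_curve_on_iff
proof (intro conjI ballI)
  have "continuous_map (top_of_set I) (mspace X) \<gamma>" using \<gamma> unfolding integral_curve_on_def by simp
  moreover have "continuous_map (mspace X) (mspace N) f" using smooth_map_onD(1)[OF f] by simp
  ultimately have "continuous_map (top_of_set I) (mspace N) (f \<circ> \<gamma>)" by (rule continuous_map_compose)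
  then show "continuous_map (top_of_set I) (mspace N) (\<lambda>s. f (\<gamma> s))" by (simp add: comp_def)
  show "has_mderiv_on euclidean_manifold I N (\<lambda>s. f (\<gamma> s)) t (\<lambda>s. s *\<^sub>R Z (f (\<gamma> t)))" if "t \<in> I" for t
    using has_mderiv_on_curve_chain[OF X N \<gamma> that f] unfolding Z[OF that] .
qed

lemma has_derivative_shift:
  fixes f :: "real \<Rightarrow> 'b::real_normed_vector"
  assumes "(f has_derivative L) (at (t + c) within I)" "\<And>s. s \<in> J \<Longrightarrow> s + c \<in> I"
  shows "((\<lambda>s. f (s + c)) has_derivative L) (at t within J)"
proof -
  have "((\<lambda>s. s + c) has_derivative (\<lambda>x. x)) (at t within J)" by (auto intro!: derivative_eq_intros)
  moreover have "(f has_derivative L) (at (t + c) within (\<lambda>s. s + c) ` J)"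
    by (rule has_derivative_subset[OF assms(1)]) (use assms(2) in auto)
  ultimately show ?thesis by (rule has_derivative_in_compose)
qed

lemma integral_curve_shift:
  assumes \<gamma>: "integral_curve_on X Y I \<gamma>" and J: "\<And>s. s \<in> J \<Longrightarrow> s + c \<in> I"
  shows "integral_curve_on X Y J (\<lambda>s. \<gamma> (s + c))"
  unfolding integral_curve_on_def
proof (intro conjI ballI)
  have "continuous_map (top_of_set I) (mspace X) \<gamma>" using \<gamma> unfolding integral_curve_on_def by simp
  moreover have "continuous_map (top_of_set J) (top_of_set I) (\<lambda>s. s + c)"
    using J by (auto intro!: continuous_map_into_subtopology continuous_intros)
  ultimately have "continuous_map (top_of_set J) (mspace X) (\<gamma> \<circ> (\<lambda>s. s + c))"
    by (rule continuous_map_compose[rotated])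
  then show "continuous_map (top_of_set J) (mspace X) (\<lambda>s. \<gamma> (s + c))" by (simp add: comp_def)
  fix t assume t: "t \<in> J"
  have "((\<lambda>s. cmap (chart_at X (\<gamma> (t + c))) (\<gamma> s)) has_derivative (\<lambda>s. s *\<^sub>R Y (\<gamma> (t + c)))) (at (t + c) within I)"
    using \<gamma> J[OF t] unfolding integral_curve_on_def has_vector_derivative_def by simp
  from has_derivative_shift[OF this J]
  show "((\<lambda>s. cmap (chart_at X (\<gamma> (t + c))) (\<gamma> (s + c))) has_vector_derivative Y (\<gamma> (t + c))) (at t within J)"
    unfolding has_vector_derivative_def .
qed

text \<open>The integrating factor exp (- t / 2) makes the curve constant. Neither of s and t has to
  come first, so the formula can be read backwards from time 0.\<close>

lemma exponential_curve:
  fixes \<zeta> :: "real \<Rightarrow> complex"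
  assumes \<zeta>: "\<And>t. t \<in> {a..b} \<Longrightarrow> (\<zeta> has_vector_derivative \<zeta> t / 2) (at t within {a..b})"
    and st: "s \<in> {a..b}" "t \<in> {a..b}"
  shows "\<zeta> t = exp ((t - s) / 2) *\<^sub>R \<zeta> s"
proof -
  let ?g = "\<lambda>t. exp (- t / 2) *\<^sub>R \<zeta> t"
  have "(?g has_derivative (\<lambda>h. 0)) (at u within {a..b})" if "u \<in> {a..b}" for u
  proof -
    have "((\<lambda>t. exp (- t / 2)) has_derivative (\<lambda>h. exp (- u / 2) * (- h / 2))) (at u within {a..b})"
      by (auto intro!: derivative_eq_intros)
    from has_derivative_scaleR[OF this \<zeta>[OF that, unfolded has_vector_derivative_def]]
    show ?thesis by (simp add: scaleR_conv_of_real algebra_simps)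
  qed
  from has_derivative_zero_unique[OF convex_closed_interval(1)[of a b, unfolded cbox_interval] this st]
  have "exp (- s / 2) *\<^sub>R \<zeta> s = exp (- t / 2) *\<^sub>R \<zeta> t" .
  then have "exp (t / 2) *\<^sub>R exp (- s / 2) *\<^sub>R \<zeta> s = exp (t / 2) *\<^sub>R exp (- t / 2) *\<^sub>R \<zeta> t" by simp
  then have "exp (t / 2 + - s / 2) *\<^sub>R \<zeta> s = exp (t / 2 + - t / 2) *\<^sub>R \<zeta> t"
    by (simp only: scaleR_scaleR exp_add)
  then show ?thesis by (simp add: diff_divide_distrib)
qed

locale liouville_ham_plus = liouville_ham +
  assumes Ham_plus: "H \<in> Ham_plus (M, lam)"
begin

text \<open>Mean value theorem along the curve. The Hamiltonian time \<open>u\<close> stays frozen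
  while the Liouville time runs.\<close>

lemma H_nonincreasing:
  assumes \<gamma>: "integral_curve_on M (liouville_field (M, lam)) {a..b} \<gamma>"
    and st: "a \<le> s" "s \<le> t" "t \<le> b"
  shows "H u (\<gamma> t) \<le> H u (\<gamma> s)"
proof -
  let ?D = "\<lambda>r. mdiff M (H u) (\<gamma> r) (liouville_field (M, lam) (\<gamma> r))"
  have D: "?D r \<le> 0" if "r \<in> {a..b}" for r
  proof -
    note p = integral_curve_in[OF \<gamma> that]
    have "0 \<le> lam (\<gamma> r) (hamiltonian_field (M, lam) (H u) (\<gamma> r))"
      using Ham_plus p by (simp add: Ham_plus_def)
    then show ?thesis using mdiff_liouville_field[OF W p H_smooth, of u] by simp
  qed
  have "((\<lambda>r. H u (\<gamma> r)) has_derivative (\<lambda>h. h * ?D r)) (at r within {s..t})" if "s \<le> r" "r \<le> t" for r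
  proof -
    have "r \<in> {a..b}" using that st by simp
    from has_mderiv_on_curve_chain[OF at_M smooth_atlas_euclidean \<gamma> this H_smooth, of u]
    have "((\<lambda>r. H u (\<gamma> r)) has_derivative (\<lambda>h. h * ?D r)) (at r within {a..b})"
      by (simp add: has_mderiv_on_rderiv rderiv_def)
    then show ?thesis by (rule has_derivative_subset) (use st in auto)
  qed
  from mvt_very_simple[OF st(2) this] obtain r where r: "r \<in> {s..t}" "H u (\<gamma> t) - H u (\<gamma> s) = (t - s) * ?D r"
    by blast
  have "(t - s) * ?D r \<le> 0" using D[of r] r(1) st by (intro mult_nonneg_nonpos) auto
  then show ?thesis using r(2) by simp
qed

end

context liouville_ham
begin

lemma tube_curve_fst:
  assumes "integral_curve_on tube_mf (liouville_field (tube (M, lam) H)) I \<gamma>"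
  shows "integral_curve_on M (liouville_field (M, lam)) I (\<lambda>s. fst (\<gamma> s))"
proof (rule integral_curve_map[OF at_tube at_M assms tube_fst_smooth])
  fix t assume "t \<in> I"
  then have "\<gamma> t \<in> tube_dom" using integral_curve_in[OF assms] by (simp add: carr_tube)
  then show "pr1 (\<gamma> t) (liouville_field (tube (M, lam) H) (\<gamma> t)) = liouville_field (M, lam) (fst (\<gamma> t))"
    by (rule tube_liouville_field(1))
qed

lemma tube_curve_snd:
  assumes "integral_curve_on tube_mf (liouville_field (tube (M, lam) H)) I \<gamma>" and t: "t \<in> I"
  shows "((\<lambda>s. snd (\<gamma> s)) has_vector_derivative snd (\<gamma> t) / 2) (at t within I)"
proof -
  have "\<gamma> t \<in> tube_dom" using integral_curve_in[OF assms] by (simp add: carr_tube)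
  then show ?thesis
    using has_mderiv_on_curve_chain[OF at_tube smooth_atlas_euclidean assms tube_snd_smooth]
    by (simp add: tube_liouville_field(2) has_mderiv_on_rderiv rderiv_def has_vector_derivative_def)
qed

text \<open>Converse to projecting: component curves solving the two separate equations form a flow
  line of the tube as long as the pair stays in it.\<close>

lemma tube_curveI:
  assumes dom: "\<And>t. t \<in> I \<Longrightarrow> (\<gamma> t, \<zeta> t) \<in> tube_dom"
    and \<gamma>: "integral_curve_on M (liouville_field (M, lam)) I \<gamma>"
    and \<zeta>: "\<And>t. t \<in> I \<Longrightarrow> (\<zeta> has_vector_derivative \<zeta> t / 2) (at t within I)"
  shows "integral_curve_on tube_mf (liouville_field (tube (M, lam) H)) I (\<lambda>t. (\<gamma> t, \<zeta> t))"
  unfolding integral_curve_on_iff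
proof (intro conjI ballI)
  have "continuous_map (top_of_set I) (mspace M) \<gamma>" using \<gamma> unfolding integral_curve_on_def by simp
  moreover have "continuous_on I \<zeta>"
    using \<zeta> has_vector_derivative_continuous continuous_on_eq_continuous_within by blast
  ultimately have "continuous_map (top_of_set I) (prod_topology (mspace M) euclidean) (\<lambda>t. (\<gamma> t, \<zeta> t))"
    by (simp add: continuous_map_pairwise comp_def)
  then show c: "continuous_map (top_of_set I) (mspace tube_mf) (\<lambda>t. (\<gamma> t, \<zeta> t))"
    unfolding tube_manifold_def domain_manifold_simps fst_conv cylinder_simps
    by (rule continuous_map_into_subtopology) (use dom in auto)
  fix t assume t: "t \<in> I"
  let ?p = "(\<gamma> t, \<zeta> t)" and ?L = "\<lambda>s. s *\<^sub>R liouville_field (tube (M, lam) H) (\<gamma> t, \<zeta> t)"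
  note p = dom[OF t]
  have pt: "?p \<in> carr tube_mf" using p by (simp add: carr_tube)
  have c': "continuous_map (subtopology (mspace euclidean_manifold) I) (mspace tube_mf) (\<lambda>t. (\<gamma> t, \<zeta> t))"
    using c by simp
  have l1: "(\<lambda>s. pr1 ?p (?L s)) = (\<lambda>s. s *\<^sub>R liouville_field (M, lam) (\<gamma> t))"
    using linear_cmul[OF mderiv(3)[OF at_tube at_M tube_fst_smooth pt]] tube_liouville_field(1)[OF p] by simp
  have l2: "(\<lambda>s. pr2 ?p (?L s)) = (\<lambda>s. s *\<^sub>R (\<zeta> t / 2))"
    unfolding linear_cmul[OF mderiv(3)[OF at_tube smooth_atlas_euclidean tube_snd_smooth pt]] tube_liouville_field(2)[OF p] snd_conv ..
  show "has_mderiv_on euclidean_manifold I tube_mf (\<lambda>t. (\<gamma> t, \<zeta> t)) t ?L"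
  proof (rule has_mderiv_on_tube_lift[OF smooth_atlas_euclidean c' t _ p])
    show "has_mderiv_on euclidean_manifold I M (\<lambda>x. fst (\<gamma> x, \<zeta> x)) t (\<lambda>v. pr1 ?p (?L v))"
      unfolding l1 fst_conv using \<gamma> t unfolding integral_curve_on_iff by simp
    show "has_mderiv_on euclidean_manifold I euclidean_manifold (\<lambda>x. snd (\<gamma> x, \<zeta> x)) t (\<lambda>v. pr2 ?p (?L v))"
      unfolding l2 snd_conv using \<zeta>[OF t] by (simp add: has_mderiv_on_rderiv rderiv_def has_vector_derivative_def)
  qed simp
qed

end

section \<open>The embedding\<close>

lemma has_mderiv_on_mono: "has_mderiv_on M D N f p L \<Longrightarrow> D' \<subseteq> D \<Longrightarrow> has_mderiv_on M D' N f p L"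
  unfolding has_mderiv_on_rderiv by (rule rderiv_mono)

lemma smooth_map_on_const: "smooth_map_on M D euclidean_manifold (\<lambda>p. k)"
  by (rule smooth_map_onI) (simp_all add: smooth_on_const)

locale tube_pair =
  fixes M :: "('a, 'e::euclidean_space) manifold" and lam H G \<phi> and C :: real
  assumes W: "liouville_domain (M, lam)" and H: "H \<in> Ham_plus (M, lam)" and G: "G \<in> Ham_plus (M, lam)"
    and \<phi>: "\<phi> \<in> Symp (M, lam)" and C: "1 \<le> C"
    and bounds: "\<And>t w. w \<in> carr M \<Longrightarrow> (1 / C) * H t w \<le> G t (\<phi> w)"
      "\<And>t w. w \<in> carr M \<Longrightarrow> G t (\<phi> w) \<le> C * H t w"
begin

sublocale HH: liouville_ham_plus M lam H
  using W H by unfold_locales (simp_all add: Ham_plus_def)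

sublocale GG: liouville_ham_plus M lam G
  using W G by unfold_locales (simp_all add: Ham_plus_def)

definition \<psi> where "\<psi> = inv_into (carr M) \<phi>"

lemmas at_M = HH.at_M
lemmas \<phi>_props = SympD[OF \<phi>, folded \<psi>_def]

lemma \<psi>_Symp: "\<psi> \<in> Symp (M, lam)"
  unfolding \<psi>_def by (rule Symp_inv_into[OF at_M \<phi>])

definition i where "i p = (\<phi> (fst p), snd p :: complex)"

lemma fst_i: "fst (i p) = \<phi> (fst p)" and snd_i: "snd (i p) = snd p"
  by (simp_all add: i_def)

lemma H_le_G: "w \<in> carr M \<Longrightarrow> H t w / C \<le> G t (\<phi> w)"
  using bounds(1)[of w t] by simp

lemma exp_curve_norm:
  assumes "z = exp (r / 2) *\<^sub>R z0"
  shows "(cmod z)\<^sup>2 = exp r * (cmod z0)\<^sup>2"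
proof -
  have "(exp (r / 2))\<^sup>2 = exp r" by (simp add: power2_eq_square flip: exp_add)
  then show ?thesis using assms by (simp add: power_mult_distrib)
qed

text \<open>The flow rescales z by a positive factor, so a single angle tests tube membership along
  a whole flow line.\<close>

lemma exp_curve_polar:
  assumes z: "z = exp r *\<^sub>R z0" and s: "z0 = of_real (cmod z0) * cis (2 * pi * s)"
  shows "z = of_real (cmod z) * cis (2 * pi * s)"
proof -
  have "z = of_real (exp r) * (of_real (cmod z0) * cis (2 * pi * s))"
    using s unfolding z scaleR_conv_of_real by simp
  moreover have "cmod z = exp r * cmod z0" by (simp add: z)
  ultimately show ?thesis by simp
qed

section \<open>Rescaled tubes and the two inclusions\<close>

lemma scaledE:
  assumes "p \<in> scaled a (tube (M, lam) F)" "0 < a" "a \<le> 1"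
  obtains \<gamma> where "integral_curve_on (tube_manifold (M, lam) F) (liouville_field (tube (M, lam) F)) {ln a..0} \<gamma>"
    "\<gamma> (ln a) = p"
proof -
  have "ln a \<le> 0" using assms(2,3) by simp
  then have "closed_segment 0 (ln a) = {ln a..0}" by (simp add: closed_segment_eq_real_ivl)
  then show thesis using assms(1) that by (auto simp: scaled_def liouville_flow_def tube_def)
qed

lemma scaledI:
  assumes "integral_curve_on (tube_manifold (M, lam) F) (liouville_field (tube (M, lam) F)) {ln a..0} \<gamma>"
    "0 < a" "a \<le> 1"
  shows "\<gamma> (ln a) \<in> scaled a (tube (M, lam) F)"
proof -
  have "ln a \<le> 0" using assms(2,3) by simp
  then have seg: "closed_segment 0 (ln a) = {ln a..0}" by (simp add: closed_segment_eq_real_ivl)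
  have "\<gamma> 0 \<in> carr (tube_manifold (M, lam) F)"
    by (rule integral_curve_in[OF assms(1)]) (use \<open>ln a \<le> 0\<close> in simp)
  then show ?thesis
    unfolding scaled_def liouville_flow_def tube_def fst_conv mem_Collect_eq seg
    using assms(1)[unfolded tube_def] by blast
qed

lemma scaled_subset: "scaled (1 / C) (tube (M, lam) H) \<subseteq> HH.tube_dom"
proof
  fix p assume p: "p \<in> scaled (1 / C) (tube (M, lam) H)"
  obtain \<gamma> where "integral_curve_on HH.tube_mf (liouville_field (tube (M, lam) H)) {ln (1 / C)..0} \<gamma>" "\<gamma> (ln (1 / C)) = p"
    by (rule scaledE[OF p]) (use C in auto)
  then show "p \<in> HH.tube_dom"
    using integral_curve_in[of HH.tube_mf _ "{ln (1 / C)..0}" \<gamma> "ln (1 / C)"] C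
    by (simp add: HH.carr_tube ln_div)
qed

lemma i_scaled:
  assumes p: "p \<in> scaled (1 / C) (tube (M, lam) H)"
  shows "i p \<in> GG.tube_dom"
proof -
  define T where "T = ln C"
  have T: "0 \<le> T" "ln (1 / C) = - T" "exp T = C" using C by (simp_all add: T_def ln_div)
  obtain \<gamma> where \<gamma>: "integral_curve_on HH.tube_mf (liouville_field (tube (M, lam) H)) {- T..0} \<gamma>" "\<gamma> (- T) = p"
    by (rule scaledE[OF p, unfolded T(2)]) (use C in auto)
  have q: "\<gamma> 0 \<in> HH.tube_dom" using integral_curve_in[OF \<gamma>(1), of 0] T(1) by (simp add: HH.carr_tube)
  have p: "p \<in> HH.tube_dom" using integral_curve_in[OF \<gamma>(1), of "- T"] T(1) \<gamma>(2) by (simp add: HH.carr_tube)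
  note w = HH.fst_tube[OF p]
  obtain s where s: "snd (\<gamma> 0) = of_real (cmod (snd (\<gamma> 0))) * cis (2 * pi * s)" using HH.polar_angle by blast
  have sn: "snd p = exp (- T / 2) *\<^sub>R snd (\<gamma> 0)"
    using exponential_curve[of "- T" 0 "\<lambda>s. snd (\<gamma> s)" 0 "- T", OF HH.tube_curve_snd[OF \<gamma>(1)]] T(1) \<gamma>(2) by simp
  have H0: "pi * (cmod (snd (\<gamma> 0)))\<^sup>2 \<le> H s (fst (\<gamma> 0))"
    using q HH.tube_iff[OF s, of "fst (\<gamma> 0)"] by simp
  have "pi * (cmod (snd p))\<^sup>2 = exp (- T) * (pi * (cmod (snd (\<gamma> 0)))\<^sup>2)"
    unfolding exp_curve_norm[OF sn] by simp
  also have "\<dots> \<le> exp (- T) * H s (fst (\<gamma> 0))" using H0 by simp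
  also have "\<dots> \<le> exp (- T) * H s (fst p)"
    using HH.H_nonincreasing[OF HH.tube_curve_fst[OF \<gamma>(1)], of "- T" 0 s] T(1) \<gamma>(2) by simp
  also have "exp (- T) * H s (fst p) = H s (fst p) / C" by (simp add: exp_minus T(3) field_simps)
  also have "\<dots> \<le> G s (\<phi> (fst p))" by (rule H_le_G[OF w])
  finally show ?thesis
    unfolding i_def GG.tube_iff[OF exp_curve_polar[OF sn s]] using \<phi>_props(7)[OF w] by simp
qed

text \<open>The point lies at time -2 ln C on a flow line of the tube over G. Before time - ln C,
  |z|^2 has shrunk enough to absorb the factor in G o \<phi> \<le> C H, so the stretch from -2 ln C
  to - ln C maps under (\<psi>, id) into the tube over H and is a flow line of length ln C
  there.\<close>

lemma scaled_i:
  assumes p: "p \<in> scaled (1 / C\<^sup>2) (tube (M, lam) G)"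
  shows "p \<in> i ` scaled (1 / C) (tube (M, lam) H)"
proof -
  define T where "T = ln C"
  have T: "0 \<le> T" "ln (1 / C) = - T" "exp T = C" "ln (1 / C\<^sup>2) = - (2 * T)"
    using C by (simp_all add: T_def ln_div ln_realpow)
  have C2: "1 / C\<^sup>2 \<le> 1" "0 < 1 / C\<^sup>2" using C by (simp_all add: divide_le_eq)
  obtain \<gamma> where \<gamma>: "integral_curve_on GG.tube_mf (liouville_field (tube (M, lam) G)) {- (2 * T)..0} \<gamma>" "\<gamma> (- (2 * T)) = p"
    by (rule scaledE[OF p C2(2,1), unfolded T(4)])
  have dom: "\<gamma> r \<in> GG.tube_dom" if "r \<in> {- (2 * T)..0}" for r
    using integral_curve_in[OF \<gamma>(1) that] by (simp add: GG.carr_tube)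
  note c1 = GG.tube_curve_fst[OF \<gamma>(1)]
  have c2: "integral_curve_on M (liouville_field (M, lam)) {- (2 * T)..0} (\<lambda>s. \<psi> (fst (\<gamma> s)))"
    by (rule integral_curve_map[OF at_M at_M c1 \<phi>_props(3)])
      (rule Symp_liouville_field[OF W \<psi>_Symp integral_curve_in[OF c1]])
  \<comment> \<open>The times -2T to -T of the given curve are relabelled -T to 0, so that the new
    curve starts in the tube over H.\<close>
  have shift: "s + - T \<in> {- (2 * T)..0}" if "s \<in> {- T..0}" for s using that T(1) by simp
  obtain a where a: "snd (\<gamma> 0) = of_real (cmod (snd (\<gamma> 0))) * cis (2 * pi * a)" using HH.polar_angle by blast
  have "0 \<in> {- (2 * T)..0}" using T(1) by simp
  note q = dom[OF this] and w0 = GG.fst_tube[OF dom[OF this]]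
  have G0: "pi * (cmod (snd (\<gamma> 0)))\<^sup>2 \<le> G a (fst (\<gamma> 0))"
    using q GG.tube_iff[OF a, of "fst (\<gamma> 0)"] by simp
  have "integral_curve_on HH.tube_mf (liouville_field (tube (M, lam) H)) {- T..0}
      (\<lambda>s. (\<psi> (fst (\<gamma> (s + - T))), snd (\<gamma> (s + - T))))"
  proof (rule HH.tube_curveI)
    show "integral_curve_on M (liouville_field (M, lam)) {- T..0} (\<lambda>s. \<psi> (fst (\<gamma> (s + - T))))"
      by (rule integral_curve_shift[OF c2 shift])
    show "((\<lambda>s. snd (\<gamma> (s + - T))) has_vector_derivative snd (\<gamma> (t + - T)) / 2) (at t within {- T..0})"
      if "t \<in> {- T..0}" for t
      using has_derivative_shift[OF GG.tube_curve_snd[OF \<gamma>(1) shift[OF that], unfolded has_vector_derivative_def] shift]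
      unfolding has_vector_derivative_def .
    fix t assume t: "t \<in> {- T..0}"
    let ?r = "t + - T"
    have r: "- (2 * T) \<le> ?r" "?r \<le> - T" "?r \<le> 0" using t T(1) by auto
    have sn: "snd (\<gamma> ?r) = exp (?r / 2) *\<^sub>R snd (\<gamma> 0)"
      using exponential_curve[of "- (2 * T)" 0 "\<lambda>s. snd (\<gamma> s)" 0 ?r, OF GG.tube_curve_snd[OF \<gamma>(1)]] r T(1) by simp
    have "pi * (cmod (snd (\<gamma> ?r)))\<^sup>2 = exp ?r * (pi * (cmod (snd (\<gamma> 0)))\<^sup>2)"
      unfolding exp_curve_norm[OF sn] by simp
    also have "\<dots> \<le> exp ?r * G a (fst (\<gamma> 0))" using G0 by simp
    also have "\<dots> \<le> exp ?r * (C * H a (\<psi> (fst (\<gamma> 0))))"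
      using bounds(2)[OF \<phi>_props(8)[OF w0], of a] \<phi>_props(6)[OF w0] by simp
    also have "\<dots> = exp (?r + T) * H a (\<psi> (fst (\<gamma> 0)))"
      by (simp only: exp_add T(3) mult.assoc)
    \<comment> \<open>Here \<open>?r\<close> \<le> - T is used: the contraction outweighs C.\<close>
    also have "\<dots> \<le> 1 * H a (\<psi> (fst (\<gamma> 0)))"
      using r(2) by (intro mult_right_mono HH.H_nonneg_pos(1) \<phi>_props(8) w0) simp
    also have "\<dots> \<le> H a (\<psi> (fst (\<gamma> ?r)))"
      using HH.H_nonincreasing[OF c2 r(1,3), of a] by simp
    finally show "(\<psi> (fst (\<gamma> ?r)), snd (\<gamma> ?r)) \<in> HH.tube_dom"
      unfolding HH.tube_iff[OF exp_curve_polar[OF sn a]]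
      using \<phi>_props(8)[OF GG.fst_tube[OF dom[OF shift[OF t]]]] by simp
  qed
  from scaledI[of H "1 / C", unfolded T(2), OF this]
  have "(\<psi> (fst (\<gamma> (- T + - T))), snd (\<gamma> (- T + - T))) \<in> scaled (1 / C) (tube (M, lam) H)"
    using C by simp
  moreover have "- T + - T = - (2 * T)" by simp
  ultimately have s: "(\<psi> (fst p), snd p) \<in> scaled (1 / C) (tube (M, lam) H)"
    using \<gamma>(2) by (simp only:)
  have "p \<in> GG.tube_dom" using dom[of "- (2 * T)"] T(1) \<gamma>(2) by simp
  then have "p = i (\<psi> (fst p), snd p)" using \<phi>_props(6)[OF GG.fst_tube] by (simp add: i_def)
  then show ?thesis using s by (rule image_eqI)
qed

section \<open>The embedding and its differential\<close>

lemma i_smooth: "smooth_map_on HH.tube_mf (scaled (1 / C) (tube (M, lam) H)) GG.tube_mf i"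
proof -
  let ?D = "scaled (1 / C) (tube (M, lam) H)"
  have D: "?D \<subseteq> carr HH.tube_mf" unfolding HH.carr_tube by (rule scaled_subset)
  have 1: "smooth_map_on HH.tube_mf ?D M (\<lambda>p. \<phi> (fst p))"
    by (rule smooth_map_on_compose[OF HH.at_tube at_M smooth_map_on_subset[OF HH.tube_fst_smooth D] \<phi>_props(2)])
      (use smooth_map_in[OF HH.tube_fst_smooth] in auto)
  have 2: "smooth_map_on HH.tube_mf ?D (cylinder M) i"
    unfolding i_def by (rule smooth_map_on_cylinder_Pair[OF HH.at_tube at_M 1 smooth_map_on_subset[OF HH.tube_snd_smooth D]])
  show ?thesis
    by (rule smooth_map_on_compose[OF HH.at_tube smooth_atlas_cylinder[OF at_M] 2 GG.tube_ident_smooth(2) i_scaled])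
qed

text \<open>The inverse is the restriction of the continuous map (w, z) |-> (\<psi> w, z).\<close>

lemma i_embedding_map:
  "embedding_map (subtopology (mspace HH.tube_mf) (scaled (1 / C) (tube (M, lam) H))) (mspace GG.tube_mf) i"
proof -
  let ?D = "scaled (1 / C) (tube (M, lam) H)"
  let ?X = "subtopology (mspace HH.tube_mf) ?D"
  let ?Y = "subtopology (mspace GG.tube_mf) (i ` topspace ?X)"
  let ?j = "\<lambda>p. (\<psi> (fst p), snd p)"
  have top: "topspace ?X = ?D" using scaled_subset HH.carr_tube by auto
  have ji: "?j (i p) = p" if "p \<in> ?D" for p
    using \<phi>_props(5)[OF HH.fst_tube[OF subsetD[OF scaled_subset that]]] by (simp add: i_def)
  have "continuous_map ?X ?Y i"
    by (rule continuous_map_into_subtopology[OF smooth_map_onD(1)[OF i_smooth]]) auto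
  moreover have "continuous_map ?Y ?X ?j"
  proof -
    have f: "continuous_map ?Y (mspace M) fst"
      using smooth_map_onD(1)[OF GG.tube_fst_smooth] by (intro continuous_map_from_subtopology) simp
    have s: "continuous_map ?Y euclidean snd"
      using smooth_map_onD(1)[OF GG.tube_snd_smooth] by (intro continuous_map_from_subtopology) simp
    have "continuous_map (mspace M) (mspace M) \<psi>" using smooth_map_onD(1)[OF \<phi>_props(3)] by simp
    from continuous_map_compose[OF f this]
    have "continuous_map ?Y (prod_topology (mspace M) euclidean) ?j"
      using s by (simp add: continuous_map_pairwise comp_def)
    then have "continuous_map ?Y (subtopology (prod_topology (mspace M) euclidean) (HH.tube_dom \<inter> ?D)) ?j"
    proof (rule continuous_map_into_subtopology)
      have "?j (i p) \<in> HH.tube_dom \<inter> ?D" if "p \<in> ?D" for p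
        unfolding ji[OF that] using that scaled_subset by blast
      then show "?j \<in> topspace ?Y \<rightarrow> HH.tube_dom \<inter> ?D" unfolding top by auto
    qed
    then show ?thesis
      by (simp add: tube_manifold_def domain_manifold_simps cylinder_simps subtopology_subtopology)
  qed
  moreover have "i (?j y) = y" if "y \<in> i ` ?D" for y
    using that ji by auto
  ultimately have "homeomorphic_maps ?X ?Y i ?j"
    unfolding homeomorphic_maps_def top using ji by auto
  then show ?thesis unfolding embedding_map_def homeomorphic_map_maps by blast
qed

text \<open>\<open>L\<close> is the lift of (D\<phi>, id) through the projections. Its injectivity
  follows from the left inverse D\<psi>; the forms agree because \<phi> preserves \<lambda> and z is
  left unchanged.\<close>

lemma i_derivative:
  assumes p: "p \<in> scaled (1 / C) (tube (M, lam) H)"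
  obtains L where "has_mderiv_on HH.tube_mf (scaled (1 / C) (tube (M, lam) H)) GG.tube_mf i p L" "inj L"
    "\<And>v. tube_form (M, lam) G (i p) (L v) = tube_form (M, lam) H p v"
proof -
  let ?D = "scaled (1 / C) (tube (M, lam) H)"
  have pd: "p \<in> HH.tube_dom" using p scaled_subset by blast
  then have pt: "p \<in> carr HH.tube_mf" by (simp add: HH.carr_tube)
  have D: "?D \<subseteq> carr HH.tube_mf" unfolding HH.carr_tube by (rule scaled_subset)
  note w = HH.fst_tube[OF pd]
  obtain A where A: "\<And>v. A (HH.pr1 p v, HH.pr2 p v) = v" using HH.tube_derivative_iso[OF pd] by metis
  obtain B where B: "\<And>y. (GG.pr1 (i p) (B y), GG.pr2 (i p) (B y)) = y"
    using GG.tube_derivative_iso[OF i_scaled[OF p]] by metis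
  define L where "L v = B (mderiv M M \<phi> (fst p) (HH.pr1 p v), HH.pr2 p v)" for v
  have L: "GG.pr1 (i p) (L v) = mderiv M M \<phi> (fst p) (HH.pr1 p v)" "GG.pr2 (i p) (L v) = HH.pr2 p v" for v
    using B[of "(mderiv M M \<phi> (fst p) (HH.pr1 p v), HH.pr2 p v)"] by (simp_all add: L_def)
  have "has_mderiv_on HH.tube_mf ?D M (\<lambda>p. \<phi> (fst p)) p (\<lambda>v. mderiv M M \<phi> (fst p) (HH.pr1 p v))"
  proof (rule has_mderiv_on_mono[OF _ D])
    show "has_mderiv_on HH.tube_mf (carr HH.tube_mf) M (\<lambda>p. \<phi> (fst p)) p (\<lambda>v. mderiv M M \<phi> (fst p) (HH.pr1 p v))"
      by (rule has_mderiv_on_chain[OF HH.at_tube at_M smooth_map_onD(1)[OF HH.tube_fst_smooth]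
            mderiv(1)[OF HH.at_tube at_M HH.tube_fst_smooth pt] mderiv(1)[OF at_M at_M \<phi>_props(2) w] pt pt])
  qed
  then have d1: "has_mderiv_on HH.tube_mf ?D M (\<lambda>x. fst (i x)) p (\<lambda>v. GG.pr1 (i p) (L v))"
    unfolding fst_i L(1) .
  have d2: "has_mderiv_on HH.tube_mf ?D euclidean_manifold (\<lambda>x. snd (i x)) p (\<lambda>v. GG.pr2 (i p) (L v))"
    unfolding snd_i L(2)
    by (rule has_mderiv_on_mono[OF mderiv(1)[OF HH.at_tube smooth_atlas_euclidean HH.tube_snd_smooth pt] D])
  show thesis
  proof (rule that)
    show "has_mderiv_on HH.tube_mf ?D GG.tube_mf i p L"
      by (rule GG.has_mderiv_on_tube_lift[OF HH.at_tube smooth_map_onD(1)[OF i_smooth] p pt i_scaled[OF p] d1 d2])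
    show "inj L"
    proof (rule injI)
      fix u v assume uv: "L u = L v"
      then have "mderiv M M \<phi> (fst p) (HH.pr1 p u) = mderiv M M \<phi> (fst p) (HH.pr1 p v)"
        and 2: "HH.pr2 p u = HH.pr2 p v" unfolding L[symmetric] by simp_all
      then have "mderiv M M \<psi> (\<phi> (fst p)) (mderiv M M \<phi> (fst p) (HH.pr1 p u))
        = mderiv M M \<psi> (\<phi> (fst p)) (mderiv M M \<phi> (fst p) (HH.pr1 p v))" by simp
      moreover have "mderiv M M \<psi> (\<phi> (fst p)) (mderiv M M \<phi> (fst p) y) = y" for y
        by (rule mderiv_left_inverse[OF at_M at_M \<phi>_props(2,3,5) w])
      ultimately have "HH.pr1 p u = HH.pr1 p v" by metis
      then have "A (HH.pr1 p u, HH.pr2 p u) = A (HH.pr1 p v, HH.pr2 p v)" using 2 by simp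
      then show "u = v" unfolding A .
    qed
    show "tube_form (M, lam) G (i p) (L v) = tube_form (M, lam) H p v" for v
      unfolding HH.tube_form_eq GG.tube_form_eq L fst_i snd_i \<phi>_props(4)[OF w] ..
  qed
qed

lemma SBM_admissible: "SBM_admissible (tube (M, lam) H) (tube (M, lam) G) C"
proof -
  let ?D = "scaled (1 / C) (tube (M, lam) H)"
  have t: "fst (tube (M, lam) H) = HH.tube_mf" "fst (tube (M, lam) G) = GG.tube_mf"
    "snd (tube (M, lam) H) = tube_form (M, lam) H" "snd (tube (M, lam) G) = tube_form (M, lam) G"
    by (simp_all add: tube_def)
  have "liouville_embedding (tube (M, lam) H) ?D (tube (M, lam) G) i"
    unfolding liouville_embedding_def t
  \<comment> \<open>The tube form is preserved exactly, so the primitive of the difference is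
    0.\<close>
  proof (intro conjI ballI exI[of _ "\<lambda>p. 0 :: real"])
    show "smooth_map_on HH.tube_mf ?D GG.tube_mf i" by (rule i_smooth)
    show "embedding_map (subtopology (mspace HH.tube_mf) ?D) (mspace GG.tube_mf) i" by (rule i_embedding_map)
    show "\<exists>L. has_mderiv_on HH.tube_mf ?D GG.tube_mf i p L \<and> inj L" if "p \<in> ?D" for p
      using i_derivative[OF that] by metis
    show "smooth_map_on HH.tube_mf ?D euclidean_manifold (\<lambda>p. 0 :: real)" by (rule smooth_map_on_const)
    fix p assume p: "p \<in> ?D"
    obtain L where L: "has_mderiv_on HH.tube_mf ?D GG.tube_mf i p L"
      "\<And>v. tube_form (M, lam) G (i p) (L v) = tube_form (M, lam) H p v"
      using i_derivative[OF p] by metis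
    show "\<exists>L K. has_mderiv_on HH.tube_mf ?D GG.tube_mf i p L \<and>
        has_mderiv_on HH.tube_mf ?D euclidean_manifold (\<lambda>p. 0 :: real) p K \<and>
        (\<forall>v. tube_form (M, lam) G (i p) (L v) - tube_form (M, lam) H p v = K v)"
      by (rule exI[of _ L], rule exI[of _ "\<lambda>v. 0"]) (simp add: L has_mderiv_on_euclidean_const)
  qed
  moreover have "scaled (1 / C\<^sup>2) (tube (M, lam) G) \<subseteq> i ` ?D" using scaled_i by blast
  moreover have "i ` ?D \<subseteq> lcarr (tube (M, lam) G)"
    unfolding t GG.carr_tube using i_scaled by blast
  ultimately show ?thesis unfolding SBM_admissible_def by blast
qed

end

theorem theorem1:
  fixes M :: "('a, 'e::euclidean_space) manifold"
    and lam :: "'a \<Rightarrow> 'e \<Rightarrow> real"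
    and H G :: "real \<Rightarrow> 'a \<Rightarrow> real"
  assumes "liouville_domain (M, lam)"
    and "H \<in> Ham_plus (M, lam)"
    and "G \<in> Ham_plus (M, lam)"
  shows "d_SBM (tube (M, lam) H) (tube (M, lam) G) \<le> d_T (M, lam) H G"
  unfolding d_SBM_def d_T_def fst_conv
\<comment> \<open>Both distances are infima of ln C, so each constant of the Thompson type is shown
  to be admissible for the other distance.\<close>
proof (rule Inf_superset_mono, rule subsetI)
  fix x assume "x \<in> {ereal (ln C) | C. 1 \<le> C \<and> (\<exists>\<phi>\<in>Symp (M, lam). \<forall>t. \<forall>w\<in>carr M.
      (1 / C) * H t w \<le> G t (\<phi> w) \<and> G t (\<phi> w) \<le> C * H t w)}"
  then obtain C \<phi> where x: "x = ereal (ln C)" and C: "1 \<le> C" and \<phi>: "\<phi> \<in> Symp (M, lam)"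
    and b: "\<And>t w. w \<in> carr M \<Longrightarrow> (1 / C) * H t w \<le> G t (\<phi> w)"
      "\<And>t w. w \<in> carr M \<Longrightarrow> G t (\<phi> w) \<le> C * H t w"
    by blast
  have M: "smooth_atlas M" by (rule liouville_domainD(1)[OF assms(1)])
  let ?\<psi> = "inv_into (carr M) \<phi>"
  note s = SympD[OF \<phi>]
  interpret HG: tube_pair M lam H G \<phi> C
    by unfold_locales (use assms \<phi> C b in simp_all)
  \<comment> \<open>The hypotheses are symmetric: exchanging H and G and passing to the inverse of
    \<phi> turns each of the two bounds into the other.\<close>
  interpret GH: tube_pair M lam G H ?\<psi> C
  proof unfold_locales
    show "?\<psi> \<in> Symp (M, lam)" by (rule Symp_inv_into[OF M \<phi>])
    fix t w assume w: "w \<in> carr M"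
    note w' = s(8)[OF w] s(6)[OF w]
    show "(1 / C) * G t w \<le> H t (?\<psi> w)"
      using b(2)[OF w'(1), of t] C unfolding w'(2) by (simp add: divide_le_eq mult.commute)
    show "H t (?\<psi> w) \<le> C * G t w"
      using b(1)[OF w'(1), of t] C unfolding w'(2) by (simp add: divide_le_eq mult.commute)
  qed (use assms C in simp_all)
  show "x \<in> {ereal (ln C) | C. 1 \<le> C \<and> SBM_admissible (tube (M, lam) H) (tube (M, lam) G) C \<and>
      SBM_admissible (tube (M, lam) G) (tube (M, lam) H) C}"
    using x C HG.SBM_admissible GH.SBM_admissible by blast
qed

end
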